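(* Let $k\ge2$ be a fixed integer and let $\alpha>\beta>0$ be fixed constants. For even $n$ let $p=\frac{\alpha\log n}{\binom{n-1}{k-1}}$, $q=\frac{\beta\log n}{\binom{n-1}{k-1}}$, and let $(\sigma,\mathcal{H})\sim\mathsf{HSBM}(n,p,q;k)$. Let $\widehat\sigma_{trunc}(\mathcal{H})$ be an optimal solution of $$\text{maximize }\sum_{\{i,j\}\in\binom{V}{2}}w(ij)x_ix_j\quad\text{subject to}\quad x\in\{\pm1\}^V,\ \sum_{v\in V}x_v=0,$$ where $w(ij)$ is the number of hyperedges of $\mathcal{H}$ containing both $i$ and $j$. Define $$I_2(\alpha,\beta)=\max_{t\ge0}\frac{1}{2^{k-1}}\left[\alpha\left(1-e^{-(k-1)t}\right)+\sum_{a=1}^{k-1}\beta\binom{k-1}{a}\left(1-e^{-(k-1-2a)t}\right)\right].$$ If $I_2(\alpha,\beta)<1$, then $\widehat\sigma_{trunc}(\mathcal{H})\notin\{\sigma,-\sigma\}$ with probability $1-o(1)$. On the other hand, if $I_2(\alpha,\beta)>1$, then $\widehat\sigma_{trunc}(\mathcal{H})\in\{\sigma,-\sigma\}$ with probability $1-o(1)$.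
   Context: Model: let $n$ be an even positive integer, $V=\{1,\dots,n\}$, $\binom{V}{k}$ the collection of $k$-element subsets of $V$, and $p,q\in[0,1]$. The model $\mathsf{HSBM}(n,p,q;k)$ samples a pair $(\sigma,\mathcal{H})$ as follows. First $\sigma\in\{\pm1\}^V$ is chosen uniformly at random among vectors with equally many $+1$'s and $-1$'s. Then, given $\sigma$, $\mathcal{H}$ is a random $k$-uniform hypergraph on $V$ in which each $e=\{e_1,\dots,e_k\}\in\binom{V}{k}$ is a hyperedge independently, with probability $p$ if $\sigma_{e_1}=\cdots=\sigma_{e_k}$ and with probability $q$ otherwise. Asymptotics are as $n\to\infty$ along even integers with $k,\alpha,\beta$ fixed. *)

theory Defs
  imports "HOL-Probability.Probability" "HOL-Library.Ramsey"
begin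

(* A vector in {+1,-1}^V with V = {1..n} is an integer-valued function on nat that vanishes
   outside V; thus equality of functions is equality of vectors, and the negated vector is
   the pointwise negation. *)
definition sign_vectors :: "nat \<Rightarrow> (nat \<Rightarrow> int) set" where
  "sign_vectors n = PiE_dflt {1..n} 0 (\<lambda>_. {1, -1})"

definition balanced_labels :: "nat \<Rightarrow> (nat \<Rightarrow> int) set" where
  "balanced_labels n =
     {\<sigma> \<in> sign_vectors n. card {v \<in> {1..n}. \<sigma> v = 1} = card {v \<in> {1..n}. \<sigma> v = -1}}"

definition monochromatic :: "(nat \<Rightarrow> int) \<Rightarrow> nat set \<Rightarrow> bool" where
  "monochromatic \<sigma> e \<longleftrightarrow> (\<forall>u\<in>e. \<forall>v\<in>e. \<sigma> u = \<sigma> v)"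

(* A k-uniform hypergraph is its set of hyperedges, a subset of nsets {1..n} k, the k-element
   subsets of V.  bernoulli_pmf clamps its parameter to [0,1], so this is the intended
   model whenever p and q lie in [0,1]. *)
definition HSBM :: "nat \<Rightarrow> real \<Rightarrow> real \<Rightarrow> nat \<Rightarrow> ((nat \<Rightarrow> int) \<times> nat set set) pmf" where
  "HSBM n p q k =
     bind_pmf (pmf_of_set (balanced_labels n)) (\<lambda>\<sigma>.
       map_pmf (\<lambda>X. (\<sigma>, {e. X e}))
         (Pi_pmf (nsets {1..n} k) False
           (\<lambda>e. bernoulli_pmf (if monochromatic \<sigma> e then p else q))))"

(* For fixed c > 0 and k >= 2 this tends to 0, so it lies in [0,1] for all large n. *)
definition edge_prob :: "nat \<Rightarrow> real \<Rightarrow> nat \<Rightarrow> real" where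
  "edge_prob k c n = c * ln (real n) / real ((n - 1) choose (k - 1))"

definition pair_weight :: "nat set set \<Rightarrow> nat set \<Rightarrow> nat" where
  "pair_weight H f = card {e \<in> H. f \<subseteq> e}"

(* The product over the two elements of f = {i, j} is x_i x_j. *)
definition trunc_objective :: "nat \<Rightarrow> nat set set \<Rightarrow> (nat \<Rightarrow> int) \<Rightarrow> int" where
  "trunc_objective n H x =
     (\<Sum>f \<in> nsets {1..n} 2. int (pair_weight H f) * (\<Prod>v\<in>f. x v))"

definition trunc_optimal :: "nat \<Rightarrow> nat set set \<Rightarrow> (nat \<Rightarrow> int) \<Rightarrow> bool" where
  "trunc_optimal n H x \<longleftrightarrow>
     is_arg_max (trunc_objective n H) (\<lambda>x. x \<in> sign_vectors n \<and> (\<Sum>v\<in>{1..n}. x v) = 0) x"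

definition I2_fun :: "nat \<Rightarrow> real \<Rightarrow> real \<Rightarrow> real \<Rightarrow> real" where
  "I2_fun k \<alpha> \<beta> t =
     1 / 2 ^ (k - 1) *
       (\<alpha> * (1 - exp (- (real k - 1) * t)) +
        (\<Sum>a = 1..k - 1. \<beta> * real ((k - 1) choose a) * (1 - exp (- (real k - 1 - 2 * real a) * t))))"

(* The supremum is a maximum whenever k >= 2 and the constants are positive: lemma I2_max. *)
definition I2 :: "nat \<Rightarrow> real \<Rightarrow> real \<Rightarrow> real" where
  "I2 k \<alpha> \<beta> = (SUP t\<in>{0..}. I2_fun k \<alpha> \<beta> t)"

lemma I2_max:
  assumes k: "k \<ge> 2" and "\<alpha> > 0" and "\<beta> > 0"
  shows "\<exists>t\<ge>0. I2 k \<alpha> \<beta> = I2_fun k \<alpha> \<beta> t \<and> (\<forall>s\<ge>0. I2_fun k \<alpha> \<beta> s \<le> I2_fun k \<alpha> \<beta> t)"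
proof -
  define B where "B = (\<Sum>a = 1..<k - 1. \<beta> * real ((k - 1) choose a))"
  define T where "T = (\<alpha> + B) / \<beta>"
  have B0: "B \<ge> 0" unfolding B_def using assms by (intro sum_nonneg) auto
  have T0: "T \<ge> 0" unfolding T_def using assms B0 by auto
  have neg: "I2_fun k \<alpha> \<beta> s \<le> 0" if s: "s \<ge> T" for s
  proof -
    have s0: "s \<ge> 0" using s T0 by linarith
    have split: "{1..k - 1} = insert (k - 1) {1..<k - 1}" using k by auto
    have "(\<Sum>a = 1..k - 1. \<beta> * real ((k - 1) choose a) * (1 - exp (- (real k - 1 - 2 * real a) * s)))
        = \<beta> * (1 - exp ((real k - 1) * s)) +
          (\<Sum>a = 1..<k - 1. \<beta> * real ((k - 1) choose a) * (1 - exp (- (real k - 1 - 2 * real a) * s)))"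
      unfolding split using k by (simp add: of_nat_diff algebra_simps)
    moreover have "(\<Sum>a = 1..<k - 1. \<beta> * real ((k - 1) choose a) * (1 - exp (- (real k - 1 - 2 * real a) * s))) \<le> B"
      unfolding B_def using assms by (intro sum_mono mult_left_le) auto
    moreover have "\<alpha> * (1 - exp (- (real k - 1) * s)) \<le> \<alpha>"
      using assms by (intro mult_left_le) auto
    moreover have "\<beta> * (1 - exp ((real k - 1) * s)) \<le> \<beta> * (- s)"
    proof (rule mult_left_mono)
      have "s \<le> (real k - 1) * s" using k s0 by (simp add: mult_le_cancel_right1)
      then show "1 - exp ((real k - 1) * s) \<le> - s"
        using exp_ge_add_one_self[of "(real k - 1) * s"] by linarith
    qed (use assms in auto)
    moreover have "\<alpha> + B \<le> \<beta> * s" using s assms unfolding T_def by (simp add: field_simps)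
    ultimately show ?thesis unfolding I2_fun_def
      by (intro mult_nonneg_nonpos) (simp, linarith)
  qed
  have "continuous_on {0..T} (I2_fun k \<alpha> \<beta>)"
    unfolding I2_fun_def by (intro continuous_intros)
  with T0 obtain t where t: "t \<in> {0..T}" "\<And>s. s \<in> {0..T} \<Longrightarrow> I2_fun k \<alpha> \<beta> s \<le> I2_fun k \<alpha> \<beta> t"
    using continuous_attains_sup[of "{0..T}" "I2_fun k \<alpha> \<beta>"] by auto
  have "I2_fun k \<alpha> \<beta> 0 = 0" by (simp add: I2_fun_def)
  with t(2)[of 0] T0 have "0 \<le> I2_fun k \<alpha> \<beta> t" by simp
  have max: "I2_fun k \<alpha> \<beta> s \<le> I2_fun k \<alpha> \<beta> t" if "s \<ge> 0" for s
  proof (cases "s \<le> T")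
    case True
    with t(2) that show ?thesis by simp
  next
    case False
    then have "I2_fun k \<alpha> \<beta> s \<le> 0" by (intro neg) linarith
    with \<open>0 \<le> I2_fun k \<alpha> \<beta> t\<close> show ?thesis by linarith
  qed
  have "I2 k \<alpha> \<beta> = I2_fun k \<alpha> \<beta> t" unfolding I2_def
    by (rule cSup_eq_maximum) (use t(1) max in auto)
  with max t(1) show ?thesis by auto
qed

lemma finite_sign_vectors: "finite (sign_vectors n)"
  unfolding sign_vectors_def by (intro finite_PiE_dflt) auto

lemma balanced_labels_nonempty:
  assumes "even n"
  shows "balanced_labels n \<noteq> {}"
proof -
  obtain m where n: "n = 2 * m" using assms by blast
  define x :: "nat \<Rightarrow> int" where
    "x v = (if v \<in> {1..m} then 1 else if v \<in> {m + 1..n} then -1 else 0)" for v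
  have "{v \<in> {1..n}. x v = 1} = {1..m}" "{v \<in> {1..n}. x v = -1} = {m + 1..n}"
    by (auto simp: x_def n)
  moreover have "x \<in> sign_vectors n" by (auto simp: sign_vectors_def PiE_dflt_def x_def n)
  ultimately have "x \<in> balanced_labels n" by (simp add: balanced_labels_def n)
  then show ?thesis by blast
qed

(* The feasible set of the optimization problem is the support of the label distribution. *)
lemma balanced_labels_sum:
  "balanced_labels n = {x \<in> sign_vectors n. (\<Sum>v\<in>{1..n}. x v) = 0}"
proof -
  have "(\<Sum>v\<in>{1..n}. x v) =
      int (card {v \<in> {1..n}. x v = 1}) - int (card {v \<in> {1..n}. x v = -1})"
    if "x \<in> sign_vectors n" for x
  proof -
    have "(\<Sum>v\<in>{1..n}. x v) =
        (\<Sum>v\<in>{1..n}. (if x v = 1 then 1 else 0) - (if x v = -1 then 1 else 0))"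
      using that by (intro sum.cong) (auto simp: sign_vectors_def PiE_dflt_def)
    then show ?thesis
      by (simp only: sum_subtractf sum.If_cases[OF finite_atLeastAtMost] Collect_conj_eq
          Collect_mem_eq) simp
  qed
  then show ?thesis by (auto simp: balanced_labels_def)
qed

lemma trunc_optimal_exists:
  assumes "even n"
  shows "\<exists>x. trunc_optimal n H x"
proof -
  have "finite (balanced_labels n)"
    using finite_sign_vectors by (simp add: balanced_labels_def)
  then have "\<exists>x. is_arg_max (trunc_objective n H) (\<lambda>x. x \<in> balanced_labels n) x"
    using ex_is_arg_min_if_finite[of "balanced_labels n" "\<lambda>x. - trunc_objective n H x"]
      balanced_labels_nonempty[OF assms]
    by (auto simp: is_arg_min_def is_arg_max_def)
  then show ?thesis by (simp add: trunc_optimal_def balanced_labels_sum)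
qed

end

theory Submission
  imports Defs "HOL-Real_Asymp.Real_Asymp"
begin

text \<open>
  Up to constants the objective is \<open>\<Sum>\<^bsub>e \<in> H\<^esub> (\<Sum>\<^bsub>v \<in> e\<^esub> x\<^sub>v)\<^sup>2\<close>, so flipping a vertex set \<open>D\<close>
  changes it by a weighted sum of independent Bernoulli variables, and a vertex \<open>u\<close> in such a flip
  contributes a variable whose moment generating function at \<open>- t\<close> is \<open>n\<close> to the power
  \<open>- I2_fun t + o(1)\<close>.

  If \<open>I2 > 1\<close>, the Chernoff bound gives probability at most \<open>n\<close> to the power \<open>- |D| (1 + \<delta>)\<close> that
  flipping \<open>D\<close> does not hurt as long as \<open>|D| \<le> \<epsilon> n\<close>, and \<open>exp (- c n ln n)\<close> for larger \<open>D\<close>; a union bound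
  over all \<open>D\<close> finishes this half.

  If \<open>I2 < 1\<close>, choose \<open>T\<close> consisting of \<open>n\<close> to the power \<open>1 - d\<close> vertices of each class. The edges meeting \<open>T\<close>
  in a single vertex are independent for different vertices of \<open>T\<close>, so some vertex of \<open>T\<close> in each class
  gains of order \<open>ln n\<close> from being flipped on those edges, while the edges meeting \<open>T\<close> at least
  twice contribute less than that. Exchanging the two vertices improves on the true labels.
\<close>

section \<open>Independent Bernoulli fields\<close>

text \<open>The exponent \<open>I2_fun\<close> arises because an edge through \<open>u\<close> with
  \<open>a\<close> further vertices in the other class changes the objective in proportion to
  \<open>k - 1 - 2 * a\<close>, and a fraction of about
  \<open>(k - 1 choose a) / 2 ^ (k - 1)\<close> of the edges through \<open>u\<close> has this
  shape. The threshold is 1 because the choice of \<open>D\<close> costs up to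
  \<open>n ^ |D|\<close> in the union bound. For \<open>|D|\<close> linear in \<open>n\<close> the
  edges meeting \<open>D\<close> twice are no longer negligible, so counting vertex by vertex breaks
  down. There the complete hypergraph serves as a reference: its total change under a balanced flip
  is 0, and the surplus \<alpha> - \<beta> on monochromatic edges leaves a drift of order
  \<open>n * ln n\<close>, which beats the \<open>2 ^ n\<close> choices of \<open>D\<close>. Below
  the threshold, a merely positive gain would not survive the edges meeting \<open>T\<close> twice.
  This is why a gain of order \<open>ln n\<close> is demanded and why the tilt lies slightly beyond
  the maximizer of \<open>I2_fun\<close>: at a positive maximizer the derivative, and with it the
  tilted mean, is 0.\<close>

definition bernoulli_field :: "'a set \<Rightarrow> ('a \<Rightarrow> real) \<Rightarrow> ('a \<Rightarrow> bool) pmf" where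
  "bernoulli_field E r = Pi_pmf E False (\<lambda>e. bernoulli_pmf (r e))"

lemma set_bernoulli_field:
  assumes "finite E" "X \<in> set_pmf (bernoulli_field E r)"
  shows "{e. X e} \<subseteq> E"
  using set_Pi_pmf_subset[of E False "\<lambda>e. bernoulli_pmf (r e)"] assms
  unfolding bernoulli_field_def by auto

lemma finite_set_bernoulli_field:
  assumes "finite E"
  shows "finite (set_pmf (bernoulli_field E r))"
proof (rule finite_subset)
  show "set_pmf (bernoulli_field E r) \<subseteq> PiE_dflt E False (\<lambda>_. UNIV)"
    unfolding bernoulli_field_def by (rule order.trans[OF set_Pi_pmf_subset'[OF assms]])
      (auto simp: PiE_dflt_def)
  show "finite (PiE_dflt E False (\<lambda>_. UNIV :: bool set))"
    using assms by (intro finite_PiE_dflt) auto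
qed

lemma integrable_bernoulli_field:
  fixes f :: "('a \<Rightarrow> bool) \<Rightarrow> real"
  assumes "finite E"
  shows "integrable (measure_pmf (bernoulli_field E r)) f"
  using finite_set_bernoulli_field[OF assms] by (rule integrable_measure_pmf_finite)

lemma expectation_exp_bernoulli_field:
  assumes E: "finite E" "F \<subseteq> E" and r: "\<And>e. e \<in> F \<Longrightarrow> 0 \<le> r e \<and> r e \<le> 1"
  shows "measure_pmf.expectation (bernoulli_field E r) (\<lambda>X. exp (\<Sum>e\<in>F. c e * of_bool (X e)))
     = (\<Prod>e\<in>F. 1 + r e * (exp (c e) - 1))"
proof -
  \<comment> \<open>Factors equal to 1 outside \<open>F\<close> extend the product to the whole
    index set \<open>E\<close>, where \<open>expectation_prod_Pi_pmf\<close> applies.\<close>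
  define f :: "'a \<Rightarrow> bool \<Rightarrow> real" where
    "f e b = (if e \<in> F then exp (c e * of_bool b) else 1)" for e b
  have EF: "E \<inter> F = F" using E by auto
  have "(\<Prod>e\<in>E. f e (X e)) = exp (\<Sum>e\<in>F. c e * of_bool (X e))" for X
    unfolding f_def prod.inter_restrict[OF E(1), symmetric] EF
    by (rule exp_sum[OF finite_subset[OF E(2,1)], symmetric])
  then have "measure_pmf.expectation (bernoulli_field E r) (\<lambda>X. exp (\<Sum>e\<in>F. c e * of_bool (X e)))
     = measure_pmf.expectation (bernoulli_field E r) (\<lambda>X. \<Prod>e\<in>E. f e (X e))"
    by simp
  also have "\<dots> = (\<Prod>e\<in>E. measure_pmf.expectation (bernoulli_pmf (r e)) (f e))"
    unfolding bernoulli_field_def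
    by (intro expectation_prod_Pi_pmf E integrable_measure_pmf_finite finite) (auto simp: f_def)
  also have "\<dots> = (\<Prod>e\<in>E. if e \<in> F then 1 + r e * (exp (c e) - 1) else 1)"
  proof (intro prod.cong refl)
    fix e
    have "f e = (\<lambda>b. exp (c e * of_bool b))" if "e \<in> F" using that by (auto simp: f_def)
    moreover have "f e = (\<lambda>_. 1)" if "e \<notin> F" using that by (auto simp: f_def)
    ultimately show "measure_pmf.expectation (bernoulli_pmf (r e)) (f e)
        = (if e \<in> F then 1 + r e * (exp (c e) - 1) else 1)"
      using r[of e] by (auto simp: algebra_simps)
  qed
  also have "\<dots> = (\<Prod>e\<in>F. 1 + r e * (exp (c e) - 1))"
    unfolding prod.inter_restrict[OF E(1), symmetric] EF ..
  finally show ?thesis .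
qed

lemma prod_one_plus_le_exp:
  fixes x :: "'a \<Rightarrow> real"
  assumes "\<And>e. e \<in> F \<Longrightarrow> - 1 \<le> x e"
  shows "(\<Prod>e\<in>F. 1 + x e) \<le> exp (\<Sum>e\<in>F. x e)"
proof (cases "finite F")
  case True
  have "(\<Prod>e\<in>F. 1 + x e) \<le> (\<Prod>e\<in>F. exp (x e))"
    using assms by (intro prod_mono) (force intro: exp_ge_add_one_self)
  then show ?thesis by (simp add: exp_sum True)
qed auto

text \<open>Follows from \<open>ln (1 + x) \<ge> x - 2 * x\<^sup>2\<close> for
  \<open>|x| \<le> 1 / 2\<close> and from \<open>x\<^sup>2 \<le> \<eta> * |x|\<close>. The error is
  kept linear in \<open>|x|\<close> because sums of absolute values are evaluated by the same star
  sums as the main term.\<close>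

lemma prod_one_plus_ge_exp:
  fixes x :: "'a \<Rightarrow> real"
  assumes "finite F" "\<And>e. e \<in> F \<Longrightarrow> \<bar>x e\<bar> \<le> \<eta>" "\<eta> \<le> 1 / 2"
  shows "exp ((\<Sum>e\<in>F. x e) - 2 * \<eta> * (\<Sum>e\<in>F. \<bar>x e\<bar>)) \<le> (\<Prod>e\<in>F. 1 + x e)"
proof -
  have "exp ((\<Sum>e\<in>F. x e) - 2 * \<eta> * (\<Sum>e\<in>F. \<bar>x e\<bar>)) = (\<Prod>e\<in>F. exp (x e - 2 * \<eta> * \<bar>x e\<bar>))"
    using assms(1) by (simp add: exp_sum sum_subtractf sum_distrib_left flip: exp_sum)
  also have "\<dots> \<le> (\<Prod>e\<in>F. 1 + x e)"
  proof (intro prod_mono conjI)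
    fix e assume e: "e \<in> F"
    have x: "\<bar>x e\<bar> \<le> 1/2" using assms(2)[OF e] assms(3) by linarith
    have "x e - 2 * (x e)\<^sup>2 \<le> ln (1 + x e)"
    proof (cases "x e \<ge> 0")
      case True
      then show ?thesis using ln_one_plus_pos_lower_bound[of "x e"] zero_le_power2[of "x e"] x by linarith
    next
      case False
      then show ?thesis
        using ln_one_minus_pos_lower_bound[of "- x e"] x by auto
    qed
    moreover have "(x e)\<^sup>2 \<le> \<eta> * \<bar>x e\<bar>"
      using mult_right_mono[OF assms(2)[OF e], of "\<bar>x e\<bar>"] by (simp add: power2_eq_square)
    ultimately have "x e - 2 * \<eta> * \<bar>x e\<bar> \<le> ln (1 + x e)" by linarith
    moreover have "0 < 1 + x e" using x by linarith
    ultimately show "exp (x e - 2 * \<eta> * \<bar>x e\<bar>) \<le> 1 + x e"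
      by (metis exp_ln exp_le_cancel_iff)
  qed auto
  finally show ?thesis .
qed

lemma mgf_bernoulli_field_le:
  assumes E: "finite E" "F \<subseteq> E" and r: "\<And>e. e \<in> F \<Longrightarrow> 0 \<le> r e \<and> r e \<le> 1"
  shows "measure_pmf.expectation (bernoulli_field E r) (\<lambda>X. exp (\<Sum>e\<in>F. c e * of_bool (X e)))
     \<le> exp (\<Sum>e\<in>F. r e * (exp (c e) - 1))"
proof -
  have "(\<Prod>e\<in>F. 1 + r e * (exp (c e) - 1)) \<le> exp (\<Sum>e\<in>F. r e * (exp (c e) - 1))"
  proof (rule prod_one_plus_le_exp)
  fix e assume "e \<in> F"
  then have "0 \<le> r e * exp (c e)" "r e \<le> 1" using r by auto
  then show "- 1 \<le> r e * (exp (c e) - 1)" by (simp add: algebra_simps)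
  qed
  then show ?thesis using expectation_exp_bernoulli_field[OF assms, where c = c] by simp
qed

text \<open>The Chernoff parameter is absorbed into the weights \<open>c\<close> and the level
  \<open>a\<close>.\<close>

lemma chernoff_bernoulli_field:
  assumes E: "finite E" "F \<subseteq> E" and r: "\<And>e. e \<in> F \<Longrightarrow> 0 \<le> r e \<and> r e \<le> 1"
  shows "measure_pmf.prob (bernoulli_field E r) {X. (\<Sum>e\<in>F. c e * of_bool (X e)) \<ge> a}
     \<le> exp ((\<Sum>e\<in>F. r e * (exp (c e) - 1)) - a)"
proof -
  let ?M = "bernoulli_field E r" and ?S = "\<lambda>X. \<Sum>e\<in>F. c e * of_bool (X e)"
  have "measure_pmf.prob ?M {X. ?S X \<ge> a} = measure_pmf.prob ?M {X\<in>space (measure_pmf ?M). exp (?S X) \<ge> exp a}"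
    by simp
  also have "\<dots> \<le> measure_pmf.expectation ?M (\<lambda>X. exp (?S X)) / exp a"
    by (rule integral_Markov_inequality_measure[where A = "{}"])
      (auto intro: integrable_bernoulli_field E)
  also have "\<dots> \<le> exp (\<Sum>e\<in>F. r e * (exp (c e) - 1)) / exp a"
    by (intro divide_right_mono mgf_bernoulli_field_le assms) auto
  finally show ?thesis by (simp add: exp_diff)
qed

text \<open>Exponential tilting without changing the measure: the tails of \<open>Z\<close> outside the window
  \<open>[- b, - a]\<close> are cut off by comparing the moment generating function at \<open>t\<close> with its values
  at \<open>t - s\<close> and \<open>t + s\<close>.\<close>

lemma tilted_lower_bound:
  fixes Z :: "'a \<Rightarrow> real" and M :: "'a pmf"
  assumes fin: "finite (set_pmf M)" and "t \<ge> 0" "s \<ge> 0"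
  defines "mgf \<equiv> \<lambda>u. measure_pmf.expectation M (\<lambda>x. exp (- u * Z x))"
  shows "exp (- t * b) * (mgf t - exp (s * a) * mgf (t - s) - exp (- s * b) * mgf (t + s))
     \<le> measure_pmf.prob M {x. Z x \<le> - a}"
proof -
  have int: "integrable (measure_pmf M) f" for f :: "'a \<Rightarrow> real"
    using fin by (rule integrable_measure_pmf_finite)
  have pointwise: "exp (- t * Z x) \<le> exp (t * b) * indicator {x. Z x \<le> - a} x
      + exp (s * a) * exp (- (t - s) * Z x) + exp (- s * b) * exp (- (t + s) * Z x)" for x
  proof -
    have nonneg: "0 \<le> exp (t * b) * indicator {x. Z x \<le> - a} x"
      "0 \<le> exp (s * a) * exp (- (t - s) * Z x)" "0 \<le> exp (- s * b) * exp (- (t + s) * Z x)"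
      by auto
    \<comment> \<open>Right of the window the term with \<open>t - s\<close> dominates, left of it
      the term with \<open>t + s\<close>; inside, \<open>exp (- t * Z x)\<close> is at most
      \<open>exp (t * b)\<close>.\<close>
    consider "Z x > - a" | "Z x \<le> - a" "Z x \<ge> - b" | "Z x < - b" by linarith
    then show ?thesis
    proof cases
      case 1
      then have "s * (a + Z x) \<ge> 0" using assms by auto
      then have "exp (- t * Z x) \<le> exp (s * a) * exp (- (t - s) * Z x)"
        by (simp add: algebra_simps flip: exp_add)
      then show ?thesis using nonneg by linarith
    next
      case 2
      then have "t * (b + Z x) \<ge> 0" using assms by auto
      then have "exp (- t * Z x) \<le> exp (t * b) * indicator {x. Z x \<le> - a} x"
        using 2 by (simp add: algebra_simps)
      then show ?thesis using nonneg by linarith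
    next
      case 3
      then have "s * (b + Z x) \<le> 0" using assms by (auto intro: mult_nonneg_nonpos)
      then have "exp (- t * Z x) \<le> exp (- s * b) * exp (- (t + s) * Z x)"
        by (simp add: algebra_simps flip: exp_add)
      then show ?thesis using nonneg by linarith
    qed
  qed
  have "mgf t \<le> measure_pmf.expectation M (\<lambda>x. exp (t * b) * indicator {x. Z x \<le> - a} x
      + exp (s * a) * exp (- (t - s) * Z x) + exp (- s * b) * exp (- (t + s) * Z x))"
    unfolding mgf_def by (intro integral_mono int pointwise)
  also have "\<dots> = exp (t * b) * measure_pmf.prob M {x. Z x \<le> - a}
      + exp (s * a) * mgf (t - s) + exp (- s * b) * mgf (t + s)"
    unfolding mgf_def by (simp add: int)
  finally have "exp (- t * b) * (mgf t - exp (s * a) * mgf (t - s) - exp (- s * b) * mgf (t + s))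
     \<le> exp (- t * b) * (exp (t * b) * measure_pmf.prob M {x. Z x \<le> - a})"
    by (intro mult_left_mono) auto
  also have "\<dots> = measure_pmf.prob M {x. Z x \<le> - a}"
    by (simp add: mult.assoc[symmetric] flip: exp_add)
  finally show ?thesis .
qed

text \<open>Restrictions of the field to disjoint index sets are independent, and each weighted sum
  depends only on its own restriction.\<close>

lemma prob_Ball_bernoulli_field:
  fixes c :: "'b \<Rightarrow> 'a \<Rightarrow> real"
  assumes E: "finite E" "finite T" and F: "\<And>v. v \<in> T \<Longrightarrow> F v \<subseteq> E" "disjoint_family_on F T"
  shows "measure_pmf.prob (bernoulli_field E r) {X. \<forall>v\<in>T. (\<Sum>e\<in>F v. c v e * of_bool (X e)) \<in> B v}
     = (\<Prod>v\<in>T. measure_pmf.prob (bernoulli_field E r) {X. (\<Sum>e\<in>F v. c v e * of_bool (X e)) \<in> B v})"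
proof (cases "T = {}")
  case True
  then show ?thesis by simp
next
  case False
  let ?M = "bernoulli_field E r"
  have "prob_space.indep_vars ?M (\<lambda>_. count_space UNIV) (\<lambda>x f. f x) E"
    unfolding bernoulli_field_def by (rule indep_vars_Pi_pmf) fact
  from prob_space.indep_vars_restrict[OF measure_pmf.prob_space_axioms this F]
  have ind: "prob_space.indep_vars ?M (\<lambda>v. PiM (F v) (\<lambda>_. count_space UNIV))
      (\<lambda>v X. restrict (\<lambda>i. X i) (F v)) T" by auto
  \<comment> \<open>Over a finite index set the product sigma-algebra is the full power set, so
    every event about a restriction is measurable.\<close>
  have sets_eq: "sets (PiM (F v) (\<lambda>_. count_space (UNIV :: bool set))) = sets (count_space (PiE (F v) (\<lambda>_. UNIV)))"
    if "v \<in> T" for v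
    using finite_subset[OF F(1)[OF that] E(1)] by (subst count_space_PiM_finite) auto
  have "prob_space.prob ?M (\<Inter>v\<in>T. (\<lambda>X. restrict (\<lambda>i. X i) (F v)) -`
       {Y \<in> PiE (F v) (\<lambda>_. UNIV). (\<Sum>e\<in>F v. c v e * of_bool (Y e)) \<in> B v} \<inter> space ?M)
     = (\<Prod>v\<in>T. measure_pmf.prob ?M ((\<lambda>X. restrict (\<lambda>i. X i) (F v)) -`
       {Y \<in> PiE (F v) (\<lambda>_. UNIV). (\<Sum>e\<in>F v. c v e * of_bool (Y e)) \<in> B v} \<inter> space ?M))"
    by (rule prob_space.indep_varsD_finite[OF measure_pmf.prob_space_axioms ind False E(2)]) (auto simp: sets_eq)
  moreover have "(\<lambda>X. restrict (\<lambda>i. X i) (F v)) -`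
       {Y \<in> PiE (F v) (\<lambda>_. UNIV). (\<Sum>e\<in>F v. c v e * of_bool (Y e)) \<in> B v} \<inter> space ?M
       = {X. (\<Sum>e\<in>F v. c v e * of_bool (X e)) \<in> B v}" for v
    by (auto simp: restrict_PiE)
  moreover have "(\<Inter>v\<in>T. {X. (\<Sum>e\<in>F v. c v e * of_bool (X e)) \<in> B v})
     = {X. \<forall>v\<in>T. (\<Sum>e\<in>F v. c v e * of_bool (X e)) \<in> B v}" by auto
  ultimately show ?thesis by simp
qed

section \<open>Counting hyperedges\<close>

lemma card_nsets: "finite U \<Longrightarrow> card (nsets U k) = card U choose k"
  using n_subsets[of U k] by (simp add: nsets_def) (metis (no_types, lifting) Collect_cong finite_subset)

lemma card_nsets_superset:
  assumes "finite U" "f \<subseteq> U" "card f \<le> k"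
  shows "card {e \<in> nsets U k. f \<subseteq> e} = (card U - card f) choose (k - card f)"
proof -
  have ff: "finite f" using assms finite_subset by blast
  have "bij_betw (\<lambda>g. g \<union> f) (nsets (U - f) (k - card f)) {e \<in> nsets U k. f \<subseteq> e}"
  proof (rule bij_betwI[where g = "\<lambda>e. e - f"])
    show "(\<lambda>g. g \<union> f) \<in> nsets (U - f) (k - card f) \<rightarrow> {e \<in> nsets U k. f \<subseteq> e}"
    proof safe
      fix g assume g: "g \<in> nsets (U - f) (k - card f)"
      then have "g \<inter> f = {}" "finite g" by (auto simp: nsets_def)
      then have "card (g \<union> f) = card g + card f" using ff card_Un_disjoint by blast
      then show "g \<union> f \<in> nsets U k" using g assms ff by (auto simp: nsets_def)
    qed
    show "(\<lambda>e. e - f) \<in> {e \<in> nsets U k. f \<subseteq> e} \<rightarrow> nsets (U - f) (k - card f)"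
      using ff by (auto simp: nsets_def card_Diff_subset)
  qed (auto simp: nsets_def)
  then have "card {e \<in> nsets U k. f \<subseteq> e} = card (nsets (U - f) (k - card f))"
    using bij_betw_same_card by fastforce
  also have "\<dots> = (card U - card f) choose (k - card f)"
    using assms ff by (simp add: card_nsets card_Diff_subset)
  finally show ?thesis .
qed

text \<open>A weighted Vandermonde identity: the \<open>j\<close>-sets are grouped by how many
  elements they take from \<open>R\<close>.\<close>

lemma sum_nsets_split:
  fixes h :: "nat \<Rightarrow> real"
  assumes "finite P" "finite R" "P \<inter> R = {}"
  shows "(\<Sum>f\<in>nsets (P \<union> R) j. h (card (f \<inter> R)))
    = (\<Sum>a\<le>j. real ((card R choose a) * (card P choose (j - a))) * h a)"
proof -
  have fin: "finite (nsets (P \<union> R) j)" using assms by (simp add: finite_imp_finite_nsets)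
  have "(\<Sum>f\<in>nsets (P \<union> R) j. h (card (f \<inter> R)))
     = (\<Sum>a\<le>j. \<Sum>f\<in>{f\<in>nsets (P \<union> R) j. card (f \<inter> R) = a}. h (card (f \<inter> R)))"
  proof (rule sum.group[symmetric, OF fin])
    show "(\<lambda>f. card (f \<inter> R)) ` nsets (P \<union> R) j \<subseteq> {..j}"
      by (auto simp: nsets_def intro: card_mono)
  qed simp
  also have "\<dots> = (\<Sum>a\<le>j. real (card {f\<in>nsets (P \<union> R) j. card (f \<inter> R) = a}) * h a)"
    by (intro sum.cong refl) simp
  also have "\<dots> = (\<Sum>a\<le>j. real ((card R choose a) * (card P choose (j - a))) * h a)"
  proof (intro sum.cong refl)
    fix a assume a: "a \<in> {..j}"
    have "bij_betw (\<lambda>(g, g'). g \<union> g') (nsets R a \<times> nsets P (j - a)) {f\<in>nsets (P \<union> R) j. card (f \<inter> R) = a}"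
    proof (rule bij_betwI[where g = "\<lambda>f. (f \<inter> R, f \<inter> P)"])
      show "(\<lambda>(g, g'). g \<union> g') \<in> nsets R a \<times> nsets P (j - a) \<rightarrow> {f \<in> nsets (P \<union> R) j. card (f \<inter> R) = a}"
      proof safe
        fix g g' assume g: "g \<in> nsets R a" "g' \<in> nsets P (j - a)"
        then have d: "g \<inter> g' = {}" "finite g" "finite g'" "(g \<union> g') \<inter> R = g"
          using assms by (auto simp: nsets_def)
        then have "card (g \<union> g') = card g + card g'" by (intro card_Un_disjoint)
        then show "g \<union> g' \<in> nsets (P \<union> R) j" using g a by (auto simp: nsets_def)
        show "card ((g \<union> g') \<inter> R) = a" using d g by (auto simp: nsets_def)
      qed
      show "(\<lambda>f. (f \<inter> R, f \<inter> P)) \<in> {f \<in> nsets (P \<union> R) j. card (f \<inter> R) = a} \<rightarrow> nsets R a \<times> nsets P (j - a)"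
      proof safe
        fix f assume f: "f \<in> nsets (P \<union> R) j" "a = card (f \<inter> R)"
        then have "card f = card (f \<inter> R) + card (f \<inter> P)"
          using assms by (subst card_Un_disjoint[symmetric])
            (auto simp: nsets_def intro!: arg_cong[where f=card])
        then show "f \<inter> P \<in> nsets P (j - card (f \<inter> R))" using f by (auto simp: nsets_def)
        show "f \<inter> R \<in> nsets R (card (f \<inter> R))" using f by (auto simp: nsets_def)
      qed
    qed (use assms in \<open>auto simp: nsets_def\<close>)
    then have "card {f\<in>nsets (P \<union> R) j. card (f \<inter> R) = a} = card (nsets R a \<times> nsets P (j - a))"
      using bij_betw_same_card by fastforce
    then show "real (card {f\<in>nsets (P \<union> R) j. card (f \<inter> R) = a}) * h a
      = real ((card R choose a) * (card P choose (j - a))) * h a"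
      using assms by (simp add: card_cartesian_product card_nsets)
  qed
  finally show ?thesis .
qed

section \<open>The objective as a sum of squares over hyperedges\<close>

lemma square_sum_eq:
  fixes x :: "'a \<Rightarrow> int"
  assumes "finite e"
  shows "(\<Sum>v\<in>e. x v)\<^sup>2 = (\<Sum>v\<in>e. (x v)\<^sup>2) + 2 * (\<Sum>f\<in>nsets e 2. \<Prod>v\<in>f. x v)"
  using assms
proof (induction e)
  case empty
  have "nsets {} 2 = ({} :: 'a set set)" by (auto simp: nsets_def)
  then show ?case by simp
next
  case (insert u e)
  have eq: "nsets (insert u e) 2 = nsets e 2 \<union> (\<lambda>v. {u, v}) ` e"
    using insert by (auto simp: nsets_2_eq)
  have inj: "inj_on (\<lambda>v. {u, v}) e" using insert by (auto simp: inj_on_def doubleton_eq_iff)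
  have disj: "nsets e 2 \<inter> (\<lambda>v. {u, v}) ` e = {}" using insert by (auto simp: nsets_def)
  have "(\<Sum>f\<in>nsets (insert u e) 2. \<Prod>v\<in>f. x v)
     = (\<Sum>f\<in>nsets e 2. \<Prod>v\<in>f. x v) + (\<Sum>v\<in>e. \<Prod>w\<in>{u, v}. x w)"
    unfolding eq using insert disj inj
    by (subst sum.union_disjoint) (auto simp: finite_imp_finite_nsets sum.reindex)
  also have "(\<Sum>v\<in>e. \<Prod>w\<in>{u, v}. x w) = x u * (\<Sum>v\<in>e. x v)"
    unfolding sum_distrib_left 
  proof (intro sum.cong refl)
    fix v assume "v \<in> e"
    then have "u \<noteq> v" using insert by auto
    then show "(\<Prod>w\<in>{u, v}. x w) = x u * x v" by simp
  qed
  finally have "2 * (\<Sum>f\<in>nsets (insert u e) 2. \<Prod>v\<in>f. x v)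
     = 2 * (\<Sum>f\<in>nsets e 2. \<Prod>v\<in>f. x v) + 2 * x u * (\<Sum>v\<in>e. x v)" by simp
  then show ?case using insert by (simp add: power2_sum)
qed

text \<open>Double counting of the pairs inside hyperedges. The constant \<open>k\<close> is the sum
  of the squared signs on an edge and cancels when two labelings are compared on the same
  \<open>H\<close>.\<close>

lemma trunc_objective_eq:
  assumes H: "H \<subseteq> nsets {1..n} k" and x: "x \<in> sign_vectors n"
  shows "2 * trunc_objective n H x = (\<Sum>e\<in>H. (\<Sum>v\<in>e. x v)\<^sup>2 - int k)"
proof -
  have fH: "finite H" using H by (rule finite_subset) (simp add: finite_imp_finite_nsets)
  let ?N = "nsets {1..n} 2"
  have fN: "finite ?N" by (simp add: finite_imp_finite_nsets)
  have "trunc_objective n H x = (\<Sum>f\<in>?N. \<Sum>e\<in>{e\<in>H. f \<subseteq> e}. \<Prod>v\<in>f. x v)"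
    by (simp add: trunc_objective_def pair_weight_def)
  also have "\<dots> = (\<Sum>e\<in>H. \<Sum>f\<in>{f\<in>?N. f \<subseteq> e}. \<Prod>v\<in>f. x v)"
    by (rule sum.swap_restrict[OF fN fH])
  also have "\<dots> = (\<Sum>e\<in>H. \<Sum>f\<in>nsets e 2. \<Prod>v\<in>f. x v)"
    using H by (intro sum.cong refl) (auto simp: nsets_def)
  finally have "2 * trunc_objective n H x = (\<Sum>e\<in>H. 2 * (\<Sum>f\<in>nsets e 2. \<Prod>v\<in>f. x v))"
    by (simp add: sum_distrib_left)
  also have "\<dots> = (\<Sum>e\<in>H. (\<Sum>v\<in>e. x v)\<^sup>2 - int k)"
  proof (intro sum.cong refl)
    fix e assume "e \<in> H"
    then have e: "e \<subseteq> {1..n}" "finite e" "card e = k" using H by (auto simp: nsets_def)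
    have "(\<Sum>v\<in>e. (x v)\<^sup>2) = (\<Sum>v\<in>e. 1)"
    proof (intro sum.cong refl)
      fix v assume "v \<in> e"
      then have "v \<in> {1..n}" using e(1) by blast
      then have "x v = 1 \<or> x v = - 1" using x by (auto simp: sign_vectors_def PiE_dflt_def)
      then show "(x v)\<^sup>2 = 1" by auto
    qed
    then show "2 * (\<Sum>f\<in>nsets e 2. \<Prod>v\<in>f. x v) = (\<Sum>v\<in>e. x v)\<^sup>2 - int k"
      using square_sum_eq[OF e(2), of x] e(3) by simp
  qed
  finally show ?thesis .
qed

text \<open>Double counting over vertices and over pairs. The right side sees \<open>x\<close> only
  through its sum and its sum of squares, so on a complete hypergraph the effect of a flip is
  explicit.\<close>

lemma sum_nsets_square_sum:
  fixes x :: "'a \<Rightarrow> int"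
  assumes U: "finite U" and k: "k \<ge> 2"
  shows "(\<Sum>e\<in>nsets U k. (\<Sum>v\<in>e. x v)\<^sup>2)
    = int ((card U - 1) choose (k - 1)) * (\<Sum>v\<in>U. (x v)\<^sup>2)
      + int ((card U - 2) choose (k - 2)) * ((\<Sum>v\<in>U. x v)\<^sup>2 - (\<Sum>v\<in>U. (x v)\<^sup>2))"
proof -
  let ?K = "nsets U k" and ?N = "nsets U 2"
  have fin: "finite ?K" "finite ?N" using U by (simp_all add: finite_imp_finite_nsets)
  have "(\<Sum>e\<in>?K. (\<Sum>v\<in>e. x v)\<^sup>2)
     = (\<Sum>e\<in>?K. (\<Sum>v\<in>{v\<in>U. v \<in> e}. (x v)\<^sup>2) + 2 * (\<Sum>f\<in>{f\<in>?N. f \<subseteq> e}. \<Prod>v\<in>f. x v))"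
  proof (intro sum.cong refl)
    fix e assume e: "e \<in> ?K"
    then have "{v\<in>U. v \<in> e} = e" "{f\<in>?N. f \<subseteq> e} = nsets e 2" "finite e" by (auto simp: nsets_def)
    then show "(\<Sum>v\<in>e. x v)\<^sup>2
      = (\<Sum>v\<in>{v\<in>U. v \<in> e}. (x v)\<^sup>2) + 2 * (\<Sum>f\<in>{f\<in>?N. f \<subseteq> e}. \<Prod>v\<in>f. x v)"
      using square_sum_eq[of e x] by simp
  qed
  also have "\<dots> = (\<Sum>e\<in>?K. \<Sum>v\<in>{v\<in>U. v \<in> e}. (x v)\<^sup>2)
      + 2 * (\<Sum>e\<in>?K. \<Sum>f\<in>{f\<in>?N. f \<subseteq> e}. \<Prod>v\<in>f. x v)"
    by (simp add: sum.distrib sum_distrib_left)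
  also have "(\<Sum>e\<in>?K. \<Sum>v\<in>{v\<in>U. v \<in> e}. (x v)\<^sup>2) = (\<Sum>v\<in>U. \<Sum>e\<in>{e\<in>?K. v \<in> e}. (x v)\<^sup>2)"
    by (rule sum.swap_restrict[OF fin(1) U])
  also have "\<dots> = (\<Sum>v\<in>U. int ((card U - 1) choose (k - 1)) * (x v)\<^sup>2)"
  proof (intro sum.cong refl)
    fix v assume "v \<in> U"
    then show "(\<Sum>e\<in>{e\<in>?K. v \<in> e}. (x v)\<^sup>2) = int ((card U - 1) choose (k - 1)) * (x v)\<^sup>2"
      using card_nsets_superset[OF U, of "{v}" k] k by simp
  qed
  also have "(\<Sum>e\<in>?K. \<Sum>f\<in>{f\<in>?N. f \<subseteq> e}. \<Prod>v\<in>f. x v) = (\<Sum>f\<in>?N. \<Sum>e\<in>{e\<in>?K. f \<subseteq> e}. \<Prod>v\<in>f. x v)"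
    by (rule sum.swap_restrict[OF fin])
  also have "\<dots> = (\<Sum>f\<in>?N. int ((card U - 2) choose (k - 2)) * (\<Prod>v\<in>f. x v))"
  proof (intro sum.cong refl)
    fix f assume "f \<in> ?N"
    then show "(\<Sum>e\<in>{e\<in>?K. f \<subseteq> e}. \<Prod>v\<in>f. x v) = int ((card U - 2) choose (k - 2)) * (\<Prod>v\<in>f. x v)"
      using card_nsets_superset[OF U, of f k] k by (auto simp: nsets_def)
  qed
  also have "2 * (\<Sum>f\<in>?N. int ((card U - 2) choose (k - 2)) * (\<Prod>v\<in>f. x v))
     = int ((card U - 2) choose (k - 2)) * ((\<Sum>v\<in>U. x v)\<^sup>2 - (\<Sum>v\<in>U. (x v)\<^sup>2))"
    using square_sum_eq[OF U, of x] by (simp flip: sum_distrib_left)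
  finally show ?thesis by (simp flip: sum_distrib_left)
qed

section \<open>Uniform asymptotics of binomial ratios and star sums\<close>

lemma binomial_fact_ge_pow:
  assumes "k \<le> n"
  shows "(real n - real k) ^ k \<le> real (n choose k) * fact k"
proof -
  have "(real n - real k) ^ k = (\<Prod>i = 0..<k. real n - real k)" by simp
  also have "\<dots> \<le> (\<Prod>i = 0..<k. real n - real i)"
    using assms by (intro prod_mono) auto
  also have "\<dots> = real (n choose k) * fact k"
    by (simp add: binomial_gbinomial gbinomial_mult_fact')
  finally show ?thesis .
qed

text \<open>Multiplication by \<open>fact j = fact a * fact (j - a) * (j choose a)\<close> turns all
  binomials into falling factorials, which lie between powers.\<close>

lemma binomial_product_ratio_bounds:
  assumes "a \<le> j" "r \<ge> j" "r \<le> m" "2 * m - 1 > j"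
  defines "\<rho> \<equiv> real ((r choose a) * (r choose (j - a))) / real ((2 * m - 1) choose j)"
  shows "\<rho> \<le> real (j choose a) * (real m / (2 * real m - 1 - real j)) ^ j"
    and "real (j choose a) * ((real r - real j) / (2 * real m - 1)) ^ j \<le> \<rho>"
proof -
  let ?N = "real ((2 * m - 1) choose j)"
  have N: "?N > 0" using assms by simp
  have cf: "fact a * fact (j - a) * real (j choose a) = fact j"
    using arg_cong[OF binomial_fact_lemma[OF assms(1)], of real] by simp
  have num: "real ((r choose a) * (r choose (j - a))) * fact j
      = real (j choose a) * ((real (r choose a) * fact a) * (real (r choose (j - a)) * fact (j - a)))"
    unfolding cf[symmetric] by simp
  have num_le: "(real (r choose a) * fact a) * (real (r choose (j - a)) * fact (j - a)) \<le> real m ^ j"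
  proof -
    have "real (r choose b) * fact b \<le> real m ^ b" for b
    proof -
      have "(r choose b) * fact b \<le> r ^ b" by (rule binomial_fact_pow)
      also have "\<dots> \<le> m ^ b" using assms by (simp add: power_mono)
      finally have "real ((r choose b) * fact b) \<le> real (m ^ b)" using of_nat_le_iff by blast
      then show ?thesis by simp
    qed
    then have "(real (r choose a) * fact a) * (real (r choose (j - a)) * fact (j - a)) \<le> real m ^ a * real m ^ (j - a)"
      by (intro mult_mono) auto
    then show ?thesis using assms by (simp flip: power_add)
  qed
  have num_ge: "(real r - real j) ^ j \<le> (real (r choose a) * fact a) * (real (r choose (j - a)) * fact (j - a))"
  proof -
    have *: "(real r - real j) ^ b \<le> real (r choose b) * fact b" if "b \<le> j" for b
      using assms that
      by (intro order.trans[OF power_mono binomial_fact_ge_pow]) auto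
    have "(real r - real j) ^ a * (real r - real j) ^ (j - a)
        \<le> (real (r choose a) * fact a) * (real (r choose (j - a)) * fact (j - a))"
      using * assms by (intro mult_mono) auto
    then show ?thesis using assms by (simp flip: power_add)
  qed
  have den_ge: "(2 * real m - 1 - real j) ^ j \<le> ?N * fact j"
    using binomial_fact_ge_pow[of j "2 * m - 1"] assms by (simp add: of_nat_diff)
  have den_le: "?N * fact j \<le> (2 * real m - 1) ^ j"
  proof -
    have "((2 * m - 1) choose j) * fact j \<le> (2 * m - 1) ^ j" by (rule binomial_fact_pow)
    then have "real (((2 * m - 1) choose j) * fact j) \<le> real ((2 * m - 1) ^ j)"
      using of_nat_le_iff by blast
    then show ?thesis using assms by (simp add: of_nat_diff)
  qed
  have rho: "\<rho> = real (j choose a) * (((real (r choose a) * fact a) * (real (r choose (j - a)) * fact (j - a))) / (?N * fact j))"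
    unfolding \<rho>_def times_divide_eq_right num[symmetric] using N by simp
  have pos: "0 < 2 * real m - 1 - real j" using assms by linarith
  show "\<rho> \<le> real (j choose a) * (real m / (2 * real m - 1 - real j)) ^ j"
    unfolding rho power_divide using num_le den_ge N pos
    by (intro mult_left_mono frac_le) auto
  show "real (j choose a) * ((real r - real j) / (2 * real m - 1)) ^ j \<le> \<rho>"
    unfolding rho power_divide using num_ge den_le N pos assms
    by (intro mult_left_mono frac_le) auto
qed

text \<open>The upper estimate converges for all \<open>r \<le> m\<close>; only the lower one asks
  for \<open>r\<close> close to \<open>m\<close>, and this fixes \<epsilon>. Uniformity in
  \<open>r\<close> lets one bound serve every small set of flipped or removed vertices.\<close>

lemma binomial_product_ratio_limit:
  assumes "a \<le> j" "\<eta> > 0"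
  shows "\<exists>\<epsilon>>0. \<epsilon> < 1 \<and> (\<forall>\<^sub>F m in sequentially. \<forall>r\<le>m. (1 - \<epsilon>) * real m \<le> real r \<longrightarrow>
     \<bar>real ((r choose a) * (r choose (j - a))) / real ((2 * m - 1) choose j) - real (j choose a) / 2 ^ j\<bar> \<le> \<eta>)"
proof -
  define C where "C = real (j choose a)"
  have C: "C > 0" using assms by (simp add: C_def)
  have "((\<lambda>\<epsilon>::real. C * ((1 - \<epsilon>) / 2) ^ j) \<longlongrightarrow> C * ((1 - 0) / 2) ^ j) (at_right 0)"
    by (intro tendsto_intros) simp
  then have "\<forall>\<^sub>F \<epsilon>::real in at_right 0. C * ((1 - \<epsilon>) / 2) ^ j > C * (1 / 2) ^ j - \<eta>"
    using assms by (intro order_tendstoD) auto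
  moreover have "\<forall>\<^sub>F \<epsilon>::real in at_right 0. 0 < \<epsilon> \<and> \<epsilon> < 1"
    using eventually_at_right_real[of 0 1] by simp
  ultimately have "\<forall>\<^sub>F \<epsilon>::real in at_right 0. C * ((1 - \<epsilon>) / 2) ^ j > C * (1 / 2) ^ j - \<eta> \<and> 0 < \<epsilon> \<and> \<epsilon> < 1"
    by eventually_elim auto
  then obtain \<epsilon> :: real where \<epsilon>: "C * ((1 - \<epsilon>) / 2) ^ j > C * (1 / 2) ^ j - \<eta>" "0 < \<epsilon>" "\<epsilon> < 1"
    using eventually_happens[of _ "at_right (0::real)"] by (auto simp: trivial_limit_at_right_real)
  have "(\<lambda>m. real m / (2 * real m - 1 - real j)) \<longlonglongrightarrow> 1 / 2"
    by real_asymp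
  then have "(\<lambda>m. C * (real m / (2 * real m - 1 - real j)) ^ j) \<longlonglongrightarrow> C * (1 / 2) ^ j"
    by (intro tendsto_mult tendsto_power tendsto_const)
  then have up: "\<forall>\<^sub>F m in sequentially. C * (real m / (2 * real m - 1 - real j)) ^ j < C * (1 / 2) ^ j + \<eta>"
    using assms by (intro order_tendstoD) auto
  have "(\<lambda>m. ((1 - \<epsilon>) * real m - real j) / (2 * real m - 1)) \<longlonglongrightarrow> (1 - \<epsilon>) / 2"
    by real_asymp
  then have "(\<lambda>m. C * (((1 - \<epsilon>) * real m - real j) / (2 * real m - 1)) ^ j) \<longlonglongrightarrow> C * ((1 - \<epsilon>) / 2) ^ j"
    by (intro tendsto_mult tendsto_power tendsto_const)
  then have low: "\<forall>\<^sub>F m in sequentially. C * (1 / 2) ^ j - \<eta> < C * (((1 - \<epsilon>) * real m - real j) / (2 * real m - 1)) ^ j"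
    using \<epsilon> by (intro order_tendstoD) auto
  have "filterlim (\<lambda>m. (1 - \<epsilon>) * real m) at_top sequentially"
    using \<epsilon> by real_asymp
  then have "\<forall>\<^sub>F m in sequentially. real j \<le> (1 - \<epsilon>) * real m"
    by (simp add: filterlim_at_top)
  with up low eventually_gt_at_top[of "j + 1"]
  have "\<forall>\<^sub>F m in sequentially. \<forall>r\<le>m. (1 - \<epsilon>) * real m \<le> real r \<longrightarrow>
     \<bar>real ((r choose a) * (r choose (j - a))) / real ((2 * m - 1) choose j) - real (j choose a) / 2 ^ j\<bar> \<le> \<eta>"
  proof eventually_elim
    case (elim m)
    show ?case
    proof (intro allI impI)
      fix r assume r: "r \<le> m" "(1 - \<epsilon>) * real m \<le> real r"
      have rj: "j \<le> r" and mj: "2 * m - 1 > j" using elim r by linarith+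
      have "C * (((1 - \<epsilon>) * real m - real j) / (2 * real m - 1)) ^ j
          \<le> C * ((real r - real j) / (2 * real m - 1)) ^ j"
        using C elim r by (intro mult_left_mono power_mono divide_right_mono) auto
      with binomial_product_ratio_bounds[OF assms(1) rj r(1) mj, folded C_def] elim
      show "\<bar>real ((r choose a) * (r choose (j - a))) / real ((2 * m - 1) choose j) - real (j choose a) / 2 ^ j\<bar> \<le> \<eta>"
        unfolding C_def[symmetric] power_one_over by (simp add: abs_le_iff)
    qed
  qed
  with \<epsilon> show ?thesis by blast
qed

text \<open>For an edge through a fixed vertex, \<open>a\<close> counts its other vertices in the opposite class, of which
  \<open>r\<close> are available in each class; the factor \<open>ln n\<close> of the edge probabilities is left out.\<close>

definition star_weight :: "nat \<Rightarrow> real \<Rightarrow> real \<Rightarrow> nat \<Rightarrow> nat \<Rightarrow> (real \<Rightarrow> real) \<Rightarrow> real" where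
  "star_weight k \<alpha> \<beta> n r g =
     (\<Sum>a\<le>k - 1. (if a = 0 then \<alpha> else \<beta>) * (real ((r choose a) * (r choose (k - 1 - a))) / real ((n - 1) choose (k - 1)))
        * g (real k - 1 - 2 * real a))"

text \<open>The function \<open>g\<close> stays abstract because it is taken both as
  \<open>1 - exp (- t * c)\<close> and as the absolute value of that expression.\<close>

definition star_limit :: "nat \<Rightarrow> real \<Rightarrow> real \<Rightarrow> (real \<Rightarrow> real) \<Rightarrow> real" where
  "star_limit k \<alpha> \<beta> g =
     (\<Sum>a\<le>k - 1. (if a = 0 then \<alpha> else \<beta>) * (real ((k - 1) choose a) / 2 ^ (k - 1))
        * g (real k - 1 - 2 * real a))"

lemma I2_fun_eq_star_limit: "I2_fun k \<alpha> \<beta> t = star_limit k \<alpha> \<beta> (\<lambda>c. 1 - exp (- t * c))"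
proof -
  have "{..k - 1} = insert 0 {1..k - 1}" by auto
  then have "star_limit k \<alpha> \<beta> (\<lambda>c. 1 - exp (- t * c)) = \<alpha> * (1 / 2 ^ (k - 1)) * (1 - exp (- t * (real k - 1)))
     + (\<Sum>a\<in>{1..k - 1}. \<beta> * (real ((k - 1) choose a) / 2 ^ (k - 1)) * (1 - exp (- t * (real k - 1 - 2 * real a))))"
    unfolding star_limit_def by simp
  also have "\<dots> = I2_fun k \<alpha> \<beta> t"
    unfolding I2_fun_def distrib_left sum_distrib_left
    by (intro arg_cong2[where f = "(+)"] sum.cong) (simp_all add: field_simps)
  finally show ?thesis ..
qed

lemma star_weight_limit:
  assumes "\<eta> > 0"
  shows "\<exists>\<epsilon>>0. \<epsilon> < 1 \<and> (\<forall>\<^sub>F m in sequentially. \<forall>r\<le>m. (1 - \<epsilon>) * real m \<le> real r \<longrightarrow>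
     \<bar>star_weight k \<alpha> \<beta> (2 * m) r g - star_limit k \<alpha> \<beta> g\<bar> \<le> \<eta>)"
proof -
  define w where "w a = (if a = 0 then \<alpha> else \<beta>) * g (real k - 1 - 2 * real a)" for a
  define S where "S = (\<Sum>a\<le>k - 1. \<bar>w a\<bar>)"
  \<comment> \<open>This is the error allowed for each single ratio; adding 1 to \<open>S\<close>
    keeps the divisor positive even if all weights vanish.\<close>
  define \<eta>' where "\<eta>' = \<eta> / (S + 1)"
  have S: "S \<ge> 0" unfolding S_def by (intro sum_nonneg) auto
  then have \<eta>': "\<eta>' > 0" using assms by (simp add: \<eta>'_def)
  let ?P = "\<lambda>a \<epsilon>. \<forall>\<^sub>F m in sequentially. \<forall>r\<le>m. (1 - \<epsilon>) * real m \<le> real r \<longrightarrow>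
     \<bar>real ((r choose a) * (r choose (k - 1 - a))) / real ((2 * m - 1) choose (k - 1)) - real ((k - 1) choose a) / 2 ^ (k - 1)\<bar> \<le> \<eta>'"
  have "\<forall>a. \<exists>\<epsilon>. a \<le> k - 1 \<longrightarrow> \<epsilon> > 0 \<and> \<epsilon> < 1 \<and> ?P a \<epsilon>"
  proof
    fix a show "\<exists>\<epsilon>. a \<le> k - 1 \<longrightarrow> \<epsilon> > 0 \<and> \<epsilon> < 1 \<and> ?P a \<epsilon>"
      using binomial_product_ratio_limit[of a "k - 1", OF _ \<eta>'] by (cases "a \<le> k - 1") auto
  qed
  from choice[OF this] obtain \<epsilon> :: "nat \<Rightarrow> real"
    where \<epsilon>: "\<And>a. a \<le> k - 1 \<Longrightarrow> \<epsilon> a > 0 \<and> \<epsilon> a < 1 \<and> ?P a (\<epsilon> a)" by blast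
  \<comment> \<open>A smaller \<epsilon> restricts \<open>r\<close> further, so the minimum works
    for all \<open>a\<close> at once.\<close>
  define \<epsilon>' where "\<epsilon>' = Min (\<epsilon> ` {..k - 1})"
  have \<epsilon>'le: "\<epsilon>' \<le> \<epsilon> a" if "a \<le> k - 1" for a unfolding \<epsilon>'_def using that by (intro Min_le) auto
  have \<epsilon>'pos: "\<epsilon>' > 0" unfolding \<epsilon>'_def using \<epsilon> by (subst Min_gr_iff) auto
  have \<epsilon>'1: "\<epsilon>' < 1" using \<epsilon>'le[of 0] \<epsilon>[of 0] by auto
  have "\<forall>\<^sub>F m in sequentially. \<forall>a\<in>{..k - 1}. \<forall>r\<le>m. (1 - \<epsilon> a) * real m \<le> real r \<longrightarrow>
     \<bar>real ((r choose a) * (r choose (k - 1 - a))) / real ((2 * m - 1) choose (k - 1)) - real ((k - 1) choose a) / 2 ^ (k - 1)\<bar> \<le> \<eta>'"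
    using \<epsilon> by (intro eventually_ball_finite) auto
  then have "\<forall>\<^sub>F m in sequentially. \<forall>r\<le>m. (1 - \<epsilon>') * real m \<le> real r \<longrightarrow>
     \<bar>star_weight k \<alpha> \<beta> (2 * m) r g - star_limit k \<alpha> \<beta> g\<bar> \<le> \<eta>"
  proof eventually_elim
    case (elim m)
    show ?case
    proof (intro allI impI)
      fix r assume r: "r \<le> m" "(1 - \<epsilon>') * real m \<le> real r"
      have "\<bar>star_weight k \<alpha> \<beta> (2 * m) r g - star_limit k \<alpha> \<beta> g\<bar>
        = \<bar>\<Sum>a\<le>k - 1. w a * (real ((r choose a) * (r choose (k - 1 - a))) / real ((2 * m - 1) choose (k - 1)) - real ((k - 1) choose a) / 2 ^ (k - 1))\<bar>"
        unfolding star_weight_def star_limit_def sum_subtractf[symmetric] w_def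
        by (intro arg_cong[where f = abs] sum.cong refl) (simp add: algebra_simps)
      also have "\<dots> \<le> (\<Sum>a\<le>k - 1. \<bar>w a\<bar> * \<eta>')"
      proof (rule order.trans[OF sum_abs], intro sum_mono)
        fix a assume a: "a \<in> {..k - 1}"
        have "(1 - \<epsilon> a) * real m \<le> (1 - \<epsilon>') * real m"
          using \<epsilon>'le[of a] a by (intro mult_right_mono) auto
        then have "(1 - \<epsilon> a) * real m \<le> real r" using r by linarith
        then show "\<bar>w a * (real ((r choose a) * (r choose (k - 1 - a))) / real ((2 * m - 1) choose (k - 1)) - real ((k - 1) choose a) / 2 ^ (k - 1))\<bar> \<le> \<bar>w a\<bar> * \<eta>'"
          unfolding abs_mult using elim a r by (intro mult_left_mono) auto
      qed
      also have "\<dots> = S * \<eta>'" by (simp add: S_def sum_distrib_right)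
      also have "\<dots> \<le> \<eta>" using S assms by (simp add: \<eta>'_def field_simps)
      finally show "\<bar>star_weight k \<alpha> \<beta> (2 * m) r g - star_limit k \<alpha> \<beta> g\<bar> \<le> \<eta>" .
    qed
  qed
  with \<epsilon>'pos \<epsilon>'1 show ?thesis by blast
qed

section \<open>The effect of flipping a vertex set\<close>

definition flip :: "nat set \<Rightarrow> (nat \<Rightarrow> int) \<Rightarrow> nat \<Rightarrow> int" where
  "flip D \<sigma> v = (if v \<in> D then - \<sigma> v else \<sigma> v)"

text \<open>The share of \<open>e\<close> in twice the loss of objective caused by flipping
  \<open>D\<close>: positive values favour \<sigma>.\<close>

definition gap :: "(nat \<Rightarrow> int) \<Rightarrow> nat set \<Rightarrow> nat set \<Rightarrow> real" where
  "gap \<sigma> D e = real_of_int ((\<Sum>v\<in>e. \<sigma> v)\<^sup>2 - (\<Sum>v\<in>e. flip D \<sigma> v)\<^sup>2)"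

definition rate :: "nat \<Rightarrow> real \<Rightarrow> real \<Rightarrow> nat \<Rightarrow> (nat \<Rightarrow> int) \<Rightarrow> nat set \<Rightarrow> real" where
  "rate k \<alpha> \<beta> n \<sigma> e = edge_prob k (if monochromatic \<sigma> e then \<alpha> else \<beta>) n"

lemma gap_cong:
  assumes "e \<inter> D = e \<inter> D'"
  shows "gap \<sigma> D e = gap \<sigma> D' e"
proof -
  have "(\<Sum>v\<in>e. flip D \<sigma> v) = (\<Sum>v\<in>e. flip D' \<sigma> v)"
    using assms by (intro sum.cong) (auto simp: flip_def)
  then show ?thesis by (simp add: gap_def)
qed

lemma gap_disjoint: "e \<inter> D = {} \<Longrightarrow> gap \<sigma> D e = 0"
  using gap_cong[of e D "{}"] by (simp add: gap_def flip_def)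

lemma sum_signs:
  fixes \<sigma> :: "nat \<Rightarrow> int"
  assumes "finite f" "\<And>w. w \<in> insert v f \<Longrightarrow> \<sigma> w = 1 \<or> \<sigma> w = - 1"
  shows "(\<Sum>w\<in>f. \<sigma> w) = \<sigma> v * (int (card f) - 2 * int (card (f \<inter> {w. \<sigma> w \<noteq> \<sigma> v})))"
proof -
  have "(\<Sum>w\<in>f. \<sigma> w) = (\<Sum>w\<in>f. \<sigma> v * (1 - 2 * (if \<sigma> w \<noteq> \<sigma> v then 1 else 0)))"
  proof (intro sum.cong refl)
    fix w assume "w \<in> f"
    then have "\<sigma> w = 1 \<or> \<sigma> w = - 1" "\<sigma> v = 1 \<or> \<sigma> v = - 1" using assms(2) by auto
    then show "\<sigma> w = \<sigma> v * (1 - 2 * (if \<sigma> w \<noteq> \<sigma> v then 1 else 0))" by auto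
  qed
  also have "\<dots> = \<sigma> v * (int (card f) - 2 * (\<Sum>w\<in>f. if \<sigma> w \<noteq> \<sigma> v then 1 else 0))"
    by (simp add: sum_subtractf flip: sum_distrib_left)
  also have "(\<Sum>w\<in>f. if \<sigma> w \<noteq> \<sigma> v then 1 else 0 :: int) = int (card (f \<inter> {w. \<sigma> w \<noteq> \<sigma> v}))"
    using assms(1) by (simp add: sum.If_cases)
  finally show ?thesis .
qed

text \<open>With \<open>S\<close> the sum of the signs on \<open>f\<close>, the two squares
  \<open>(\<sigma> v + S)\<^sup>2\<close> and \<open>(- \<sigma> v + S)\<^sup>2\<close> differ by
  \<open>4 * \<sigma> v * S\<close>. This is the origin of the divisions by 4 that match
  \<open>gap\<close> to the exponents in \<open>I2_fun\<close>.\<close>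

lemma gap_insert:
  assumes "finite f" "v \<in> D" "v \<notin> f" "f \<inter> D = {}"
    and "\<And>w. w \<in> insert v f \<Longrightarrow> \<sigma> w = 1 \<or> \<sigma> w = - 1"
  shows "gap \<sigma> D (insert v f) = 4 * (real (card f) - 2 * real (card (f \<inter> {w. \<sigma> w \<noteq> \<sigma> v})))"
proof -
  define d where "d = int (card f) - 2 * int (card (f \<inter> {w. \<sigma> w \<noteq> \<sigma> v}))"
  have S: "(\<Sum>w\<in>f. \<sigma> w) = \<sigma> v * d"
    unfolding d_def by (rule sum_signs[OF assms(1,5)])
  have "(\<Sum>w\<in>f. flip D \<sigma> w) = (\<Sum>w\<in>f. \<sigma> w)"
    using assms by (intro sum.cong) (auto simp: flip_def)
  then have "gap \<sigma> D (insert v f) = real_of_int ((\<sigma> v + \<sigma> v * d)\<^sup>2 - (- \<sigma> v + \<sigma> v * d)\<^sup>2)"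
    using assms S by (simp add: gap_def flip_def)
  also have "(\<sigma> v + \<sigma> v * d)\<^sup>2 - (- \<sigma> v + \<sigma> v * d)\<^sup>2 = 4 * d"
    using assms(5)[of v] by (auto simp: power2_eq_square algebra_simps)
  finally show ?thesis by (simp add: d_def)
qed

lemma sign_vectorsD: "\<sigma> \<in> sign_vectors n \<Longrightarrow> v \<in> {1..n} \<Longrightarrow> \<sigma> v = 1 \<or> \<sigma> v = - 1"
  by (auto simp: sign_vectors_def PiE_dflt_def)

lemma sign_vectors_outside: "\<sigma> \<in> sign_vectors n \<Longrightarrow> v \<notin> {1..n} \<Longrightarrow> \<sigma> v = 0"
  by (auto simp: sign_vectors_def PiE_dflt_def)

lemma square_sum_le:
  fixes x :: "nat \<Rightarrow> int"
  assumes "\<And>v. v \<in> e \<Longrightarrow> \<bar>x v\<bar> \<le> 1"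
  shows "(\<Sum>v\<in>e. x v)\<^sup>2 \<le> int (card e) ^ 2"
proof -
  have "\<bar>\<Sum>v\<in>e. x v\<bar> \<le> (\<Sum>v\<in>e. \<bar>x v\<bar>)" by (rule sum_abs)
  also have "\<dots> \<le> int (card e)" using sum_mono[of e "\<lambda>v. \<bar>x v\<bar>" "\<lambda>_. 1"] assms by simp
  finally show ?thesis by (simp add: abs_le_square_iff[symmetric])
qed

lemma abs_gap_le:
  assumes "\<sigma> \<in> sign_vectors n" "e \<in> nsets {1..n} k"
  shows "\<bar>gap \<sigma> D e\<bar> \<le> real k ^ 2"
proof -
  have e: "e \<subseteq> {1..n}" "card e = k" using assms by (auto simp: nsets_def)
  have "\<sigma> v = 1 \<or> \<sigma> v = - 1" if "v \<in> e" for v using sign_vectorsD[OF assms(1)] e that by blast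
  then have b: "\<bar>\<sigma> v\<bar> \<le> 1" "\<bar>flip D \<sigma> v\<bar> \<le> 1" if "v \<in> e" for v
    using that by (force simp: flip_def)+
  have "(\<Sum>v\<in>e. \<sigma> v)\<^sup>2 \<le> int k ^ 2" "(\<Sum>v\<in>e. flip D \<sigma> v)\<^sup>2 \<le> int k ^ 2"
    using square_sum_le[of e \<sigma>] square_sum_le[of e "flip D \<sigma>"] b e by auto
  then have "\<bar>(\<Sum>v\<in>e. \<sigma> v)\<^sup>2 - (\<Sum>v\<in>e. flip D \<sigma> v)\<^sup>2\<bar> \<le> int k ^ 2"
    using zero_le_power2[of "\<Sum>v\<in>e. \<sigma> v"] zero_le_power2[of "\<Sum>v\<in>e. flip D \<sigma> v"] by linarith
  then have "real_of_int \<bar>(\<Sum>v\<in>e. \<sigma> v)\<^sup>2 - (\<Sum>v\<in>e. flip D \<sigma> v)\<^sup>2\<bar> \<le> real_of_int (int k ^ 2)"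
    using of_int_le_iff by blast
  then show ?thesis unfolding gap_def by simp
qed

section \<open>Edge probabilities and the edges through a vertex\<close>

lemma rate_bounds:
  assumes "0 < \<beta>" "\<beta> \<le> \<alpha>" "n \<ge> 1"
  shows "0 \<le> rate k \<alpha> \<beta> n \<sigma> e" "rate k \<alpha> \<beta> n \<sigma> e \<le> edge_prob k \<alpha> n"
  using assms by (auto simp: rate_def edge_prob_def intro!: divide_right_mono mult_right_mono)

lemma edge_prob_tendsto_0:
  assumes "k \<ge> 2"
  shows "(\<lambda>m. edge_prob k \<alpha> (2 * m)) \<longlonglongrightarrow> 0"
proof (rule Lim_null_comparison)
  show "(\<lambda>m. \<bar>\<alpha>\<bar> * ln (2 * real m) * (real (k - 1) / (2 * real m - 1))) \<longlonglongrightarrow> 0"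
    by real_asymp
  show "\<forall>\<^sub>F m in sequentially. norm (edge_prob k \<alpha> (2 * m))
      \<le> \<bar>\<alpha>\<bar> * ln (2 * real m) * (real (k - 1) / (2 * real m - 1))"
    using eventually_gt_at_top[of k]
  proof eventually_elim
    case (elim m)
    let ?x = "real (2 * m - 1) / real (k - 1)"
    have x: "1 \<le> ?x" using elim assms by simp
    \<comment> \<open>The first power of \<open>?x\<close> is enough, since \<open>ln n / n\<close>
      already tends to 0.\<close>
    have "?x \<le> ?x ^ (k - 1)" using x assms by (intro self_le_power) auto
    also have "\<dots> \<le> real ((2 * m - 1) choose (k - 1))"
      using elim by (intro binomial_ge_n_over_k_pow_k) auto
    finally have "?x \<le> real ((2 * m - 1) choose (k - 1))" .
    then have "1 / real ((2 * m - 1) choose (k - 1)) \<le> 1 / ?x"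
      using order.strict_trans2[OF zero_less_one x] by (intro frac_le) auto
    then have "\<bar>\<alpha>\<bar> * ln (2 * real m) * (1 / real ((2 * m - 1) choose (k - 1))) \<le> \<bar>\<alpha>\<bar> * ln (2 * real m) * (1 / ?x)"
      using elim by (intro mult_left_mono) auto
    then show ?case using elim by (simp add: edge_prob_def abs_mult of_nat_diff)
  qed
qed

text \<open>Both the rate and the argument of \<open>g\<close> depend on the edge
  \<open>insert v f\<close> only through \<open>card (f \<inter> R)\<close>, the edge being
  monochromatic exactly when this number is 0. Grouping by it yields the weighted Vandermonde
  sum.\<close>

lemma star_sum:
  assumes k: "k \<ge> 2" and P: "finite P" "finite R" "P \<inter> R = {}" "card P = r" "card R = r"
    and \<sigma>: "\<And>w. w \<in> P \<Longrightarrow> \<sigma> w = \<sigma> v" "\<And>w. w \<in> R \<Longrightarrow> \<sigma> w \<noteq> \<sigma> v"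
  shows "(\<Sum>f\<in>nsets (P \<union> R) (k - 1). rate k \<alpha> \<beta> n \<sigma> (insert v f) * g (real k - 1 - 2 * real (card (f \<inter> R))))
     = ln (real n) * star_weight k \<alpha> \<beta> n r g"
proof -
  define h where "h a = edge_prob k (if a = 0 then \<alpha> else \<beta>) n * g (real k - 1 - 2 * real a)" for a
  have "(\<Sum>f\<in>nsets (P \<union> R) (k - 1). rate k \<alpha> \<beta> n \<sigma> (insert v f) * g (real k - 1 - 2 * real (card (f \<inter> R))))
    = (\<Sum>f\<in>nsets (P \<union> R) (k - 1). h (card (f \<inter> R)))"
  proof (intro sum.cong refl)
    fix f assume f: "f \<in> nsets (P \<union> R) (k - 1)"
    have "monochromatic \<sigma> (insert v f) \<longleftrightarrow> f \<inter> R = {}"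
    proof
      assume "monochromatic \<sigma> (insert v f)"
      then have "\<sigma> w = \<sigma> v" if "w \<in> f" for w
        using that unfolding monochromatic_def by blast
      then show "f \<inter> R = {}" using \<sigma>(2) by blast
    next
      assume "f \<inter> R = {}"
      then have "f \<subseteq> P" using f by (auto simp: nsets_def)
      then have "\<sigma> w = \<sigma> v" if "w \<in> insert v f" for w using \<sigma>(1) that by blast
      then show "monochromatic \<sigma> (insert v f)" unfolding monochromatic_def by metis
    qed
    also have "\<dots> \<longleftrightarrow> card (f \<inter> R) = 0" using P by simp
    finally show "rate k \<alpha> \<beta> n \<sigma> (insert v f) * g (real k - 1 - 2 * real (card (f \<inter> R))) = h (card (f \<inter> R))"
      by (simp add: h_def rate_def)
  qed
  also have "\<dots> = (\<Sum>a\<le>k - 1. real ((r choose a) * (r choose (k - 1 - a))) * h a)"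
    using sum_nsets_split[OF P(1-3), of h "k - 1"] P by simp
  also have "\<dots> = ln (real n) * star_weight k \<alpha> \<beta> n r g"
    unfolding star_weight_def sum_distrib_left
    by (intro sum.cong refl) (simp add: h_def edge_prob_def)
  finally show ?thesis .
qed

text \<open>Every such edge contains a pair from \<open>D\<close>, and each pair lies in the same
  number of edges.\<close>

lemma card_nsets_two_in_le:
  assumes V: "finite V" "D \<subseteq> V" and k: "k \<ge> 2"
  shows "card {e\<in>nsets V k. 2 \<le> card (e \<inter> D)} \<le> (card D)\<^sup>2 * ((card V - 2) choose (k - 2))"
proof -
  have fD: "finite D" using V finite_subset by blast
  have fin: "finite (nsets V k)" "finite (nsets D 2)" using V fD by (simp_all add: finite_imp_finite_nsets)
  have "{e\<in>nsets V k. 2 \<le> card (e \<inter> D)} \<subseteq> (\<Union>f\<in>nsets D 2. {e\<in>nsets V k. f \<subseteq> e})"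
  proof
    fix e assume "e \<in> {e\<in>nsets V k. 2 \<le> card (e \<inter> D)}"
    then have e: "e \<in> nsets V k" "2 \<le> card (e \<inter> D)" by auto
    obtain f where f: "f \<subseteq> e \<inter> D" "card f = 2" "finite f"
      using obtain_subset_with_card_n[OF e(2)] by metis
    then have "f \<in> nsets D 2" "f \<subseteq> e" by (auto simp: nsets_def)
    then show "e \<in> (\<Union>f\<in>nsets D 2. {e\<in>nsets V k. f \<subseteq> e})" using e by blast
  qed
  then have "card {e\<in>nsets V k. 2 \<le> card (e \<inter> D)} \<le> card (\<Union>f\<in>nsets D 2. {e\<in>nsets V k. f \<subseteq> e})"
    using fin by (intro card_mono) auto
  also have "\<dots> \<le> (\<Sum>f\<in>nsets D 2. card {e\<in>nsets V k. f \<subseteq> e})"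
    by (rule card_UN_le[OF fin(2)])
  also have "\<dots> = (\<Sum>f\<in>nsets D 2. (card V - 2) choose (k - 2))"
  proof (intro sum.cong refl)
    fix f assume "f \<in> nsets D 2"
    then have "f \<subseteq> V" "card f = 2" using V by (auto simp: nsets_def)
    then show "card {e\<in>nsets V k. f \<subseteq> e} = (card V - 2) choose (k - 2)"
      using card_nsets_superset[OF V(1), of f k] k by simp
  qed
  also have "\<dots> = (card D choose 2) * ((card V - 2) choose (k - 2))"
    using fD by (simp add: card_nsets)
  also have "\<dots> \<le> (card D)\<^sup>2 * ((card V - 2) choose (k - 2))"
    using binomial_fact_pow[of "card D" 2] by (intro mult_right_mono) (auto simp: fact_numeral)
  finally show ?thesis .
qed

text \<open>Compares the number of edges through a pair with the normalization in
  \<open>edge_prob\<close>: the expected number of hyperedges through a given pair is of order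
  \<open>ln n / n\<close>.\<close>

lemma binomial_absorb2:
  assumes "k \<ge> 2" "n \<ge> 2"
  shows "(real n - 1) * real ((n - 2) choose (k - 2)) = (real k - 1) * real ((n - 1) choose (k - 1))"
proof -
  have "(n - 1) * ((n - 2) choose (k - 2)) = (k - 1) * ((n - 1) choose (k - 1))"
    using binomial_absorption[of "k - 2" "n - 1"] assms by (simp add: Suc_diff_Suc numeral_2_eq_2)
  then have "real ((n - 1) * ((n - 2) choose (k - 2))) = real ((k - 1) * ((n - 1) choose (k - 1)))"
    by simp
  then show ?thesis using assms by (simp add: of_nat_diff)
qed

lemma balanced_card:
  assumes "\<sigma> \<in> balanced_labels (2 * m)" "s = 1 \<or> s = - 1"
  shows "card {v\<in>{1..2 * m}. \<sigma> v = s} = m"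
proof -
  have sv: "\<sigma> \<in> sign_vectors (2 * m)" and eq: "card {v \<in> {1..2 * m}. \<sigma> v = 1} = card {v \<in> {1..2 * m}. \<sigma> v = -1}"
    using assms by (auto simp: balanced_labels_def)
  have "{1..2 * m} = {v \<in> {1..2 * m}. \<sigma> v = 1} \<union> {v \<in> {1..2 * m}. \<sigma> v = -1}"
    using sign_vectorsD[OF sv] by blast
  then have "2 * m = card ({v \<in> {1..2 * m}. \<sigma> v = 1} \<union> {v \<in> {1..2 * m}. \<sigma> v = -1})"
    by (metis card_atLeastAtMost diff_Suc_1)
  also have "\<dots> = card {v \<in> {1..2 * m}. \<sigma> v = 1} + card {v \<in> {1..2 * m}. \<sigma> v = -1}"
    by (intro card_Un_disjoint) auto
  finally show ?thesis using eq assms(2) by auto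
qed

lemma balanced_card_Diff:
  assumes \<sigma>: "\<sigma> \<in> balanced_labels (2 * m)" "s = 1 \<or> s = - 1"
    and D: "D \<subseteq> {1..2 * m}" "card {v\<in>D. \<sigma> v = s} = r"
  shows "card {v\<in>{1..2 * m} - D. \<sigma> v = s} = m - r"
proof -
  have "{v\<in>{1..2 * m} - D. \<sigma> v = s} = {v\<in>{1..2 * m}. \<sigma> v = s} - {v\<in>D. \<sigma> v = s}" by auto
  moreover have "finite {v\<in>D. \<sigma> v = s}" using D finite_subset[of D] by auto
  ultimately show ?thesis
    using balanced_card[OF \<sigma>] D by (subst \<open>_ = _ - _\<close>, subst card_Diff_subset) auto
qed

text \<open>Serves both halves: with \<open>T\<close> the flipped set itself above the threshold,
  and with \<open>T\<close> the pool of candidates for an exchange below it.\<close>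

definition private_edges :: "nat \<Rightarrow> nat \<Rightarrow> nat set \<Rightarrow> nat \<Rightarrow> nat set set" where
  "private_edges n k T u = {e \<in> nsets {1..n} k. e \<inter> T = {u}}"

lemma sum_private_edges:
  fixes h :: "nat set \<Rightarrow> real"
  assumes "T \<subseteq> {1..n}" "u \<in> T" "k \<ge> 1"
  shows "(\<Sum>e\<in>private_edges n k T u. h e) = (\<Sum>f\<in>nsets ({1..n} - T) (k - 1). h (insert u f))"
proof (rule sum.reindex_bij_witness[where i = "insert u" and j = "\<lambda>e. e - {u}"])
  fix e assume e: "e \<in> private_edges n k T u"
  then have ue: "u \<in> e" by (auto simp: private_edges_def)
  then show "insert u (e - {u}) = e" by auto
  then show "h (insert u (e - {u})) = h e" by simp
  show "e - {u} \<in> nsets ({1..n} - T) (k - 1)"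
    using e ue by (auto simp: private_edges_def nsets_def card_Diff_singleton)
next
  fix f assume f: "f \<in> nsets ({1..n} - T) (k - 1)"
  then have "u \<notin> f" "finite f" using assms(2) by (auto simp: nsets_def)
  then show "insert u f - {u} = f" by simp
  show "insert u f \<in> private_edges n k T u"
    using f \<open>u \<notin> f\<close> \<open>finite f\<close> assms by (auto simp: private_edges_def nsets_def)
qed

text \<open>As \<open>T\<close> takes \<open>r\<close> vertices from each class,
  \<open>m - r\<close> remain in each, and \<open>star_sum\<close> applies with classes of equal
  size. Flipping \<open>u\<close> alone has the same effect on these edges as flipping any subset of
  \<open>T\<close> that contains \<open>u\<close>.\<close>

lemma sum_private_edges_rate:
  assumes k: "k \<ge> 2" and \<sigma>: "\<sigma> \<in> balanced_labels (2 * m)" and T: "T \<subseteq> {1..2 * m}"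
    and r: "card {v\<in>T. \<sigma> v = 1} = r" "card {v\<in>T. \<sigma> v = - 1} = r" and u: "u \<in> T"
  shows "(\<Sum>e\<in>private_edges (2 * m) k T u. rate k \<alpha> \<beta> (2 * m) \<sigma> e * g (gap \<sigma> {u} e / 4))
    = ln (2 * real m) * star_weight k \<alpha> \<beta> (2 * m) (m - r) g"
proof -
  let ?V = "{1..2 * m}"
  have sv: "\<sigma> \<in> sign_vectors (2 * m)" using \<sigma> by (auto simp: balanced_labels_def)
  have su: "\<sigma> u = 1 \<or> \<sigma> u = - 1" using sign_vectorsD[OF sv] T u by blast
  have sgn: "\<sigma> w = \<sigma> u \<or> \<sigma> w = - \<sigma> u" if "w \<in> ?V" for w
    using sign_vectorsD[OF sv that] su by auto
  have nz: "\<sigma> u \<noteq> - \<sigma> u" using su by auto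
  define P where "P = {w\<in>?V - T. \<sigma> w = \<sigma> u}"
  define R where "R = {w\<in>?V - T. \<sigma> w = - \<sigma> u}"
  have PR: "?V - T = P \<union> R" "P \<inter> R = {}"
    unfolding P_def R_def using sgn nz by (blast, auto)
  have cP: "card P = m - r" unfolding P_def
    using su r by (intro balanced_card_Diff \<sigma> T) auto
  have cR: "card R = m - r" unfolding R_def
    using su r by (intro balanced_card_Diff \<sigma> T) auto
  have "(\<Sum>e\<in>private_edges (2 * m) k T u. rate k \<alpha> \<beta> (2 * m) \<sigma> e * g (gap \<sigma> {u} e / 4))
     = (\<Sum>f\<in>nsets (?V - T) (k - 1). rate k \<alpha> \<beta> (2 * m) \<sigma> (insert u f) * g (gap \<sigma> {u} (insert u f) / 4))"
    using k by (intro sum_private_edges T u) auto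
  also have "\<dots> = (\<Sum>f\<in>nsets (P \<union> R) (k - 1). rate k \<alpha> \<beta> (2 * m) \<sigma> (insert u f) * g (real k - 1 - 2 * real (card (f \<inter> R))))"
    unfolding PR(1)
  proof (rule sum.cong[OF refl])
    fix f assume "f \<in> nsets (P \<union> R) (k - 1)"
    then have f: "finite f" "f \<subseteq> ?V - T" "card f = k - 1"
      unfolding PR(1) by (auto simp: nsets_def)
    have "f \<inter> {w. \<sigma> w \<noteq> \<sigma> u} = f \<inter> R"
      unfolding R_def using f(2) sgn nz by fastforce
    moreover have "gap \<sigma> {u} (insert u f) = 4 * (real (card f) - 2 * real (card (f \<inter> {w. \<sigma> w \<noteq> \<sigma> u})))"
    proof (rule gap_insert)
      fix w assume "w \<in> insert u f"
      then have "w \<in> ?V" using f(2) u T by blast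
      then show "\<sigma> w = 1 \<or> \<sigma> w = - 1" by (rule sign_vectorsD[OF sv])
    qed (use f u in auto)
    ultimately have "gap \<sigma> {u} (insert u f) / 4 = real k - 1 - 2 * real (card (f \<inter> R))"
      using f(3) k by (simp add: of_nat_diff)
    then show "rate k \<alpha> \<beta> (2 * m) \<sigma> (insert u f) * g (gap \<sigma> {u} (insert u f) / 4)
       = rate k \<alpha> \<beta> (2 * m) \<sigma> (insert u f) * g (real k - 1 - 2 * real (card (f \<inter> R)))"
      by (simp only:)
  qed
  also have "\<dots> = ln (real (2 * m)) * star_weight k \<alpha> \<beta> (2 * m) (m - r) g"
  proof (rule star_sum[OF k])
    show "finite P" "finite R" by (auto simp: P_def R_def)
    show "P \<inter> R = {}" "card P = m - r" "card R = m - r" by (fact PR cP cR)+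
    show "\<sigma> w = \<sigma> u" if "w \<in> P" for w using that unfolding P_def by blast
    show "\<sigma> w \<noteq> \<sigma> u" if "w \<in> R" for w using that nz unfolding R_def by auto
  qed
  finally show ?thesis by simp
qed

lemma sum_nsets_boundary:
  fixes F :: "nat set \<Rightarrow> real"
  assumes D: "D \<subseteq> {1..n}" and F: "\<And>e. e \<inter> D = {} \<Longrightarrow> F e = 0"
  shows "(\<Sum>e\<in>nsets {1..n} k. F e) = (\<Sum>v\<in>D. \<Sum>e\<in>private_edges n k D v. F e)
     + (\<Sum>e\<in>{e\<in>nsets {1..n} k. 2 \<le> card (e \<inter> D)}. F e)"
proof -
  let ?E = "nsets {1..n} k"
  let ?E1 = "\<Union>v\<in>D. private_edges n k D v"
  let ?E2 = "{e\<in>?E. 2 \<le> card (e \<inter> D)}"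
  have fD: "finite D" by (rule finite_subset[OF D]) simp
  have fin: "finite ?E" by (simp add: finite_imp_finite_nsets)
  have fin1: "finite (private_edges n k D v)" for v using fin by (simp add: private_edges_def)
  have "(\<Sum>e\<in>?E. F e) = (\<Sum>e\<in>?E1 \<union> ?E2. F e)"
  proof (rule sum.mono_neutral_right)
    show "\<forall>e\<in>?E - (?E1 \<union> ?E2). F e = 0"
    proof
      fix e assume e: "e \<in> ?E - (?E1 \<union> ?E2)"
      have "card (e \<inter> D) \<noteq> 1"
      proof
        assume "card (e \<inter> D) = 1"
        then obtain v where "e \<inter> D = {v}" using card_1_singletonE by blast
        then have "v \<in> D" "e \<in> private_edges n k D v" using e by (auto simp: private_edges_def)
        then show False using e by blast
      qed
      moreover have "\<not> 2 \<le> card (e \<inter> D)" using e by auto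
      ultimately have "card (e \<inter> D) = 0" by linarith
      then show "F e = 0" using fD by (intro F) simp
    qed
  qed (use fin in \<open>auto simp: private_edges_def\<close>)
  also have "\<dots> = (\<Sum>e\<in>?E1. F e) + (\<Sum>e\<in>?E2. F e)"
    using fD fin fin1 by (intro sum.union_disjoint) (auto simp: private_edges_def)
  also have "(\<Sum>e\<in>?E1. F e) = (\<Sum>v\<in>D. \<Sum>e\<in>private_edges n k D v. F e)"
    using fD fin1 by (intro sum.UNION_disjoint) (auto simp: private_edges_def)
  finally show ?thesis .
qed

section \<open>Exponents of small and large flips\<close>

lemma card_eq_double:
  assumes \<sigma>: "\<sigma> \<in> sign_vectors n" and D: "D \<subseteq> {1..n}"
    and r: "card {v\<in>D. \<sigma> v = 1} = r" "card {v\<in>D. \<sigma> v = - 1} = r"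
  shows "card D = 2 * r"
proof -
  have fD: "finite D" using D finite_subset by blast
  have "D = {v\<in>D. \<sigma> v = 1} \<union> {v\<in>D. \<sigma> v = - 1}" using sign_vectorsD[OF \<sigma>] D by blast
  then have "card D = card ({v\<in>D. \<sigma> v = 1} \<union> {v\<in>D. \<sigma> v = - 1})" by simp
  also have "\<dots> = r + r" using r fD by (subst card_Un_disjoint) auto
  finally show ?thesis by simp
qed

text \<open>Each vertex of \<open>D\<close> contributes the exponent of its own star, taken over
  private edges. The edges with several vertices in \<open>D\<close> contribute at most a multiple
  of \<open>r\<^sup>2 * ln n / n\<close>, which \<open>r \<le> \<epsilon> * m\<close> turns into a
  small fraction of the main term \<open>r * ln n\<close>.\<close>

lemma small_exponent:
  assumes k: "k \<ge> 2" and \<beta>: "0 < \<beta>" "\<beta> \<le> \<alpha>" and \<eta>: "\<eta> > 0" and t: "t \<ge> 0"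
  shows "\<exists>\<epsilon>>0. \<forall>\<^sub>F m in sequentially. \<forall>\<sigma>\<in>balanced_labels (2 * m). \<forall>D\<subseteq>{1..2 * m}. \<forall>r.
     card {v\<in>D. \<sigma> v = 1} = r \<longrightarrow> card {v\<in>D. \<sigma> v = - 1} = r \<longrightarrow> real r \<le> \<epsilon> * real m \<longrightarrow>
     real (2 * r) * ln (2 * real m) * (I2_fun k \<alpha> \<beta> t - \<eta>)
       \<le> (\<Sum>e\<in>nsets {1..2 * m} k. rate k \<alpha> \<beta> (2 * m) \<sigma> e * (1 - exp (- t * gap \<sigma> D e / 4)))"
proof -
  define g where "g c = 1 - exp (- t * c)" for c :: real
  define K where "K = exp (t * real k ^ 2)"
  obtain \<epsilon>1 where \<epsilon>1: "\<epsilon>1 > 0" "\<forall>\<^sub>F m in sequentially. \<forall>r\<le>m. (1 - \<epsilon>1) * real m \<le> real r \<longrightarrow>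
     \<bar>star_weight k \<alpha> \<beta> (2 * m) r g - star_limit k \<alpha> \<beta> g\<bar> \<le> \<eta> / 2"
    using star_weight_limit[OF half_gt_zero[OF \<eta>], of k \<alpha> \<beta> g] by blast
  \<comment> \<open>\<open>K\<close> bounds the exponential on a single edge, \<alpha> comes from
    the rate and \<open>k - 1\<close> from \<open>binomial_absorb2\<close>; the factor 4 leaves room
    for comparing \<open>2 * r\<close> with \<open>2 * m - 1\<close>.\<close>
  define B where "B = 4 * \<alpha> * K * (real k - 1)"
  have B: "B > 0" unfolding B_def K_def using k \<beta> by simp
  define \<epsilon> where "\<epsilon> = min (min \<epsilon>1 1) (\<eta> / (2 * B))"
  have "\<epsilon> \<le> \<eta> / (2 * B)" "\<epsilon> > 0" "\<epsilon> \<le> \<epsilon>1" "\<epsilon> \<le> 1"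
    using \<epsilon>1(1) B \<eta> by (auto simp: \<epsilon>_def)
  moreover from this have "\<epsilon> * B \<le> \<eta> / 2"
    using B by (simp add: pos_le_divide_eq algebra_simps)
  ultimately have \<epsilon>: "\<epsilon> > 0" "\<epsilon> \<le> \<epsilon>1" "\<epsilon> * B \<le> \<eta> / 2" "\<epsilon> \<le> 1" by blast+
  have "\<forall>\<^sub>F m in sequentially. \<forall>\<sigma>\<in>balanced_labels (2 * m). \<forall>D\<subseteq>{1..2 * m}. \<forall>r.
     card {v\<in>D. \<sigma> v = 1} = r \<longrightarrow> card {v\<in>D. \<sigma> v = - 1} = r \<longrightarrow> real r \<le> \<epsilon> * real m \<longrightarrow>
     real (2 * r) * ln (2 * real m) * (I2_fun k \<alpha> \<beta> t - \<eta>)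
       \<le> (\<Sum>e\<in>nsets {1..2 * m} k. rate k \<alpha> \<beta> (2 * m) \<sigma> e * (1 - exp (- t * gap \<sigma> D e / 4)))"
    using \<epsilon>1(2) eventually_gt_at_top[of k]
  proof eventually_elim
    case (elim m)
    show ?case
    proof (intro ballI allI impI)
      fix \<sigma> D r
      assume \<sigma>: "\<sigma> \<in> balanced_labels (2 * m)" and D: "D \<subseteq> {1..2 * m}"
        and r1: "card {v\<in>D. \<sigma> v = 1} = r" and r2: "card {v\<in>D. \<sigma> v = - 1} = r" and r: "real r \<le> \<epsilon> * real m"
      let ?V = "{1..2 * m}" and ?p = "rate k \<alpha> \<beta> (2 * m) \<sigma>"
      let ?E2 = "{e\<in>nsets ?V k. 2 \<le> card (e \<inter> D)}"
      define L where "L = ln (2 * real m)"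
      have m: "m > k" "m \<ge> 1" using elim by auto
      have L: "L \<ge> 0" unfolding L_def using m by simp
      have sv: "\<sigma> \<in> sign_vectors (2 * m)" using \<sigma> by (auto simp: balanced_labels_def)
      have cardD: "card D = 2 * r" by (rule card_eq_double[OF sv D r1 r2])
      have "real r \<le> 1 * real m" using r \<epsilon>(4) mult_right_mono[of \<epsilon> 1 "real m"] by linarith
      then have rm: "r \<le> m" by simp
      define F where "F e = ?p e * (1 - exp (- t * gap \<sigma> D e / 4))" for e
      have "(\<Sum>e\<in>nsets ?V k. F e) = (\<Sum>v\<in>D. \<Sum>e\<in>private_edges (2 * m) k D v. F e) + (\<Sum>e\<in>?E2. F e)"
        using D by (intro sum_nsets_boundary) (auto simp: F_def gap_disjoint)
      moreover have "(\<Sum>v\<in>D. \<Sum>e\<in>private_edges (2 * m) k D v. F e)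
          \<ge> (\<Sum>v\<in>D. L * (I2_fun k \<alpha> \<beta> t - \<eta> / 2))"
      proof (rule sum_mono)
        fix v assume v: "v \<in> D"
        have "\<epsilon> * real m \<le> \<epsilon>1 * real m" using \<epsilon> by (intro mult_right_mono) auto
        then have "(1 - \<epsilon>1) * real m \<le> real (m - r)"
          using r rm by (simp add: of_nat_diff algebra_simps)
        then have "\<bar>star_weight k \<alpha> \<beta> (2 * m) (m - r) g - star_limit k \<alpha> \<beta> g\<bar> \<le> \<eta> / 2"
          using elim by auto
        then have "I2_fun k \<alpha> \<beta> t - \<eta> / 2 \<le> star_weight k \<alpha> \<beta> (2 * m) (m - r) g"
          unfolding I2_fun_eq_star_limit g_def[abs_def, symmetric] by linarith
        then have "L * (I2_fun k \<alpha> \<beta> t - \<eta> / 2) \<le> L * star_weight k \<alpha> \<beta> (2 * m) (m - r) g"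
          using L by (rule mult_left_mono)
        also have "\<dots> = (\<Sum>e\<in>private_edges (2 * m) k D v. ?p e * g (gap \<sigma> {v} e / 4))"
          unfolding sum_private_edges_rate[OF k \<sigma> D r1 r2 v] L_def ..
        also have "\<dots> = (\<Sum>e\<in>private_edges (2 * m) k D v. F e)"
        proof (rule sum.cong[OF refl])
          fix e assume "e \<in> private_edges (2 * m) k D v"
          then have "gap \<sigma> {v} e = gap \<sigma> D e" by (intro gap_cong) (auto simp: private_edges_def)
          then show "?p e * g (gap \<sigma> {v} e / 4) = F e" by (simp add: F_def g_def)
        qed
        finally show "L * (I2_fun k \<alpha> \<beta> t - \<eta> / 2) \<le> (\<Sum>e\<in>private_edges (2 * m) k D v. F e)" .
      qed
      moreover have "(\<Sum>e\<in>?E2. F e) \<ge> - (real (2 * r) * L * (\<eta> / 2))"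
      proof -
        let ?N = "real ((2 * m - 1) choose (k - 1))"
        have N: "?N > 0" using m by simp
        have "- (\<Sum>e\<in>?E2. F e) = (\<Sum>e\<in>?E2. - F e)" by (simp add: sum_negf)
        also have "\<dots> \<le> (\<Sum>e\<in>?E2. edge_prob k \<alpha> (2 * m) * K)"
        proof (rule sum_mono)
          fix e assume e: "e \<in> ?E2"
          have p: "0 \<le> ?p e" "?p e \<le> edge_prob k \<alpha> (2 * m)"
            using rate_bounds[OF \<beta>, of "2 * m"] m by auto
          have "\<bar>gap \<sigma> D e\<bar> \<le> real k ^ 2" using abs_gap_le[OF sv] e by auto
          then have "t * (- gap \<sigma> D e / 4) \<le> t * real k ^ 2" using t by (intro mult_left_mono) auto
          then have "exp (- t * gap \<sigma> D e / 4) \<le> K" by (simp add: K_def)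
          then have "?p e * (exp (- t * gap \<sigma> D e / 4) - 1) \<le> ?p e * K"
            using p by (intro mult_left_mono) auto
          also have "\<dots> \<le> edge_prob k \<alpha> (2 * m) * K"
            using p by (intro mult_right_mono) (auto simp: K_def)
          finally show "- F e \<le> edge_prob k \<alpha> (2 * m) * K" by (simp add: F_def algebra_simps)
        qed
        also have "\<dots> = real (card ?E2) * (edge_prob k \<alpha> (2 * m) * K)" by simp
        also have "\<dots> \<le> real ((2 * r)\<^sup>2 * ((2 * m - 2) choose (k - 2))) * (edge_prob k \<alpha> (2 * m) * K)"
        proof (intro mult_right_mono)
          have "card ?E2 \<le> (2 * r)\<^sup>2 * ((2 * m - 2) choose (k - 2))"
            using card_nsets_two_in_le[OF _ D k] by (simp add: cardD)
          then show "real (card ?E2) \<le> real ((2 * r)\<^sup>2 * ((2 * m - 2) choose (k - 2)))"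
            using of_nat_le_iff by blast
          have "0 \<le> edge_prob k \<alpha> (2 * m)" using \<beta> m by (simp add: edge_prob_def)
          then show "0 \<le> edge_prob k \<alpha> (2 * m) * K" by (simp add: K_def)
        qed
        also have "\<dots> = (real (2 * r) * L * (\<alpha> * K / ?N)) * (real (2 * r) * real ((2 * m - 2) choose (k - 2)))"
          by (simp add: edge_prob_def L_def power2_eq_square)
        also have "\<dots> \<le> (real (2 * r) * L * (\<alpha> * K / ?N)) * (4 * \<epsilon> * (real k - 1) * ?N)"
        proof (rule mult_left_mono)
          have "real (2 * r) \<le> 4 * \<epsilon> * (real (2 * m) - 1)"
          proof -
            have "\<epsilon> * (2 * real m) \<le> \<epsilon> * (4 * (2 * real m - 1))"
              using \<epsilon> m by (intro mult_left_mono) auto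
            then show ?thesis using r by (simp add: algebra_simps)
          qed
          then have "real (2 * r) * real ((2 * m - 2) choose (k - 2))
              \<le> 4 * \<epsilon> * (real (2 * m) - 1) * real ((2 * m - 2) choose (k - 2))"
            by (rule mult_right_mono) simp
          also have "\<dots> = 4 * \<epsilon> * ((real (2 * m) - 1) * real ((2 * m - 2) choose (k - 2)))" by simp
          also have "\<dots> = 4 * \<epsilon> * ((real k - 1) * ?N)"
            using m by (subst binomial_absorb2[OF k]) auto
          finally show "real (2 * r) * real ((2 * m - 2) choose (k - 2)) \<le> 4 * \<epsilon> * (real k - 1) * ?N" by simp
          show "0 \<le> real (2 * r) * L * (\<alpha> * K / ?N)" using L \<beta> N by (simp add: K_def)
        qed
        also have "\<dots> = real (2 * r) * L * (\<epsilon> * B)" using N by (simp add: B_def)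
        also have "\<dots> \<le> real (2 * r) * L * (\<eta> / 2)" using L \<epsilon> by (intro mult_left_mono) auto
        finally show ?thesis by linarith
      qed
      moreover have "(\<Sum>v\<in>D. L * (I2_fun k \<alpha> \<beta> t - \<eta> / 2)) = real (2 * r) * L * (I2_fun k \<alpha> \<beta> t - \<eta> / 2)"
        by (simp add: cardD)
      ultimately have "real (2 * r) * L * (I2_fun k \<alpha> \<beta> t - \<eta> / 2) - real (2 * r) * L * (\<eta> / 2) \<le> (\<Sum>e\<in>nsets ?V k. F e)"
        by linarith
      moreover have "real (2 * r) * L * (I2_fun k \<alpha> \<beta> t - \<eta> / 2) - real (2 * r) * L * (\<eta> / 2)
         = real (2 * r) * L * (I2_fun k \<alpha> \<beta> t - \<eta>)"
        by (simp add: algebra_simps)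
      ultimately show "real (2 * r) * ln (2 * real m) * (I2_fun k \<alpha> \<beta> t - \<eta>)
          \<le> (\<Sum>e\<in>nsets ?V k. ?p e * (1 - exp (- t * gap \<sigma> D e / 4)))"
        unfolding F_def L_def by simp
    qed
  qed
  with \<epsilon> show ?thesis by blast
qed

text \<open>For positive \<open>y\<close> this is
  \<open>exp (- y) \<le> 1 / (1 + y) \<le> 1 - y + y\<^sup>2\<close>. It reduces the exponent of the
  Chernoff bound to first and second moments of \<open>gap\<close>.\<close>

lemma one_minus_exp_ge:
  fixes y :: real
  assumes "y \<ge> - 1"
  shows "y - y\<^sup>2 \<le> 1 - exp (- y)"
proof (cases "y \<le> 0")
  case True
  then show ?thesis using exp_bound[of "- y"] assms by simp
next
  case False
  have "1 * 1 \<le> (1 + y) * (1 - y + y\<^sup>2)"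
  proof -
    have "(1 + y) * (1 - y + y\<^sup>2) = 1 + y ^ 3" by (simp add: power2_eq_square power3_eq_cube algebra_simps)
    then show ?thesis using False by simp
  qed
  moreover have "(1 + y) * exp (- y) \<le> 1"
  proof -
    have "(1 + y) * exp (- y) \<le> exp y * exp (- y)" by (intro mult_right_mono) auto
    then show ?thesis by (simp flip: exp_add)
  qed
  ultimately have "(1 + y) * exp (- y) \<le> (1 + y) * (1 - y + y\<^sup>2)" by simp
  then have "exp (- y) \<le> 1 - y + y\<^sup>2" using False by simp
  then show ?thesis by simp
qed

lemma sum_flip:
  assumes \<sigma>: "\<sigma> \<in> sign_vectors n" and D: "D \<subseteq> {1..n}"
  shows "(\<Sum>v\<in>{1..n}. flip D \<sigma> v) = (\<Sum>v\<in>{1..n}. \<sigma> v)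
    - 2 * (int (card {v\<in>D. \<sigma> v = 1}) - int (card {v\<in>D. \<sigma> v = - 1}))"
proof -
  have fD: "finite D" using D finite_subset by blast
  have "(\<Sum>v\<in>{1..n}. flip D \<sigma> v) = (\<Sum>v\<in>{1..n}. \<sigma> v - 2 * (if v \<in> D then \<sigma> v else 0))"
    by (intro sum.cong refl) (auto simp: flip_def)
  also have "\<dots> = (\<Sum>v\<in>{1..n}. \<sigma> v) - 2 * (\<Sum>v\<in>{1..n} \<inter> D. \<sigma> v)"
    by (simp add: sum_subtractf sum.inter_restrict flip: sum_distrib_left)
  also have "{1..n} \<inter> D = {v\<in>D. \<sigma> v = 1} \<union> {v\<in>D. \<sigma> v = - 1}"
    using D sign_vectorsD[OF \<sigma>] by blast
  also have "(\<Sum>v\<in>{v\<in>D. \<sigma> v = 1} \<union> {v\<in>D. \<sigma> v = - 1}. \<sigma> v)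
      = int (card {v\<in>D. \<sigma> v = 1}) - int (card {v\<in>D. \<sigma> v = - 1})"
    using fD by (subst sum.union_disjoint) auto
  finally show ?thesis .
qed

text \<open>A balanced flip preserves the sum of all signs, so by
  \<open>sum_nsets_square_sum\<close> the gaps over all \<open>k\<close>-sets add up to 0. Only the
  excess rate on monochromatic edges remains, which is positive since \<alpha> > \<beta>, and each
  class contributes a multiple of \<open>r * (m - r)\<close>. With
  \<open>\<epsilon> * m \<le> r \<le> m / 2\<close> this first moment has order
  \<open>m * ln m\<close>. The second moment has at most the same order, so a small parameter
  \<open>s\<close> makes the first-order term win.\<close>

lemma large_exponent:
  assumes k: "k \<ge> 2" and \<beta>: "0 < \<beta>" "\<beta> < \<alpha>" and \<epsilon>: "\<epsilon> > 0"
  shows "\<exists>s>0. \<exists>c>0. \<forall>\<^sub>F m in sequentially. \<forall>\<sigma>\<in>balanced_labels (2 * m). \<forall>D\<subseteq>{1..2 * m}. \<forall>r.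
     card {v\<in>D. \<sigma> v = 1} = r \<longrightarrow> card {v\<in>D. \<sigma> v = - 1} = r \<longrightarrow> \<epsilon> * real m \<le> real r \<longrightarrow> 2 * r \<le> m \<longrightarrow>
     c * real m * ln (2 * real m)
       \<le> (\<Sum>e\<in>nsets {1..2 * m} k. rate k \<alpha> \<beta> (2 * m) \<sigma> e * (1 - exp (- s * gap \<sigma> D e)))"
proof -
  \<comment> \<open>In units of \<open>m * ln (2 * m)\<close>, \<open>A\<close> bounds the first
    moment of \<open>gap\<close> from below and \<open>B\<close> the second moment from
    above.\<close>
  define A where "A = 4 * \<epsilon> * (\<alpha> - \<beta>) / 2 ^ k"
  define B where "B = 2 * \<alpha> * real k ^ 4"
  have A: "A > 0" using \<epsilon> \<beta> by (simp add: A_def)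
  have B: "B > 0" using \<beta> k by (simp add: B_def)
  \<comment> \<open>The first entry keeps \<open>s * gap\<close> within [-1, 1], as
    \<open>one_minus_exp_ge\<close> requires; by the second, the quadratic term consumes at most
    half of the linear one.\<close>
  define s where "s = min (1 / real k ^ 2) (A / (2 * B))"
  have s: "s > 0" "s * real k ^ 2 \<le> 1" "s * B \<le> A / 2"
  proof -
    show "s > 0" using A B k by (simp add: s_def)
    have "s \<le> 1 / real k ^ 2" "s \<le> A / (2 * B)" by (simp_all add: s_def)
    then show "s * real k ^ 2 \<le> 1" "s * B \<le> A / 2"
      using k B by (simp_all add: pos_le_divide_eq algebra_simps)
  qed
  \<comment> \<open>The tolerance is half of the limit \<open>1 / 2 ^ (k - 1)\<close>, so the ratio
    stays above \<open>1 / 2 ^ k\<close>. It is applied at \<open>r = m - 1\<close>, which is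
    admissible once \<open>1 \<le> \<epsilon>2 * m\<close>.\<close>
  obtain \<epsilon>2 where \<epsilon>2: "\<epsilon>2 > 0" "\<forall>\<^sub>F m in sequentially. \<forall>r\<le>m. (1 - \<epsilon>2) * real m \<le> real r \<longrightarrow>
     \<bar>real ((r choose 0) * (r choose (k - 1 - 0))) / real ((2 * m - 1) choose (k - 1)) - real ((k - 1) choose 0) / 2 ^ (k - 1)\<bar> \<le> 1 / 2 ^ k"
    using binomial_product_ratio_limit[of 0 "k - 1" "1 / 2 ^ k"] by auto
  have "\<forall>\<^sub>F m in sequentially. 1 \<le> \<epsilon>2 * real m"
    using \<epsilon>2(1) by real_asymp
  with \<epsilon>2(2) eventually_gt_at_top[of k]
  have "\<forall>\<^sub>F m in sequentially. \<forall>\<sigma>\<in>balanced_labels (2 * m). \<forall>D\<subseteq>{1..2 * m}. \<forall>r.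
     card {v\<in>D. \<sigma> v = 1} = r \<longrightarrow> card {v\<in>D. \<sigma> v = - 1} = r \<longrightarrow> \<epsilon> * real m \<le> real r \<longrightarrow> 2 * r \<le> m \<longrightarrow>
     (s * A / 2) * real m * ln (2 * real m)
       \<le> (\<Sum>e\<in>nsets {1..2 * m} k. rate k \<alpha> \<beta> (2 * m) \<sigma> e * (1 - exp (- s * gap \<sigma> D e)))"
  proof eventually_elim
    case (elim m)
    show ?case
    proof (intro ballI allI impI)
      fix \<sigma> D r
      assume \<sigma>: "\<sigma> \<in> balanced_labels (2 * m)" and D: "D \<subseteq> {1..2 * m}"
        and r1: "card {v\<in>D. \<sigma> v = 1} = r" and r2: "card {v\<in>D. \<sigma> v = - 1} = r"
        and r: "\<epsilon> * real m \<le> real r" "2 * r \<le> m"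
      let ?V = "{1..2 * m}" and ?p = "rate k \<alpha> \<beta> (2 * m) \<sigma>" and ?N = "real ((2 * m - 1) choose (k - 1))"
      let ?E = "nsets ?V k"
      define C where "C = (m - 2) choose (k - 2)"
      define L where "L = ln (2 * real m)"
      define Vs where "Vs s = {v\<in>?V. \<sigma> v = s}" for s
      have m: "m > k" "m \<ge> 1" using elim by auto
      have L: "L \<ge> 0" unfolding L_def using m by simp
      have N: "?N > 0" using m by simp
      have sv: "\<sigma> \<in> sign_vectors (2 * m)" using \<sigma> by (auto simp: balanced_labels_def)
      have sgn: "\<sigma> v = 1 \<or> \<sigma> v = - 1" if "v \<in> ?V" for v using sign_vectorsD[OF sv that] .
      have finE: "finite ?E" by (simp add: finite_imp_finite_nsets)
      have sq: "(flip D \<sigma> v)\<^sup>2 = (\<sigma> v)\<^sup>2" for v by (simp add: flip_def)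

      \<comment> \<open>Within the class of sign \<open>s\<close> the flip moves the sum of signs
        from \<open>s * m\<close> to \<open>s * (m - 2 * r)\<close>, while the squared signs
        cancel.\<close>
      have gap_class: "(\<Sum>e\<in>nsets (Vs s) k. gap \<sigma> D e) = real C * (4 * real r * (real m - real r))" if s: "s = 1 \<or> s = - 1" for s
      proof -
        have fin: "finite (Vs s)" and card: "card (Vs s) = m"
          using balanced_card[OF \<sigma> s] by (auto simp: Vs_def)
        have Ds: "Vs s \<inter> D = {v\<in>D. \<sigma> v = s}" using D by (auto simp: Vs_def)
        have cDs: "card (Vs s \<inter> D) = r" unfolding Ds using s r1 r2 by auto
        have S1: "(\<Sum>v\<in>Vs s. \<sigma> v) = s * int m"
          using card by (simp add: Vs_def)
        have "(\<Sum>v\<in>Vs s. flip D \<sigma> v) = (\<Sum>v\<in>Vs s. s - 2 * s * (if v \<in> D then 1 else 0))"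
          by (intro sum.cong refl) (auto simp: flip_def Vs_def)
        also have "\<dots> = s * int m - 2 * s * (\<Sum>v\<in>Vs s. if v \<in> D then 1 else 0)"
          by (simp only: sum_subtractf sum_distrib_left[symmetric]) (simp add: card)
        also have "(\<Sum>v\<in>Vs s. if v \<in> D then 1 else 0 :: int) = int (card (Vs s \<inter> D))"
          using fin by (simp add: sum.If_cases)
        finally have S2: "(\<Sum>v\<in>Vs s. flip D \<sigma> v) = s * int m - 2 * s * int r"
          by (simp add: cDs)
        have "(\<Sum>e\<in>nsets (Vs s) k. (\<Sum>v\<in>e. \<sigma> v)\<^sup>2) - (\<Sum>e\<in>nsets (Vs s) k. (\<Sum>v\<in>e. flip D \<sigma> v)\<^sup>2)
          = int C * ((s * int m)\<^sup>2 - (s * int m - 2 * s * int r)\<^sup>2)"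
          unfolding sum_nsets_square_sum[OF fin k] card S1 S2 sq C_def by (simp add: algebra_simps)
        also have "(s * int m)\<^sup>2 - (s * int m - 2 * s * int r)\<^sup>2 = 4 * int r * (int m - int r)"
          using s by (auto simp: power2_eq_square algebra_simps)
        finally have "real_of_int ((\<Sum>e\<in>nsets (Vs s) k. (\<Sum>v\<in>e. \<sigma> v)\<^sup>2) - (\<Sum>e\<in>nsets (Vs s) k. (\<Sum>v\<in>e. flip D \<sigma> v)\<^sup>2))
          = real_of_int (int C * (4 * int r * (int m - int r)))" by simp
        then show ?thesis by (simp add: gap_def sum_subtractf)
      qed
      have gap_total: "(\<Sum>e\<in>?E. gap \<sigma> D e) = 0"
      proof -
        have S: "(\<Sum>v\<in>?V. flip D \<sigma> v) = (\<Sum>v\<in>?V. \<sigma> v)"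
          unfolding sum_flip[OF sv D] r1 r2 by simp
        have "(\<Sum>e\<in>?E. (\<Sum>v\<in>e. \<sigma> v)\<^sup>2) = (\<Sum>e\<in>?E. (\<Sum>v\<in>e. flip D \<sigma> v)\<^sup>2)"
          unfolding sum_nsets_square_sum[OF finite_atLeastAtMost k] S sq ..
        then have "real_of_int (\<Sum>e\<in>?E. (\<Sum>v\<in>e. \<sigma> v)\<^sup>2) = real_of_int (\<Sum>e\<in>?E. (\<Sum>v\<in>e. flip D \<sigma> v)\<^sup>2)" by simp
        then show ?thesis by (simp add: gap_def sum_subtractf)
      qed
      have mono: "{e\<in>?E. monochromatic \<sigma> e} = nsets (Vs 1) k \<union> nsets (Vs (- 1)) k"
      proof (intro equalityI subsetI)
        fix e assume e: "e \<in> {e\<in>?E. monochromatic \<sigma> e}"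
        then have e': "e \<subseteq> ?V" "finite e" "card e = k" and mon: "\<forall>u\<in>e. \<forall>v\<in>e. \<sigma> u = \<sigma> v"
          unfolding nsets_def monochromatic_def by blast+
        have "e \<noteq> {}" using e' k by auto
        then obtain u where u: "u \<in> e" by blast
        have "e \<subseteq> Vs (\<sigma> u)" using e'(1) mon u unfolding Vs_def by blast
        moreover have "\<sigma> u = 1 \<or> \<sigma> u = - 1" using sgn u e'(1) by blast
        ultimately have "e \<subseteq> Vs 1 \<or> e \<subseteq> Vs (- 1)" by metis
        then show "e \<in> nsets (Vs 1) k \<union> nsets (Vs (- 1)) k" using e'(2,3) by (auto simp: nsets_def)
      next
        fix e assume "e \<in> nsets (Vs 1) k \<union> nsets (Vs (- 1)) k"
        then obtain s where "e \<subseteq> Vs s" "finite e" "card e = k" by (auto simp: nsets_def)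
        moreover from this have "e \<subseteq> ?V" "\<And>w. w \<in> e \<Longrightarrow> \<sigma> w = s" unfolding Vs_def by blast+
        ultimately show "e \<in> {e\<in>?E. monochromatic \<sigma> e}"
          unfolding nsets_def monochromatic_def by simp
      qed
      have disj: "nsets (Vs 1) k \<inter> nsets (Vs (- 1)) k = {}"
      proof (rule ccontr)
        assume "nsets (Vs 1) k \<inter> nsets (Vs (- 1)) k \<noteq> {}"
        then obtain e where e: "e \<subseteq> Vs 1" "e \<subseteq> Vs (- 1)" "card e = k" unfolding nsets_def by blast
        moreover have "Vs 1 \<inter> Vs (- 1) = {}" unfolding Vs_def by auto
        ultimately have "e = {}" by blast
        then show False using e k by simp
      qed
      define p1 where "p1 = edge_prob k \<alpha> (2 * m)"
      define p0 where "p0 = edge_prob k \<beta> (2 * m)"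
      have lin: "A * (real m * L) \<le> (\<Sum>e\<in>?E. ?p e * gap \<sigma> D e)"
      proof -
        have "(\<Sum>e\<in>?E. ?p e * gap \<sigma> D e) = (\<Sum>e\<in>?E. p0 * gap \<sigma> D e + (if monochromatic \<sigma> e then (p1 - p0) * gap \<sigma> D e else 0))"
          by (intro sum.cong refl) (simp add: rate_def p0_def p1_def algebra_simps)
        also have "\<dots> = p0 * (\<Sum>e\<in>?E. gap \<sigma> D e) + (p1 - p0) * (\<Sum>e\<in>{e\<in>?E. monochromatic \<sigma> e}. gap \<sigma> D e)"
          unfolding sum.distrib sum_distrib_left sum.inter_filter[OF finE]
          by (intro arg_cong2[where f = "(+)"] refl sum.cong) simp
        also have "(\<Sum>e\<in>{e\<in>?E. monochromatic \<sigma> e}. gap \<sigma> D e) = 2 * (real C * (4 * real r * (real m - real r)))"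
          unfolding mono using gap_class disj
          by (subst sum.union_disjoint) (auto simp: finite_imp_finite_nsets Vs_def)
        finally have eq: "(\<Sum>e\<in>?E. ?p e * gap \<sigma> D e) = (p1 - p0) * (2 * (real C * (4 * real r * (real m - real r))))"
          using gap_total by simp
        have Cm: "?N / 2 ^ k \<le> real C * real m"
        proof -
          have "(1 - \<epsilon>2) * real m \<le> real (m - 1)" using elim by (simp add: of_nat_diff algebra_simps)
          then have "\<bar>real ((m - 1) choose (k - 1)) / ?N - 1 / 2 ^ (k - 1)\<bar> \<le> 1 / 2 ^ k"
            using elim(1)[rule_format, of "m - 1"] by simp
          moreover have "1 / 2 ^ (k - 1) = 2 * (1 / 2 ^ k :: real)" using k by (cases k) auto
          ultimately have "1 / 2 ^ k \<le> real ((m - 1) choose (k - 1)) / ?N" by linarith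
          then have "?N / 2 ^ k \<le> real ((m - 1) choose (k - 1))" using N by (simp add: pos_le_divide_eq)
          also have "\<dots> \<le> (real k - 1) * real ((m - 1) choose (k - 1))"
            using k by (simp add: mult_le_cancel_right1)
          also have "\<dots> = (real m - 1) * real C" using m k by (subst binomial_absorb2[symmetric]) (auto simp: C_def)
          also have "\<dots> \<le> real C * real m" by (simp add: algebra_simps)
          finally show ?thesis .
        qed
        have "A * (real m * L) = ((\<alpha> - \<beta>) * L / ?N) * (2 * (4 * (\<epsilon> * real m) * (1 / 2) * (?N / 2 ^ k)))"
          using N by (simp add: A_def)
        also have "\<dots> \<le> ((\<alpha> - \<beta>) * L / ?N) * (2 * (4 * real r * (1 / 2) * (real C * real m)))"
          using r Cm \<beta> L N \<epsilon> by (intro mult_left_mono mult_mono) auto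
        also have "\<dots> = ((\<alpha> - \<beta>) * L / ?N) * (2 * (4 * real r * (real C * (real m / 2))))"
          by simp
        also have "\<dots> \<le> ((\<alpha> - \<beta>) * L / ?N) * (2 * (4 * real r * (real C * (real m - real r))))"
        proof -
          have "real m / 2 \<le> real m - real r" using r(2) by linarith
          then have "real C * (real m / 2) \<le> real C * (real m - real r)" by (intro mult_left_mono) auto
          then have "4 * real r * (real C * (real m / 2)) \<le> 4 * real r * (real C * (real m - real r))" by (rule mult_left_mono) auto
          then have "2 * (4 * real r * (real C * (real m / 2))) \<le> 2 * (4 * real r * (real C * (real m - real r)))" by (rule mult_left_mono) auto
          then show ?thesis by (rule mult_left_mono) (use \<beta> L N in auto)
        qed
        also have "(\<alpha> - \<beta>) * L / ?N = p1 - p0" by (simp add: p1_def p0_def edge_prob_def L_def diff_divide_distrib left_diff_distrib)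
        finally show ?thesis unfolding eq by (simp add: algebra_simps)
      qed
      have quad: "(\<Sum>e\<in>?E. ?p e * (gap \<sigma> D e)\<^sup>2) \<le> B * (real m * L)"
      proof -
        have "(\<Sum>e\<in>?E. ?p e * (gap \<sigma> D e)\<^sup>2) \<le> (\<Sum>e\<in>?E. p1 * real k ^ 4)"
        proof (rule sum_mono)
          fix e assume e: "e \<in> ?E"
          have "\<bar>gap \<sigma> D e\<bar> \<le> real k ^ 2" by (rule abs_gap_le[OF sv e])
          then have "\<bar>gap \<sigma> D e\<bar> ^ 2 \<le> (real k ^ 2) ^ 2" by (intro power_mono) auto
          then have "(gap \<sigma> D e)\<^sup>2 \<le> real k ^ 4" by (simp flip: power_mult)
          moreover have "0 \<le> ?p e" "?p e \<le> p1"
            unfolding p1_def using rate_bounds[of \<beta> \<alpha> "2 * m"] \<beta> m by auto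
          ultimately show "?p e * (gap \<sigma> D e)\<^sup>2 \<le> p1 * real k ^ 4" by (intro mult_mono) auto
        qed
        also have "\<dots> = (\<alpha> * L / ?N) * real k ^ 4 * real ((2 * m) choose k)"
          by (simp add: card_nsets p1_def edge_prob_def L_def)
        also have "\<dots> \<le> (\<alpha> * L / ?N) * real k ^ 4 * (2 * real m * ?N)"
        proof (rule mult_left_mono)
          have "k * ((2 * m) choose k) = 2 * m * ((2 * m - 1) choose (k - 1))"
            using k by (intro times_binomial_minus1_eq) auto
          then have "(2 * m) choose k \<le> 2 * m * ((2 * m - 1) choose (k - 1))" using k by (metis le_trans mult_le_mono1 nat_mult_1 one_le_numeral)
          then have "real ((2 * m) choose k) \<le> real (2 * m * ((2 * m - 1) choose (k - 1)))" using of_nat_le_iff by blast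
          then show "real ((2 * m) choose k) \<le> 2 * real m * ?N" by simp
          show "0 \<le> \<alpha> * L / ?N * real k ^ 4" using \<beta> L by simp
        qed
        also have "\<dots> = B * (real m * L)" using N by (simp add: B_def)
        finally show ?thesis .
      qed
      have "(s * A / 2) * (real m * L) \<le> s * (A * (real m * L)) - s\<^sup>2 * (B * (real m * L))"
      proof -
        have "s * (s * B) * (real m * L) \<le> s * (A / 2) * (real m * L)"
          using s L by (intro mult_right_mono mult_left_mono) auto
        then show ?thesis by (simp add: power2_eq_square algebra_simps)
      qed
      also have "\<dots> \<le> s * (\<Sum>e\<in>?E. ?p e * gap \<sigma> D e) - s\<^sup>2 * (\<Sum>e\<in>?E. ?p e * (gap \<sigma> D e)\<^sup>2)"
        using lin quad s by (intro diff_mono mult_left_mono) auto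
      also have "\<dots> = (\<Sum>e\<in>?E. ?p e * (s * gap \<sigma> D e - (s * gap \<sigma> D e)\<^sup>2))"
        by (simp add: sum_distrib_left algebra_simps power_mult_distrib flip: sum_subtractf)
      also have "\<dots> \<le> (\<Sum>e\<in>?E. ?p e * (1 - exp (- (s * gap \<sigma> D e))))"
      proof (intro sum_mono mult_left_mono one_minus_exp_ge)
        fix e assume e: "e \<in> ?E"
        have "s * (- gap \<sigma> D e) \<le> s * real k ^ 2"
          using abs_gap_le[OF sv e, of D] s by (intro mult_left_mono) auto
        then show "- 1 \<le> s * gap \<sigma> D e" using s by linarith
        show "0 \<le> ?p e" using rate_bounds[of \<beta> \<alpha> "2 * m"] \<beta> m by auto
      qed
      finally show "(s * A / 2) * real m * ln (2 * real m) \<le> (\<Sum>e\<in>?E. ?p e * (1 - exp (- s * gap \<sigma> D e)))"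
        by (simp add: L_def mult.assoc)
    qed
  qed
  moreover have "s * A / 2 > 0" using s A by simp
  ultimately show ?thesis using s(1) by blast
qed

section \<open>Recovery above the threshold\<close>

lemma trunc_objective_uminus: "trunc_objective n H (\<lambda>v. - x v) = trunc_objective n H x"
  unfolding trunc_objective_def
proof (intro sum.cong refl)
  fix f assume "f \<in> nsets {1..n} 2"
  then obtain a b where "f = {a, b}" "a \<noteq> b" by (auto simp: nsets_2_eq)
  then show "int (pair_weight H f) * (\<Prod>v\<in>f. - x v) = int (pair_weight H f) * (\<Prod>v\<in>f. x v)" by simp
qed

lemma flip_sign_vectors:
  assumes "\<sigma> \<in> sign_vectors n" "D \<subseteq> {1..n}"
  shows "flip D \<sigma> \<in> sign_vectors n"
  using assms by (auto simp: sign_vectors_def PiE_dflt_def flip_def)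

lemma trunc_objective_diff:
  assumes \<sigma>: "\<sigma> \<in> sign_vectors n" and D: "D \<subseteq> {1..n}" and X: "{e. X e} \<subseteq> nsets {1..n} k"
  shows "2 * real_of_int (trunc_objective n {e. X e} \<sigma> - trunc_objective n {e. X e} (flip D \<sigma>))
     = (\<Sum>e\<in>nsets {1..n} k. gap \<sigma> D e * of_bool (X e))"
proof -
  let ?H = "{e. X e}" and ?E = "nsets {1..n} k"
  have finE: "finite ?E" by (simp add: finite_imp_finite_nsets)
  have "2 * trunc_objective n ?H \<sigma> - 2 * trunc_objective n ?H (flip D \<sigma>)
      = (\<Sum>e\<in>?H. (\<Sum>v\<in>e. \<sigma> v)\<^sup>2 - (\<Sum>v\<in>e. flip D \<sigma> v)\<^sup>2)"
    unfolding trunc_objective_eq[OF X \<sigma>] trunc_objective_eq[OF X flip_sign_vectors[OF \<sigma> D]]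
    by (simp add: sum_subtractf)
  then have "real_of_int (2 * trunc_objective n ?H \<sigma> - 2 * trunc_objective n ?H (flip D \<sigma>))
      = real_of_int (\<Sum>e\<in>?H. (\<Sum>v\<in>e. \<sigma> v)\<^sup>2 - (\<Sum>v\<in>e. flip D \<sigma> v)\<^sup>2)" by simp
  then have "2 * real_of_int (trunc_objective n ?H \<sigma> - trunc_objective n ?H (flip D \<sigma>)) = (\<Sum>e\<in>?H. gap \<sigma> D e)"
    by (simp add: gap_def)
  also have "(\<Sum>e\<in>?H. gap \<sigma> D e) = (\<Sum>e\<in>?E \<inter> ?H. gap \<sigma> D e)"
    using X by (intro sum.cong) auto
  also have "\<dots> = (\<Sum>e\<in>?E. gap \<sigma> D e * of_bool (X e))"
    unfolding sum.inter_restrict[OF finE] by (intro sum.cong) auto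
  finally show ?thesis .
qed

text \<open>\<open>D\<close> is the set where \<open>y\<close> and \<sigma> disagree. If it covers
  more than half of each class, \<open>y\<close> is replaced by its negative, which has the same
  objective and disagrees with \<sigma> on the complement; hence only the objective of
  \<open>y\<close> is matched, not \<open>y\<close> itself. Excluding \<sigma> and its negative
  makes \<open>r\<close> positive in both cases.\<close>

lemma balanced_difference:
  assumes \<sigma>: "\<sigma> \<in> balanced_labels (2 * m)" and y: "y \<in> balanced_labels (2 * m)"
    and ne: "y \<noteq> \<sigma>" "y \<noteq> (\<lambda>v. - \<sigma> v)"
  obtains D r where "D \<subseteq> {1..2 * m}" "card {v\<in>D. \<sigma> v = 1} = r" "card {v\<in>D. \<sigma> v = - 1} = r"
    "r \<ge> 1" "2 * r \<le> m" "\<And>H. trunc_objective (2 * m) H (flip D \<sigma>) = trunc_objective (2 * m) H y"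
proof -
  let ?V = "{1..2 * m}"
  have sv: "\<sigma> \<in> sign_vectors (2 * m)" "y \<in> sign_vectors (2 * m)"
    using \<sigma> y by (auto simp: balanced_labels_def)
  define D where "D = {v\<in>?V. y v \<noteq> \<sigma> v}"
  have D: "D \<subseteq> ?V" "finite D" by (auto simp: D_def)
  have yD: "y = flip D \<sigma>"
  proof
    fix v
    show "y v = flip D \<sigma> v"
      using sign_vectorsD[OF sv(1), of v] sign_vectorsD[OF sv(2), of v]
        sign_vectors_outside[OF sv(1), of v] sign_vectors_outside[OF sv(2), of v]
      by (cases "v \<in> ?V"; cases "y v = \<sigma> v") (auto simp: flip_def D_def)
  qed
  define r where "r = card {v\<in>D. \<sigma> v = 1}"
  have "(\<Sum>v\<in>?V. y v) = 0" "(\<Sum>v\<in>?V. \<sigma> v) = 0" using \<sigma> y by (auto simp: balanced_labels_sum)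
  then have r2: "card {v\<in>D. \<sigma> v = - 1} = r"
    using sum_flip[OF sv(1) D(1)] unfolding yD r_def by simp
  have cD: "card D = 2 * r" by (rule card_eq_double[OF sv(1) D(1) r_def[symmetric] r2])
  have r1: "r \<ge> 1"
  proof (rule ccontr)
    assume "\<not> r \<ge> 1"
    then have "r = 0" by simp
    then have "D = {}" using cD D(2) by simp
    then show False using ne(1) yD by (auto simp: flip_def fun_eq_iff)
  qed
  show ?thesis
  proof (cases "2 * r \<le> m")
    case True
    then show ?thesis using that[of D r] D r1 r2 yD by (auto simp: r_def)
  next
    case False
    define D' where "D' = ?V - D"
    have c: "card {v\<in>D'. \<sigma> v = s} = m - r" if "s = 1 \<or> s = - 1" for s
      unfolding D'_def using that r2 by (intro balanced_card_Diff[OF \<sigma> _ D(1)]) (auto simp: r_def)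
    have "r \<le> m"
    proof -
      have "card D \<le> card ?V" using D by (intro card_mono) auto
      then show ?thesis using cD by simp
    qed
    have y': "flip D' \<sigma> = (\<lambda>v. - y v)"
      unfolding yD using sign_vectors_outside[OF sv(1)] D(1) by (auto simp: flip_def D'_def fun_eq_iff)
    have "m - r \<noteq> 0"
    proof
      assume "m - r = 0"
      then have "card D = card ?V" using cD \<open>r \<le> m\<close> by simp
      then have "D = ?V" using D by (intro card_subset_eq) auto
      then have "D' = {}" by (simp add: D'_def)
      then have "y = (\<lambda>v. - \<sigma> v)" using fun_cong[OF y'] by (auto simp: flip_def fun_eq_iff)
      then show False using ne(2) by simp
    qed
    then show ?thesis
      using that[of D' "m - r"] c False y' by (auto simp: D'_def trunc_objective_uminus)
  qed
qed

lemma sum_pow_card: "finite V \<Longrightarrow> (\<Sum>D\<in>Pow V. w ^ card D) = (1 + w :: real) ^ card V"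
  using prod_add[of V "\<lambda>_. w" "\<lambda>_. 1"] by (simp add: add.commute)

lemma chernoff_gap:
  assumes "s > 0" and "\<And>e. e \<in> nsets {1..n} k \<Longrightarrow> 0 \<le> p e \<and> p e \<le> 1"
  shows "measure_pmf.prob (bernoulli_field (nsets {1..n} k) p) {X. (\<Sum>e\<in>nsets {1..n} k. gap \<sigma> D e * of_bool (X e)) \<le> 0}
    \<le> exp (- (\<Sum>e\<in>nsets {1..n} k. p e * (1 - exp (- s * gap \<sigma> D e))))"
proof -
  let ?E = "nsets {1..n} k"
  have finE: "finite ?E" by (simp add: finite_imp_finite_nsets)
  have "{X. (\<Sum>e\<in>?E. gap \<sigma> D e * of_bool (X e)) \<le> 0} = {X. (\<Sum>e\<in>?E. (- s * gap \<sigma> D e) * of_bool (X e)) \<ge> 0}"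
  proof -
    have "(\<Sum>e\<in>?E. (- s * gap \<sigma> D e) * of_bool (X e)) = - s * (\<Sum>e\<in>?E. gap \<sigma> D e * of_bool (X e))" for X
      unfolding sum_distrib_left by (simp only: mult.assoc)
    then show ?thesis using assms(1) by (auto simp: zero_le_mult_iff mult_le_0_iff)
  qed
  moreover have "measure_pmf.prob (bernoulli_field ?E p) {X. (\<Sum>e\<in>?E. (- s * gap \<sigma> D e) * of_bool (X e)) \<ge> 0}
    \<le> exp ((\<Sum>e\<in>?E. p e * (exp (- s * gap \<sigma> D e) - 1)) - 0)"
    using assms(2) by (intro chernoff_bernoulli_field finE) auto
  moreover have "(\<Sum>e\<in>?E. p e * (exp (- s * gap \<sigma> D e) - 1)) = - (\<Sum>e\<in>?E. p e * (1 - exp (- s * gap \<sigma> D e)))"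
    unfolding sum_negf[symmetric] by (intro sum.cong) (auto simp: algebra_simps)
  ultimately show ?thesis by simp
qed

lemma eventually_rate:
  assumes k: "k \<ge> 2" and \<beta>: "0 < \<beta>" "\<beta> \<le> \<alpha>" and "\<eta> > 0"
  shows "\<forall>\<^sub>F m in sequentially. \<forall>\<sigma> e. 0 \<le> rate k \<alpha> \<beta> (2 * m) \<sigma> e \<and> rate k \<alpha> \<beta> (2 * m) \<sigma> e \<le> \<eta>"
proof -
  have "\<forall>\<^sub>F m in sequentially. edge_prob k \<alpha> (2 * m) < \<eta>"
    using edge_prob_tendsto_0[OF k, of \<alpha>] assms(4) by (rule order_tendstoD)
  with eventually_ge_at_top[of 1] show ?thesis
  proof eventually_elim
    case (elim m)
    show ?case
    proof (intro allI conjI)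
      fix \<sigma> e
      have "1 \<le> 2 * m" using elim by simp
      from rate_bounds[OF \<beta> this, of k \<sigma> e] elim(2)
      show "0 \<le> rate k \<alpha> \<beta> (2 * m) \<sigma> e" "rate k \<alpha> \<beta> (2 * m) \<sigma> e \<le> \<eta>" by linarith+
    qed
  qed
qed

text \<open>Ties count as failures, so outside this event every optimum is \<sigma> or its negative,
  whichever one is selected.\<close>

lemma recovery_exponent:
  assumes k: "k \<ge> 2" and \<beta>: "0 < \<beta>" "\<beta> < \<alpha>" and I: "I2 k \<alpha> \<beta> > 1" and \<delta>: "\<delta> > 0"
  shows "\<forall>\<^sub>F m in sequentially. \<forall>\<sigma>\<in>balanced_labels (2 * m).
    measure_pmf.prob (bernoulli_field (nsets {1..2 * m} k) (rate k \<alpha> \<beta> (2 * m) \<sigma>))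
      {X. \<exists>y\<in>balanced_labels (2 * m). y \<noteq> \<sigma> \<and> y \<noteq> (\<lambda>v. - \<sigma> v) \<and>
        trunc_objective (2 * m) {e. X e} \<sigma> \<le> trunc_objective (2 * m) {e. X e} y} \<le> \<delta>"
proof -
  obtain t where t: "t \<ge> 0" "I2_fun k \<alpha> \<beta> t = I2 k \<alpha> \<beta>"
    using I2_max[OF k] \<beta> by (metis order.strict_trans)
  \<comment> \<open>\<open>I2_fun\<close> vanishes at 0, while \<open>chernoff_gap\<close> asks for
    a positive parameter.\<close>
  have "t \<noteq> 0" using t I by (auto simp: I2_fun_def)
  then have t0: "t > 0" using t by simp
  \<comment> \<open>Half of the excess over 1 is given up in \<open>small_exponent\<close>; the
    other half remains to beat the number of sets \<open>D\<close>.\<close>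
  define \<eta> where "\<eta> = (I2 k \<alpha> \<beta> - 1) / 2"
  have \<eta>: "\<eta> > 0" "I2_fun k \<alpha> \<beta> t - \<eta> = 1 + \<eta>" using I t by (auto simp: \<eta>_def field_simps)
  obtain \<epsilon> where \<epsilon>: "\<epsilon> > 0" and small: "\<forall>\<^sub>F m in sequentially. \<forall>\<sigma>\<in>balanced_labels (2 * m). \<forall>D\<subseteq>{1..2 * m}. \<forall>r.
     card {v\<in>D. \<sigma> v = 1} = r \<longrightarrow> card {v\<in>D. \<sigma> v = - 1} = r \<longrightarrow> real r \<le> \<epsilon> * real m \<longrightarrow>
     real (2 * r) * ln (2 * real m) * (I2_fun k \<alpha> \<beta> t - \<eta>)
       \<le> (\<Sum>e\<in>nsets {1..2 * m} k. rate k \<alpha> \<beta> (2 * m) \<sigma> e * (1 - exp (- t * gap \<sigma> D e / 4)))"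
    using small_exponent[OF k \<beta>(1) less_imp_le[OF \<beta>(2)] \<eta>(1) t(1)] by blast
  obtain s c where s: "s > 0" and c: "c > 0" and large: "\<forall>\<^sub>F m in sequentially. \<forall>\<sigma>\<in>balanced_labels (2 * m). \<forall>D\<subseteq>{1..2 * m}. \<forall>r.
     card {v\<in>D. \<sigma> v = 1} = r \<longrightarrow> card {v\<in>D. \<sigma> v = - 1} = r \<longrightarrow> \<epsilon> * real m \<le> real r \<longrightarrow> 2 * r \<le> m \<longrightarrow>
     c * real m * ln (2 * real m)
       \<le> (\<Sum>e\<in>nsets {1..2 * m} k. rate k \<alpha> \<beta> (2 * m) \<sigma> e * (1 - exp (- s * gap \<sigma> D e)))"
    using large_exponent[OF k \<beta> \<epsilon>] by blast
  \<comment> \<open>The first part bounds \<open>(1 + w) ^ (2 * m) - 1\<close>, the sum of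
    \<open>w ^ card D\<close> over nonempty \<open>D\<close>, where \<open>2 * m * w\<close> is
    \<open>n\<close> to the power \<open>- \<eta>\<close>; the second charges the large-flip bound
    to all \<open>4 ^ m\<close> subsets.\<close>
  have "(\<lambda>m. exp (exp (- \<eta> * ln (2 * real m))) - 1 + 4 ^ m * exp (- (c * real m * ln (2 * real m)))) \<longlonglongrightarrow> 0"
    using \<eta>(1) c by real_asymp
  then have lim: "\<forall>\<^sub>F m in sequentially. exp (exp (- \<eta> * ln (2 * real m))) - 1 + 4 ^ m * exp (- (c * real m * ln (2 * real m))) < \<delta>"
    using \<delta> by (rule order_tendstoD)
  show ?thesis
    using small large lim eventually_rate[OF k \<beta>(1) less_imp_le[OF \<beta>(2)] zero_less_one] eventually_ge_at_top[of 1]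
  proof eventually_elim
    case (elim m)
    show ?case
    proof
      fix \<sigma> assume \<sigma>: "\<sigma> \<in> balanced_labels (2 * m)"
      let ?V = "{1..2 * m}" and ?p = "rate k \<alpha> \<beta> (2 * m) \<sigma>"
      let ?E = "nsets ?V k"
      let ?M = "bernoulli_field ?E ?p"
      let ?bad = "\<lambda>X. \<exists>y\<in>balanced_labels (2 * m). y \<noteq> \<sigma> \<and> y \<noteq> (\<lambda>v. - \<sigma> v) \<and>
        trunc_objective (2 * m) {e. X e} \<sigma> \<le> trunc_objective (2 * m) {e. X e} y"
      let ?A = "\<lambda>D. {X. (\<Sum>e\<in>?E. gap \<sigma> D e * of_bool (X e)) \<le> 0}"
      have sv: "\<sigma> \<in> sign_vectors (2 * m)" using \<sigma> by (auto simp: balanced_labels_def)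
      have finE: "finite ?E" by (simp add: finite_imp_finite_nsets)
      define \<D> where "\<D> = {D. D \<subseteq> ?V \<and> (\<exists>r\<ge>1. card {v\<in>D. \<sigma> v = 1} = r \<and> card {v\<in>D. \<sigma> v = - 1} = r \<and> 2 * r \<le> m)}"
      have \<D>: "\<D> \<subseteq> Pow ?V - {{}}" by (auto simp: \<D>_def)
      have fin\<D>: "finite \<D>" by (rule finite_subset[OF \<D>]) simp
      define w where "w = exp (- (1 + \<eta>) * ln (2 * real m))"
      define z where "z = exp (- (c * real m * ln (2 * real m)))"
      \<comment> \<open>Adding the bounds for small and large flips allows one sum over all
        \<open>D\<close> instead of a split by size.\<close>
      have each: "measure_pmf.prob ?M (?A D) \<le> w ^ card D + z" if D\<D>: "D \<in> \<D>" for D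
      proof -
        from D\<D> obtain r where D: "D \<subseteq> ?V" and r: "card {v\<in>D. \<sigma> v = 1} = r" "card {v\<in>D. \<sigma> v = - 1} = r" "2 * r \<le> m"
          by (auto simp: \<D>_def)
        have cD: "card D = 2 * r" by (rule card_eq_double[OF sv D r(1,2)])
        have p: "0 \<le> ?p e \<and> ?p e \<le> 1" if "e \<in> ?E" for e using elim(4) by blast
        show ?thesis
        proof (cases "real r \<le> \<epsilon> * real m")
          case True
          have "measure_pmf.prob ?M (?A D) \<le> exp (- (\<Sum>e\<in>?E. ?p e * (1 - exp (- (t / 4) * gap \<sigma> D e))))"
            using t0 p by (intro chernoff_gap) auto
          also have "\<dots> \<le> exp (- (real (2 * r) * ln (2 * real m) * (1 + \<eta>)))"
            using elim(1)[rule_format, OF \<sigma> D r(1,2) True] by (simp add: \<eta>(2))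
          also have "\<dots> = w ^ card D" unfolding w_def cD
            by (simp add: algebra_simps flip: exp_of_nat_mult)
          finally show ?thesis by (simp add: z_def add_increasing2)
        next
          case False
          have "measure_pmf.prob ?M (?A D) \<le> exp (- (\<Sum>e\<in>?E. ?p e * (1 - exp (- s * gap \<sigma> D e))))"
            using s p by (intro chernoff_gap) auto
          also have "\<dots> \<le> z" unfolding z_def
            using elim(2)[rule_format, OF \<sigma> D r(1,2) _ r(3)] False by simp
          finally show ?thesis by (simp add: w_def add_increasing)
        qed
      qed
      have "measure_pmf.prob ?M {X. ?bad X} = measure_pmf.prob ?M ({X. ?bad X} \<inter> set_pmf ?M)"
        by (simp add: measure_Int_set_pmf)
      also have "\<dots> \<le> measure_pmf.prob ?M (\<Union>D\<in>\<D>. ?A D)"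
      proof (rule measure_pmf.finite_measure_mono)
        show "{X. ?bad X} \<inter> set_pmf ?M \<subseteq> (\<Union>D\<in>\<D>. ?A D)"
        proof
          fix X assume X: "X \<in> {X. ?bad X} \<inter> set_pmf ?M"
          then obtain y where y: "y \<in> balanced_labels (2 * m)" "y \<noteq> \<sigma>" "y \<noteq> (\<lambda>v. - \<sigma> v)"
            "trunc_objective (2 * m) {e. X e} \<sigma> \<le> trunc_objective (2 * m) {e. X e} y" by blast
          have XE: "{e. X e} \<subseteq> ?E" using set_bernoulli_field[OF finE] X by blast
          obtain D r where D: "D \<subseteq> ?V" "card {v\<in>D. \<sigma> v = 1} = r" "card {v\<in>D. \<sigma> v = - 1} = r"
            "r \<ge> 1" "2 * r \<le> m" "\<And>H. trunc_objective (2 * m) H (flip D \<sigma>) = trunc_objective (2 * m) H y"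
            using balanced_difference[OF \<sigma> y(1-3)] by blast
          have "2 * real_of_int (trunc_objective (2 * m) {e. X e} \<sigma> - trunc_objective (2 * m) {e. X e} (flip D \<sigma>)) \<le> 0"
            unfolding D(6) using y(4) by simp
          then have "X \<in> ?A D" unfolding trunc_objective_diff[OF sv D(1) XE] by simp
          moreover have "D \<in> \<D>" using D unfolding \<D>_def by blast
          ultimately show "X \<in> (\<Union>D\<in>\<D>. ?A D)" by blast
        qed
      qed simp
      also have "\<dots> \<le> (\<Sum>D\<in>\<D>. measure_pmf.prob ?M (?A D))"
        by (rule measure_pmf.finite_measure_subadditive_finite[OF fin\<D>]) simp
      also have "\<dots> \<le> (\<Sum>D\<in>\<D>. w ^ card D + z)" by (intro sum_mono each)
      also have "\<dots> \<le> (\<Sum>D\<in>Pow ?V - {{}}. w ^ card D + z)"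
        by (rule sum_mono2[OF _ \<D>]) (auto simp: w_def z_def)
      also have "\<dots> = (\<Sum>D\<in>Pow ?V - {{}}. w ^ card D) + real (card (Pow ?V - {{}})) * z"
        by (simp add: sum.distrib)
      also have "(\<Sum>D\<in>Pow ?V - {{}}. w ^ card D) = (1 + w) ^ (2 * m) - 1"
        using sum_pow_card[of ?V w] by (subst sum_diff1) auto
      also have "(1 + w) ^ (2 * m) \<le> exp w ^ (2 * m)"
        by (intro power_mono) (auto simp: w_def intro: add_nonneg_nonneg)
      also have "exp w ^ (2 * m) = exp (exp (- \<eta> * ln (2 * real m)))"
      proof -
        have "exp (ln (2 * real m)) = 2 * real m" using elim(5) by simp
        then have "2 * real m * w = exp (ln (2 * real m)) * exp (- (1 + \<eta>) * ln (2 * real m))" by (simp add: w_def)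
        also have "\<dots> = exp (- \<eta> * ln (2 * real m))" by (simp add: algebra_simps flip: exp_add)
        finally show ?thesis by (simp flip: exp_of_nat_mult)
      qed
      also have "real (card (Pow ?V - {{}})) * z \<le> 4 ^ m * z"
      proof (rule mult_right_mono)
        have "card (Pow ?V - {{}}) \<le> card (Pow ?V)" by (intro card_mono) auto
        also have "\<dots> = 4 ^ m" by (simp add: card_Pow power_mult)
        finally show "real (card (Pow ?V - {{}})) \<le> 4 ^ m" by (metis of_nat_le_iff of_nat_numeral of_nat_power)
      qed (simp add: z_def)
      finally show "measure_pmf.prob ?M {X. ?bad X} \<le> \<delta>" using elim(3) unfolding z_def by linarith
    qed
  qed
qed

section \<open>Failure below the threshold\<close>

text \<open>Just to the right of the maximizer of \<open>I2_fun\<close> the derivative is negative while \<open>t\<close> times it is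
  still close to \<open>0\<close>, also when the maximizer is \<open>0\<close>.\<close>

lemma tilt_parameters:
  assumes k: "k \<ge> 2" and pos: "0 < \<alpha>" "0 < \<beta>" and I: "I2 k \<alpha> \<beta> < 1"
  obtains t s a b where "t \<ge> 0" "s > 0" "a > 0" "I2_fun k \<alpha> \<beta> t + t * b < 1"
    "I2_fun k \<alpha> \<beta> t + s * a < I2_fun k \<alpha> \<beta> (t - s)"
    "I2_fun k \<alpha> \<beta> t < I2_fun k \<alpha> \<beta> (t + s) + s * b"
proof -
  define W where "W j = (if j = 0 then \<alpha> else \<beta>) * (real ((k - 1) choose j) / 2 ^ (k - 1))" for j
  define c where "c j = real k - 1 - 2 * real j" for j
  let ?I = "I2_fun k \<alpha> \<beta>"
  define I' where "I' t = (\<Sum>j\<le>k - 1. W j * (c j * exp (- t * c j)))" for t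
  have I_eq: "?I = (\<lambda>t. \<Sum>j\<le>k - 1. W j * (1 - exp (- t * c j)))"
    by (simp add: fun_eq_iff I2_fun_eq_star_limit star_limit_def W_def c_def)
  have W0: "W j \<ge> 0" for j using pos by (simp add: W_def)
  have deriv: "(?I has_real_derivative I' t) (at t)" for t
    unfolding I_eq I'_def by (auto intro!: derivative_eq_intros sum.cong)
  have cont: "isCont I' t" for t unfolding I'_def by (intro continuous_intros)
  \<comment> \<open>Strict concavity of \<open>I2_fun\<close>: all terms are concave, and the one
    with \<open>j = k - 1\<close> is strictly so because its coefficient
    \<open>c j = - (k - 1)\<close> is nonzero.\<close>
  have decr: "I' y < I' x" if xy: "x < y" for x y
  proof -
    have term_le: "c j * exp (- y * c j) \<le> c j * exp (- x * c j)" for j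
    proof (cases "c j \<ge> 0")
      case True
      then have "x * c j \<le> y * c j" using xy by (intro mult_right_mono) auto
      then show ?thesis using True by (intro mult_left_mono) auto
    next
      case False
      then have "y * c j \<le> x * c j" using xy by (intro mult_right_mono_neg) auto
      then show ?thesis using False by (intro mult_left_mono_neg) auto
    qed
    have neg: "c (k - 1) < 0" using k by (simp add: c_def of_nat_diff)
    then have "y * c (k - 1) < x * c (k - 1)" using xy by (intro mult_strict_right_mono_neg) auto
    then have "c (k - 1) * exp (- y * c (k - 1)) < c (k - 1) * exp (- x * c (k - 1))"
      using neg by (intro mult_strict_left_mono_neg) auto
    moreover have "W (k - 1) > 0" using pos by (simp add: W_def)
    ultimately have "W (k - 1) * (c (k - 1) * exp (- y * c (k - 1))) < W (k - 1) * (c (k - 1) * exp (- x * c (k - 1)))"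
      by (rule mult_strict_left_mono)
    then show ?thesis unfolding I'_def
      by (intro sum_strict_mono_ex1 ballI bexI[of _ "k - 1"] mult_left_mono[OF term_le W0]) auto
  qed
  obtain t0 where t0: "t0 \<ge> 0" "I2 k \<alpha> \<beta> = ?I t0" and max: "\<And>s. s \<ge> 0 \<Longrightarrow> ?I s \<le> ?I t0"
    using I2_max[OF k pos] by blast
  \<comment> \<open>At an interior maximizer the derivative vanishes, at the boundary the factor
    \<open>t0\<close> does.\<close>
  have t0I': "t0 * I' t0 = 0"
  proof (cases "t0 = 0")
    case False
    have "I' t0 = 0"
      by (rule DERIV_local_max[OF deriv, of t0 t0]) (use False t0 max in \<open>auto simp: abs_if split: if_splits\<close>)
    then show ?thesis by simp
  qed simp
  \<comment> \<open>The coefficient 2 anticipates the choice \<open>b = 2 * g\<close>, for which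
    \<open>I2_fun t + t * b\<close> equals this expression.\<close>
  have "isCont (\<lambda>t. ?I t - 2 * (t * I' t)) t0"
    by (intro continuous_intros cont DERIV_isCont[OF deriv])
  then have "((\<lambda>t. ?I t - 2 * (t * I' t)) \<longlongrightarrow> ?I t0 - 2 * (t0 * I' t0)) (at_right t0)"
    unfolding isCont_def by (rule tendsto_mono[rotated]) (simp add: at_within_le_at)
  then have "\<forall>\<^sub>F t in at_right t0. ?I t - 2 * (t * I' t) < 1"
    by (rule order_tendstoD) (unfold t0I', use I t0 in simp)
  moreover have "\<forall>\<^sub>F t in at_right t0. t0 < t" by (simp add: eventually_at_right_less)
  ultimately have "\<forall>\<^sub>F t in at_right t0. ?I t - 2 * (t * I' t) < 1 \<and> t0 < t"
    by (rule eventually_conj)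
  then obtain t where t: "?I t - 2 * (t * I' t) < 1" "t0 < t"
    using eventually_happens[of _ "at_right t0"] by (auto simp: trivial_limit_at_right_real)
  define g where "g = - I' t"
  \<comment> \<open>The mean value theorem gives a point before \<open>t\<close> with nonpositive
    slope, and the slope strictly decreases.\<close>
  have g: "g > 0"
  proof -
    obtain z where z: "t0 < z" "z < t" "?I t - ?I t0 = (t - t0) * I' z"
      using MVT2[OF t(2), of ?I I'] deriv by blast
    have "?I t - ?I t0 \<le> 0" using max[of t] t0 t by simp
    then have "I' z \<le> 0" using z(3) t(2) by (simp add: mult_le_0_iff)
    then show ?thesis using decr[OF z(2)] by (simp add: g_def)
  qed
  have "((\<lambda>h. (?I (t + h) - ?I t) / h) \<longlongrightarrow> I' t) (at 0)"
    using deriv[of t] by (simp add: DERIV_def)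
  then have "\<forall>\<^sub>F h in at 0. dist ((?I (t + h) - ?I t) / h) (I' t) < g / 2"
    using g by (intro tendstoD) auto
  then obtain d where d: "d > 0" "\<And>h. h \<noteq> 0 \<Longrightarrow> \<bar>h\<bar> < d \<Longrightarrow> \<bar>(?I (t + h) - ?I t) / h + g\<bar> < g / 2"
    unfolding eventually_at by (auto simp: dist_real_def g_def)
  define s where "s = d / 2"
  have s: "s > 0" "s < d" using d by (auto simp: s_def)
  show ?thesis
  \<comment> \<open>Under the tilt by \<open>t\<close> the variable has mean about
    \<open>- g * ln n\<close>. The window from \<open>- 2 * g\<close> to \<open>- g / 2\<close>, in
    units of \<open>ln n\<close>, surrounds it, and \<open>s\<close> is small enough for the
    difference quotients to stay within \<open>g / 2\<close> of \<open>- g\<close>.\<close>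
  proof (rule that[of t s "g / 2" "2 * g"])
    show "t \<ge> 0" "s > 0" "g / 2 > 0" using t t0 s g by auto
    show "?I t + t * (2 * g) < 1" using t(1) by (simp add: g_def)
    have "\<bar>(?I (t + - s) - ?I t) / - s + g\<bar> < g / 2" using s by (intro d(2)) auto
    then have "\<bar>- ((?I (t - s) - ?I t) / s) + g\<bar> < g / 2" by simp
    then have "(?I (t - s) - ?I t) / s > g / 2" by linarith
    then show "?I t + s * (g / 2) < ?I (t - s)" using s by (simp add: pos_less_divide_eq algebra_simps)
    have "\<bar>(?I (t + s) - ?I t) / s + g\<bar> < g / 2" using s by (intro d(2)) auto
    then have "(?I (t + s) - ?I t) / s > - (2 * g)" using g by linarith
    then show "?I t < ?I (t + s) + s * (2 * g)" using s by (simp add: pos_less_divide_eq algebra_simps)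
  qed
qed

section \<open>Moment generating function and lower tail of the private gap\<close>

definition private_gap :: "(nat \<Rightarrow> int) \<Rightarrow> nat \<Rightarrow> nat \<Rightarrow> nat set \<Rightarrow> nat \<Rightarrow> (nat set \<Rightarrow> bool) \<Rightarrow> real" where
  "private_gap \<sigma> n k T u X = (\<Sum>e\<in>private_edges n k T u. gap \<sigma> {u} e / 4 * of_bool (X e))"

text \<open>By independence the expectation is a product of factors \<open>1 + x e\<close>. The
  rates tend to 0, so all \<open>x e\<close> are small and the logarithm of the product is the sum
  of the \<open>x e\<close> up to a small relative error; that sum is \<open>- ln n\<close> times a
  star weight. The parameter \<open>t\<close> may have either sign because it is later taken as
  \<open>t - s\<close>.\<close>

lemma mgf_private_gap:
  assumes k: "k \<ge> 2" and \<beta>: "0 < \<beta>" "\<beta> \<le> \<alpha>" and \<eta>: "\<eta> > 0"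
  shows "\<exists>\<epsilon>>0. \<forall>\<^sub>F m in sequentially. \<forall>\<sigma>\<in>balanced_labels (2 * m). \<forall>T\<subseteq>{1..2 * m}. \<forall>r.
     card {v\<in>T. \<sigma> v = 1} = r \<longrightarrow> card {v\<in>T. \<sigma> v = - 1} = r \<longrightarrow> real r \<le> \<epsilon> * real m \<longrightarrow> (\<forall>u\<in>T.
       measure_pmf.expectation (bernoulli_field (nsets {1..2 * m} k) (rate k \<alpha> \<beta> (2 * m) \<sigma>))
          (\<lambda>X. exp (- t * private_gap \<sigma> (2 * m) k T u X))
       \<in> {exp (- (I2_fun k \<alpha> \<beta> t + \<eta>) * ln (2 * real m))..exp (- (I2_fun k \<alpha> \<beta> t - \<eta>) * ln (2 * real m))})"
proof -
  define g where "g c = 1 - exp (- t * c)" for c :: real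
  define G where "G c = \<bar>1 - exp (- t * c)\<bar>" for c :: real
  define K where "K = exp (\<bar>t\<bar> * real k ^ 2)"
  define C where "C = \<bar>star_limit k \<alpha> \<beta> G\<bar> + 1"
  \<comment> \<open>Bound for all \<open>|x e|\<close>. The loss in
    \<open>prod_one_plus_ge_exp\<close> is then at most \<open>2 * \<theta> * C * ln n\<close>,
    hence at most half of the tolerance; the other half covers the convergence of the star
    weight.\<close>
  define \<theta> where "\<theta> = min (1 / 2) (\<eta> / (4 * C))"
  have C: "C \<ge> 1" by (simp add: C_def)
  have \<theta>: "\<theta> > 0" "\<theta> \<le> 1 / 2" "2 * \<theta> * C \<le> \<eta> / 2"
  proof -
    show "\<theta> > 0" "\<theta> \<le> 1 / 2" using \<eta> C by (auto simp: \<theta>_def)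
    have "\<theta> \<le> \<eta> / (4 * C)" by (simp add: \<theta>_def)
    then show "2 * \<theta> * C \<le> \<eta> / 2" using C by (simp add: pos_le_divide_eq algebra_simps)
  qed
  obtain \<epsilon>1 where \<epsilon>1: "\<epsilon>1 > 0" "\<epsilon>1 < 1" "\<forall>\<^sub>F m in sequentially. \<forall>r\<le>m. (1 - \<epsilon>1) * real m \<le> real r \<longrightarrow>
     \<bar>star_weight k \<alpha> \<beta> (2 * m) r g - star_limit k \<alpha> \<beta> g\<bar> \<le> \<eta> / 2"
    using star_weight_limit[OF half_gt_zero[OF \<eta>], of k \<alpha> \<beta> g] by blast
  obtain \<epsilon>2 where \<epsilon>2: "\<epsilon>2 > 0" "\<forall>\<^sub>F m in sequentially. \<forall>r\<le>m. (1 - \<epsilon>2) * real m \<le> real r \<longrightarrow>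
     \<bar>star_weight k \<alpha> \<beta> (2 * m) r G - star_limit k \<alpha> \<beta> G\<bar> \<le> 1"
    using star_weight_limit[OF zero_less_one, of k \<alpha> \<beta> G] by blast
  define \<epsilon> where "\<epsilon> = min \<epsilon>1 \<epsilon>2"
  have \<epsilon>: "\<epsilon> > 0" "\<epsilon> \<le> \<epsilon>1" "\<epsilon> \<le> \<epsilon>2" "\<epsilon> \<le> 1" using \<epsilon>1 \<epsilon>2 by (auto simp: \<epsilon>_def)
  \<comment> \<open>Target for the rates: the deviation of the exponential from 1 is at most
    \<open>K\<close>, so rates below \<open>\<theta> / K\<close> give
    \<open>|x e| \<le> \<theta>\<close>.\<close>
  have \<theta>K: "\<theta> / K > 0" using \<theta> by (simp add: K_def)
  have "\<forall>\<^sub>F m in sequentially. \<forall>\<sigma>\<in>balanced_labels (2 * m). \<forall>T\<subseteq>{1..2 * m}. \<forall>r.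
     card {v\<in>T. \<sigma> v = 1} = r \<longrightarrow> card {v\<in>T. \<sigma> v = - 1} = r \<longrightarrow> real r \<le> \<epsilon> * real m \<longrightarrow> (\<forall>u\<in>T.
       measure_pmf.expectation (bernoulli_field (nsets {1..2 * m} k) (rate k \<alpha> \<beta> (2 * m) \<sigma>))
          (\<lambda>X. exp (- t * private_gap \<sigma> (2 * m) k T u X))
       \<in> {exp (- (I2_fun k \<alpha> \<beta> t + \<eta>) * ln (2 * real m))..exp (- (I2_fun k \<alpha> \<beta> t - \<eta>) * ln (2 * real m))})"
    using \<epsilon>1(3) \<epsilon>2(2) eventually_rate[OF k \<beta> \<theta>K] eventually_rate[OF k \<beta> zero_less_one] eventually_gt_at_top[of k]
  proof eventually_elim
    case (elim m)
    show ?case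
    proof (intro ballI allI impI)
      fix \<sigma> T r u
      assume \<sigma>: "\<sigma> \<in> balanced_labels (2 * m)" and T: "T \<subseteq> {1..2 * m}"
        and r: "card {v\<in>T. \<sigma> v = 1} = r" "card {v\<in>T. \<sigma> v = - 1} = r" and re: "real r \<le> \<epsilon> * real m" and u: "u \<in> T"
      let ?E = "nsets {1..2 * m} k" and ?p = "rate k \<alpha> \<beta> (2 * m) \<sigma>"
      let ?F = "private_edges (2 * m) k T u"
      define L where "L = ln (2 * real m)"
      define x where "x e = ?p e * (exp (- t * (gap \<sigma> {u} e / 4)) - 1)" for e
      have L: "L \<ge> 0" using elim by (simp add: L_def)
      have sv: "\<sigma> \<in> sign_vectors (2 * m)" using \<sigma> by (auto simp: balanced_labels_def)
      have finE: "finite ?E" by (simp add: finite_imp_finite_nsets)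
      have F: "?F \<subseteq> ?E" "finite ?F" using finE by (auto simp: private_edges_def)
      have p: "0 \<le> ?p e" "?p e \<le> 1" "?p e \<le> \<theta> / K" for e using elim(3,4) by blast+
      have "real r \<le> 1 * real m" using re \<epsilon>(4) mult_right_mono[of \<epsilon> 1 "real m"] by linarith
      then have rm: "r \<le> m" by simp
      have le: "\<epsilon> * real m \<le> \<epsilon>1 * real m" "\<epsilon> * real m \<le> \<epsilon>2 * real m"
        using \<epsilon> by (auto intro: mult_right_mono)
      have w: "(1 - \<epsilon>1) * real m \<le> real (m - r)" "(1 - \<epsilon>2) * real m \<le> real (m - r)"
        using re rm le by (auto simp: of_nat_diff algebra_simps)
      have sumx: "(\<Sum>e\<in>?F. x e) = - (L * star_weight k \<alpha> \<beta> (2 * m) (m - r) g)"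
      proof -
        have "(\<Sum>e\<in>?F. x e) = - (\<Sum>e\<in>?F. ?p e * g (gap \<sigma> {u} e / 4))"
          unfolding sum_negf[symmetric] by (intro sum.cong) (auto simp: x_def g_def algebra_simps)
        then show ?thesis using sum_private_edges_rate[OF k \<sigma> T r u, of \<alpha> \<beta> g] by (simp add: L_def)
      qed
      have sumabs: "(\<Sum>e\<in>?F. \<bar>x e\<bar>) = L * star_weight k \<alpha> \<beta> (2 * m) (m - r) G"
        using sum_private_edges_rate[OF k \<sigma> T r u, of \<alpha> \<beta> G] p
        by (simp add: x_def G_def L_def abs_mult abs_minus_commute)
      have SW: "\<bar>star_weight k \<alpha> \<beta> (2 * m) (m - r) g - I2_fun k \<alpha> \<beta> t\<bar> \<le> \<eta> / 2"
        using elim(1) w unfolding I2_fun_eq_star_limit g_def[abs_def, symmetric] by auto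
      have SWG: "star_weight k \<alpha> \<beta> (2 * m) (m - r) G \<le> C"
      proof -
        have "\<bar>star_weight k \<alpha> \<beta> (2 * m) (m - r) G - star_limit k \<alpha> \<beta> G\<bar> \<le> 1"
          using elim(2) w by auto
        then show ?thesis unfolding C_def by linarith
      qed
      have "measure_pmf.expectation (bernoulli_field ?E ?p) (\<lambda>X. exp (- t * private_gap \<sigma> (2 * m) k T u X))
        = measure_pmf.expectation (bernoulli_field ?E ?p) (\<lambda>X. exp (\<Sum>e\<in>?F. (- t * (gap \<sigma> {u} e / 4)) * of_bool (X e)))"
        unfolding private_gap_def sum_distrib_left by (simp only: mult.assoc)
      also have "\<dots> = (\<Prod>e\<in>?F. 1 + x e)"
        unfolding x_def using p by (intro expectation_exp_bernoulli_field finE F) auto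
      finally have eq: "measure_pmf.expectation (bernoulli_field ?E ?p) (\<lambda>X. exp (- t * private_gap \<sigma> (2 * m) k T u X)) = (\<Prod>e\<in>?F. 1 + x e)" .
      have up: "(\<Prod>e\<in>?F. 1 + x e) \<le> exp (\<Sum>e\<in>?F. x e)"
      proof (rule prod_one_plus_le_exp)
        fix e
        have "?p e * exp (- t * (gap \<sigma> {u} e / 4)) \<ge> 0" using p by simp
        then show "- 1 \<le> x e" using p(2)[of e] unfolding x_def by (simp add: algebra_simps)
      qed
      have low: "exp ((\<Sum>e\<in>?F. x e) - 2 * \<theta> * (\<Sum>e\<in>?F. \<bar>x e\<bar>)) \<le> (\<Prod>e\<in>?F. 1 + x e)"
      proof (rule prod_one_plus_ge_exp[OF F(2) _ \<theta>(2)])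
        fix e assume "e \<in> ?F"
        then have "\<bar>gap \<sigma> {u} e\<bar> \<le> real k ^ 2" using abs_gap_le[OF sv] F by blast
        then have "\<bar>t\<bar> * \<bar>gap \<sigma> {u} e / 4\<bar> \<le> \<bar>t\<bar> * real k ^ 2" by (intro mult_left_mono) auto
        then have "\<bar>- t * (gap \<sigma> {u} e / 4)\<bar> \<le> \<bar>t\<bar> * real k ^ 2" by (simp add: abs_mult)
        then have "- t * (gap \<sigma> {u} e / 4) \<le> \<bar>t\<bar> * real k ^ 2" by (rule abs_le_D1)
        then have "exp (- t * (gap \<sigma> {u} e / 4)) \<le> K" unfolding K_def exp_le_cancel_iff .
        moreover have "K \<ge> 1" by (simp add: K_def)
        ultimately have "\<bar>exp (- t * (gap \<sigma> {u} e / 4)) - 1\<bar> \<le> K"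
          using exp_gt_zero[of "- t * (gap \<sigma> {u} e / 4)"] by linarith
        then have "\<bar>x e\<bar> \<le> \<theta> / K * K"
          unfolding x_def abs_mult using p[of e] by (intro mult_mono) auto
        then show "\<bar>x e\<bar> \<le> \<theta>" by (simp add: K_def)
      qed
      have "- (I2_fun k \<alpha> \<beta> t + \<eta>) * L \<le> (\<Sum>e\<in>?F. x e) - 2 * \<theta> * (\<Sum>e\<in>?F. \<bar>x e\<bar>)"
      proof -
        have "2 * \<theta> * star_weight k \<alpha> \<beta> (2 * m) (m - r) G \<le> \<eta> / 2"
          using mult_left_mono[OF SWG, of "2 * \<theta>"] \<theta> by linarith
        then have "star_weight k \<alpha> \<beta> (2 * m) (m - r) g + 2 * \<theta> * star_weight k \<alpha> \<beta> (2 * m) (m - r) G \<le> I2_fun k \<alpha> \<beta> t + \<eta>"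
          using SW by linarith
        from mult_right_mono[OF this L] show ?thesis unfolding sumx sumabs by (simp add: algebra_simps)
      qed
      moreover have "(\<Sum>e\<in>?F. x e) \<le> - (I2_fun k \<alpha> \<beta> t - \<eta>) * L"
      proof -
        have "I2_fun k \<alpha> \<beta> t - \<eta> \<le> star_weight k \<alpha> \<beta> (2 * m) (m - r) g" using SW \<eta> by linarith
        from mult_right_mono[OF this L] show ?thesis unfolding sumx by (simp add: algebra_simps)
      qed
      ultimately show "measure_pmf.expectation (bernoulli_field ?E ?p) (\<lambda>X. exp (- t * private_gap \<sigma> (2 * m) k T u X))
       \<in> {exp (- (I2_fun k \<alpha> \<beta> t + \<eta>) * ln (2 * real m))..exp (- (I2_fun k \<alpha> \<beta> t - \<eta>) * ln (2 * real m))}"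
        unfolding eq L_def[symmetric] using up low by (auto intro: order.trans)
    qed
  qed
  with \<epsilon> show ?thesis by blast
qed

text \<open>Since \<open>\<kappa> < 1\<close>, a set of \<open>n\<close> to the power
  \<open>1 - d\<close> vertices with \<open>1 - d > \<kappa>\<close> is expected to contain many
  whose private gap is this negative.\<close>

lemma private_gap_lower:
  assumes k: "k \<ge> 2" and \<beta>: "0 < \<beta>" "\<beta> \<le> \<alpha>" and I: "I2 k \<alpha> \<beta> < 1"
  obtains \<kappa> a \<epsilon> where "0 \<le> \<kappa>" "\<kappa> < 1" "a > 0" "\<epsilon> > 0"
    "\<forall>\<^sub>F m in sequentially. \<forall>\<sigma>\<in>balanced_labels (2 * m). \<forall>T\<subseteq>{1..2 * m}. \<forall>r.
     card {v\<in>T. \<sigma> v = 1} = r \<longrightarrow> card {v\<in>T. \<sigma> v = - 1} = r \<longrightarrow> real r \<le> \<epsilon> * real m \<longrightarrow> (\<forall>u\<in>T.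
       exp (- \<kappa> * ln (2 * real m)) / 2
       \<le> measure_pmf.prob (bernoulli_field (nsets {1..2 * m} k) (rate k \<alpha> \<beta> (2 * m) \<sigma>))
          {X. private_gap \<sigma> (2 * m) k T u X \<le> - (a * ln (2 * real m))})"
proof -
  let ?I = "I2_fun k \<alpha> \<beta>"
  have "0 < \<alpha>" using \<beta> by simp
  then obtain t s a b where par: "t \<ge> 0" "s > 0" "a > 0" "?I t + t * b < 1"
    "?I t + s * a < ?I (t - s)" "?I t < ?I (t + s) + s * b"
    using tilt_parameters[OF k _ \<beta>(1) I] by blast
  \<comment> \<open>The smallest slack in the three strict inequalities, then divided by 4. In each
    tail one \<eta> pays for the moment estimate at the shifted parameter, one for the estimate at
    \<open>t\<close>, and one yields the factor \<open>n\<close> to the power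
    \<open>- \<eta>\<close>, eventually below 1/4.\<close>
  define d where "d = min (1 - (?I t + t * b)) (min (?I (t - s) - (?I t + s * a)) (?I (t + s) + s * b - ?I t))"
  define \<eta> where "\<eta> = d / 4"
  have "d > 0" using par by (simp add: d_def)
  then have \<eta>: "\<eta> > 0" by (simp add: \<eta>_def)
  have "d \<le> 1 - (?I t + t * b)" "d \<le> ?I (t - s) - (?I t + s * a)" "d \<le> ?I (t + s) + s * b - ?I t"
    unfolding d_def by (simp_all only: min.cobounded1 min.coboundedI2[OF min.cobounded1] min.coboundedI2[OF min.cobounded2])
  then have \<eta>1: "?I t + t * b + \<eta> < 1"
    and \<eta>2: "?I t + s * a + 3 * \<eta> \<le> ?I (t - s)" "?I t + 3 * \<eta> \<le> ?I (t + s) + s * b"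
    using \<open>d > 0\<close> unfolding \<eta>_def by linarith+
  \<comment> \<open>\<open>I2_fun t\<close> may be negative when \<open>t\<close> lies beyond a
    maximizer with value 0; the maximum with 0 makes \<open>exp (- \<kappa> * ln n) / 2\<close> at
    most 1.\<close>
  define \<kappa> where "\<kappa> = max 0 (?I t + t * b + \<eta>)"
  define Q where "Q \<epsilon> u \<longleftrightarrow> (\<forall>\<^sub>F m in sequentially. \<forall>\<sigma>\<in>balanced_labels (2 * m). \<forall>T\<subseteq>{1..2 * m}. \<forall>r.
     card {v\<in>T. \<sigma> v = 1} = r \<longrightarrow> card {v\<in>T. \<sigma> v = - 1} = r \<longrightarrow> real r \<le> \<epsilon> * real m \<longrightarrow> (\<forall>v\<in>T.
       measure_pmf.expectation (bernoulli_field (nsets {1..2 * m} k) (rate k \<alpha> \<beta> (2 * m) \<sigma>))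
          (\<lambda>X. exp (- u * private_gap \<sigma> (2 * m) k T v X))
       \<in> {exp (- (?I u + \<eta>) * ln (2 * real m))..exp (- (?I u - \<eta>) * ln (2 * real m))}))" for \<epsilon> u
  have "\<exists>\<epsilon>>0. Q \<epsilon> u" for u unfolding Q_def by (rule mgf_private_gap[OF k \<beta> \<eta>])
  then obtain \<epsilon>1 \<epsilon>2 \<epsilon>3 where \<epsilon>: "\<epsilon>1 > 0" "Q \<epsilon>1 t" "\<epsilon>2 > 0" "Q \<epsilon>2 (t - s)" "\<epsilon>3 > 0" "Q \<epsilon>3 (t + s)"
    by meson
  have "(\<lambda>m. exp (- \<eta> * ln (2 * real m))) \<longlonglongrightarrow> 0" using \<eta> by real_asymp
  then have small: "\<forall>\<^sub>F m in sequentially. exp (- \<eta> * ln (2 * real m)) < 1 / 4"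
    by (rule order_tendstoD) simp
  show ?thesis
  proof (rule that[of \<kappa> a "min \<epsilon>1 (min \<epsilon>2 \<epsilon>3)"])
    show "0 \<le> \<kappa>" "\<kappa> < 1" using \<eta>1 by (auto simp: \<kappa>_def)
    show "a > 0" "min \<epsilon>1 (min \<epsilon>2 \<epsilon>3) > 0" using par \<epsilon> by auto
    show "\<forall>\<^sub>F m in sequentially. \<forall>\<sigma>\<in>balanced_labels (2 * m). \<forall>T\<subseteq>{1..2 * m}. \<forall>r.
     card {v\<in>T. \<sigma> v = 1} = r \<longrightarrow> card {v\<in>T. \<sigma> v = - 1} = r \<longrightarrow> real r \<le> min \<epsilon>1 (min \<epsilon>2 \<epsilon>3) * real m \<longrightarrow> (\<forall>u\<in>T.
       exp (- \<kappa> * ln (2 * real m)) / 2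
       \<le> measure_pmf.prob (bernoulli_field (nsets {1..2 * m} k) (rate k \<alpha> \<beta> (2 * m) \<sigma>))
          {X. private_gap \<sigma> (2 * m) k T u X \<le> - (a * ln (2 * real m))})"
      using \<epsilon>(2,4,6)[unfolded Q_def] small eventually_ge_at_top[of 1]
    proof eventually_elim
      case (elim m)
      show ?case
      proof (intro ballI allI impI)
        fix \<sigma> T r u
        assume \<sigma>: "\<sigma> \<in> balanced_labels (2 * m)" and T: "T \<subseteq> {1..2 * m}"
          and r: "card {v\<in>T. \<sigma> v = 1} = r" "card {v\<in>T. \<sigma> v = - 1} = r"
          and re: "real r \<le> min \<epsilon>1 (min \<epsilon>2 \<epsilon>3) * real m" and u: "u \<in> T"
        define L where "L = ln (2 * real m)"
        have L: "L \<ge> 0" using elim by (simp add: L_def)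
        let ?M = "bernoulli_field (nsets {1..2 * m} k) (rate k \<alpha> \<beta> (2 * m) \<sigma>)"
        let ?Z = "private_gap \<sigma> (2 * m) k T u"
        define mgf where "mgf x = measure_pmf.expectation ?M (\<lambda>X. exp (- x * ?Z X))" for x
        have re': "real r \<le> \<epsilon>1 * real m" "real r \<le> \<epsilon>2 * real m" "real r \<le> \<epsilon>3 * real m"
          by (rule order.trans[OF re], rule mult_right_mono, auto)+
        define A where "A = exp (- (?I t + \<eta>) * L)"
        have m1: "A \<le> mgf t" unfolding A_def mgf_def L_def
          using elim(1)[rule_format, OF \<sigma> T r re'(1) u] by simp
        have m2: "mgf (t - s) \<le> exp (- (?I (t - s) - \<eta>) * L)" unfolding mgf_def L_def
          using elim(2)[rule_format, OF \<sigma> T r re'(2) u] by simp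
        have m3: "mgf (t + s) \<le> exp (- (?I (t + s) - \<eta>) * L)" unfolding mgf_def L_def
          using elim(3)[rule_format, OF \<sigma> T r re'(3) u] by simp
        have A4: "exp (- (?I t + 2 * \<eta>) * L) \<le> A / 4"
        proof -
          have "exp (- (?I t + 2 * \<eta>) * L) = A * exp (- \<eta> * L)" by (simp add: A_def algebra_simps flip: exp_add)
          also have "\<dots> \<le> A * (1 / 4)" using elim(4) by (intro mult_left_mono) (auto simp: L_def A_def)
          finally show ?thesis by simp
        qed
        have "exp (s * (a * L)) * mgf (t - s) \<le> exp (s * (a * L)) * exp (- (?I (t - s) - \<eta>) * L)"
          using m2 by (intro mult_left_mono) auto
        also have "\<dots> = exp ((s * a - (?I (t - s) - \<eta>)) * L)" by (simp add: algebra_simps flip: exp_add)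
        also have "\<dots> \<le> exp (- (?I t + 2 * \<eta>) * L)" unfolding exp_le_cancel_iff using \<eta>2 by (intro mult_right_mono L) auto
        finally have t2: "exp (s * (a * L)) * mgf (t - s) \<le> A / 4" using A4 by linarith
        have "exp (- s * (b * L)) * mgf (t + s) \<le> exp (- s * (b * L)) * exp (- (?I (t + s) - \<eta>) * L)"
          using m3 by (intro mult_left_mono) auto
        also have "\<dots> = exp ((- s * b - (?I (t + s) - \<eta>)) * L)" by (simp add: algebra_simps flip: exp_add)
        also have "\<dots> \<le> exp (- (?I t + 2 * \<eta>) * L)" unfolding exp_le_cancel_iff using \<eta>2 by (intro mult_right_mono L) auto
        finally have t3: "exp (- s * (b * L)) * mgf (t + s) \<le> A / 4" using A4 by linarith
        have "exp (- \<kappa> * L) \<le> exp (- (?I t + t * b + \<eta>) * L)"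
          unfolding exp_le_cancel_iff by (intro mult_right_mono L) (simp add: \<kappa>_def)
        also have "\<dots> = exp (- t * (b * L)) * A" by (simp add: A_def algebra_simps flip: exp_add)
        finally have "exp (- \<kappa> * L) / 2 \<le> exp (- t * (b * L)) * (A / 2)" by simp
        also have "\<dots> \<le> exp (- t * (b * L)) * (mgf t - exp (s * (a * L)) * mgf (t - s) - exp (- s * (b * L)) * mgf (t + s))"
          using m1 t2 t3 by (intro mult_left_mono) auto
        also have "\<dots> \<le> measure_pmf.prob ?M {X. ?Z X \<le> - (a * L)}"
          unfolding mgf_def using par
          by (intro tilted_lower_bound finite_set_bernoulli_field) (auto simp: finite_imp_finite_nsets)
        finally show "exp (- \<kappa> * ln (2 * real m)) / 2 \<le> measure_pmf.prob ?M {X. ?Z X \<le> - (a * ln (2 * real m))}"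
          by (simp add: L_def)
      qed
    qed
  qed
qed

section \<open>Hyperedges meeting the candidate set at least twice\<close>

definition shared_edges :: "nat \<Rightarrow> nat \<Rightarrow> nat set \<Rightarrow> nat \<Rightarrow> nat set set" where
  "shared_edges n k T u = {e \<in> nsets {1..n} k. u \<in> e \<and> 2 \<le> card (e \<inter> T)}"

lemma card_shared_edges_le:
  assumes T: "T \<subseteq> {1..n}" "u \<in> T" and k: "k \<ge> 2"
  shows "card (shared_edges n k T u) \<le> card T * ((n - 2) choose (k - 2))"
proof -
  let ?A = "\<lambda>w. {e \<in> nsets {1..n} k. {u, w} \<subseteq> e}"
  have fT: "finite T" using T(1) finite_subset by blast
  have fin: "finite (?A w)" for w by (simp add: finite_imp_finite_nsets)
  have "shared_edges n k T u \<subseteq> (\<Union>w\<in>T - {u}. ?A w)"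
  proof
    fix e assume "e \<in> shared_edges n k T u"
    then have e: "e \<in> nsets {1..n} k" "u \<in> e" "2 \<le> card (e \<inter> T)" by (auto simp: shared_edges_def)
    have "\<not> e \<inter> T \<subseteq> {u}"
    proof
      assume "e \<inter> T \<subseteq> {u}"
      then have "card (e \<inter> T) \<le> card {u}" by (intro card_mono) auto
      then show False using e(3) by simp
    qed
    then obtain w where "w \<in> e" "w \<in> T" "w \<noteq> u" by blast
    then show "e \<in> (\<Union>w\<in>T - {u}. ?A w)" using e by blast
  qed
  then have "card (shared_edges n k T u) \<le> card (\<Union>w\<in>T - {u}. ?A w)"
    using fT fin by (intro card_mono) auto
  also have "\<dots> \<le> (\<Sum>w\<in>T - {u}. card (?A w))" using fT by (intro card_UN_le) auto
  also have "\<dots> = (\<Sum>w\<in>T - {u}. (n - 2) choose (k - 2))"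
  proof (intro sum.cong refl)
    fix w assume w: "w \<in> T - {u}"
    then have "{u, w} \<subseteq> {1..n}" "card {u, w} = 2" using T by auto
    then show "card (?A w) = (n - 2) choose (k - 2)"
      using card_nsets_superset[of "{1..n}" "{u, w}" k] k by simp
  qed
  also have "\<dots> \<le> card T * ((n - 2) choose (k - 2))"
    using fT by (simp add: card_Diff1_le)
  finally show ?thesis .
qed

text \<open>If \<open>card T \<le> \<epsilon> * m\<close>, the expected number of shared hyperedges
  at a vertex is a small multiple of \<open>ln n\<close>. The power 3/2 is more than a union bound
  over the at most \<open>n\<close> vertices of \<open>T\<close> consumes.\<close>

lemma shared_edges_tail:
  assumes k: "k \<ge> 2" and \<beta>: "0 < \<beta>" "\<beta> \<le> \<alpha>" and \<gamma>: "\<gamma> > 0"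
  shows "\<exists>\<epsilon>>0. \<forall>\<^sub>F m in sequentially. \<forall>\<sigma> T. T \<subseteq> {1..2 * m} \<longrightarrow> real (card T) \<le> \<epsilon> * real m \<longrightarrow> (\<forall>u\<in>T.
     measure_pmf.prob (bernoulli_field (nsets {1..2 * m} k) (rate k \<alpha> \<beta> (2 * m) \<sigma>))
       {X. \<gamma> * ln (2 * real m) \<le> (\<Sum>e\<in>shared_edges (2 * m) k T u. of_bool (X e))}
     \<le> exp (- (3 / 2) * ln (2 * real m)))"
proof -
  \<comment> \<open>This Chernoff parameter turns the level \<open>\<gamma> * ln n\<close> into
    \<open>2 * ln n\<close>; \<epsilon> below is chosen so that the mean term gives back at most
    \<open>ln n / 2\<close>.\<close>
  define \<theta> where "\<theta> = 2 / \<gamma>"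
  define B where "B = (exp \<theta> - 1) * \<alpha> * (real k - 1)"
  have \<theta>: "\<theta> > 0" using \<gamma> by (simp add: \<theta>_def)
  have B: "B > 0" unfolding B_def using \<theta> \<beta> k by simp
  define \<epsilon> where "\<epsilon> = 1 / (2 * B)"
  have \<epsilon>: "\<epsilon> > 0" using B by (simp add: \<epsilon>_def)
  have "\<forall>\<^sub>F m in sequentially. \<forall>\<sigma> T. T \<subseteq> {1..2 * m} \<longrightarrow> real (card T) \<le> \<epsilon> * real m \<longrightarrow> (\<forall>u\<in>T.
     measure_pmf.prob (bernoulli_field (nsets {1..2 * m} k) (rate k \<alpha> \<beta> (2 * m) \<sigma>))
       {X. \<gamma> * ln (2 * real m) \<le> (\<Sum>e\<in>shared_edges (2 * m) k T u. of_bool (X e))}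
     \<le> exp (- (3 / 2) * ln (2 * real m)))"
    using eventually_rate[OF k \<beta> zero_less_one] eventually_gt_at_top[of k]
  proof eventually_elim
    case (elim m)
    show ?case
    proof (intro ballI allI impI)
      fix \<sigma> T u assume T: "T \<subseteq> {1..2 * m}" and cT: "real (card T) \<le> \<epsilon> * real m" and u: "u \<in> T"
      let ?E = "nsets {1..2 * m} k" and ?p = "rate k \<alpha> \<beta> (2 * m) \<sigma>" and ?G = "shared_edges (2 * m) k T u"
      let ?M = "bernoulli_field ?E ?p" and ?N = "real ((2 * m - 1) choose (k - 1))"
      define L where "L = ln (2 * real m)"
      have L: "L \<ge> 0" using elim by (simp add: L_def)
      have N: "?N > 0" using elim by simp
      have finE: "finite ?E" by (simp add: finite_imp_finite_nsets)
      have G: "?G \<subseteq> ?E" by (auto simp: shared_edges_def)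
      have "(\<gamma> * L \<le> (\<Sum>e\<in>?G. of_bool (X e))) \<longleftrightarrow> 2 * L \<le> (\<Sum>e\<in>?G. \<theta> * of_bool (X e))" for X
        unfolding sum_distrib_left[symmetric] \<theta>_def using \<gamma> by (simp add: field_simps)
      then have "measure_pmf.prob ?M {X. \<gamma> * L \<le> (\<Sum>e\<in>?G. of_bool (X e))}
          = measure_pmf.prob ?M {X. (\<Sum>e\<in>?G. \<theta> * of_bool (X e)) \<ge> 2 * L}" by simp
      also have "\<dots> \<le> exp ((\<Sum>e\<in>?G. ?p e * (exp \<theta> - 1)) - 2 * L)"
        using elim(1) by (intro chernoff_bernoulli_field[OF finE G]) blast
      also have "\<dots> \<le> exp (- (3 / 2) * L)"
      proof -
        have "(\<Sum>e\<in>?G. ?p e * (exp \<theta> - 1)) \<le> (\<Sum>e\<in>?G. edge_prob k \<alpha> (2 * m) * (exp \<theta> - 1))"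
          using \<theta> elim(2) rate_bounds[OF \<beta>, of "2 * m"] by (intro sum_mono mult_right_mono) auto
        also have "\<dots> = real (card ?G) * (edge_prob k \<alpha> (2 * m) * (exp \<theta> - 1))" by simp
        also have "\<dots> \<le> (\<epsilon> * (real (2 * m) - 1) * real ((2 * m - 2) choose (k - 2))) * (edge_prob k \<alpha> (2 * m) * (exp \<theta> - 1))"
        proof (rule mult_right_mono)
          have "real (card ?G) \<le> real (card T * ((2 * m - 2) choose (k - 2)))"
            using card_shared_edges_le[OF T u k] of_nat_le_iff by blast
          also have "\<dots> = real (card T) * real ((2 * m - 2) choose (k - 2))" by simp
          also have "\<dots> \<le> \<epsilon> * (real (2 * m) - 1) * real ((2 * m - 2) choose (k - 2))"
          proof (rule mult_right_mono)
            have "\<epsilon> * real m \<le> \<epsilon> * (real (2 * m) - 1)" using \<epsilon> elim by (intro mult_left_mono) auto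
            then show "real (card T) \<le> \<epsilon> * (real (2 * m) - 1)" using cT by linarith
          qed simp
          finally show "real (card ?G) \<le> \<epsilon> * (real (2 * m) - 1) * real ((2 * m - 2) choose (k - 2))" .
          show "0 \<le> edge_prob k \<alpha> (2 * m) * (exp \<theta> - 1)" using \<theta> \<beta> elim by (simp add: edge_prob_def)
        qed
        also have "\<dots> = (\<epsilon> * ((real (2 * m) - 1) * real ((2 * m - 2) choose (k - 2)))) * (edge_prob k \<alpha> (2 * m) * (exp \<theta> - 1))"
          by (simp only: mult.assoc)
        also have "\<dots> = (\<epsilon> * ((real k - 1) * ?N)) * (edge_prob k \<alpha> (2 * m) * (exp \<theta> - 1))"
          using elim by (subst binomial_absorb2[OF k]) auto
        also have "\<dots> = \<epsilon> * B * L" using N by (simp add: edge_prob_def L_def B_def)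
        also have "\<dots> = L / 2" using B by (simp add: \<epsilon>_def)
        finally show ?thesis by simp
      qed
      finally show "measure_pmf.prob ?M {X. \<gamma> * ln (2 * real m) \<le> (\<Sum>e\<in>?G. of_bool (X e))} \<le> exp (- (3 / 2) * ln (2 * real m))"
        by (simp add: L_def)
    qed
  qed
  with \<epsilon> show ?thesis by blast
qed

text \<open>An edge containing \<open>u\<close> or \<open>v\<close> is private to one of them or
  meets \<open>T\<close> at least twice. In the latter case only the crude bound
  \<open>k\<^sup>2\<close> is used, and an edge containing both vertices may be charged twice since
  the charge is nonnegative.\<close>

lemma gap_pair_le:
  assumes \<sigma>: "\<sigma> \<in> sign_vectors n" and T: "u \<in> T" "v \<in> T" "u \<noteq> v"
    and X: "finite T"
  shows "(\<Sum>e\<in>nsets {1..n} k. gap \<sigma> {u, v} e * of_bool (X e))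
    \<le> 4 * private_gap \<sigma> n k T u X + 4 * private_gap \<sigma> n k T v X
      + real k ^ 2 * ((\<Sum>e\<in>shared_edges n k T u. of_bool (X e)) + (\<Sum>e\<in>shared_edges n k T v. of_bool (X e)))"
proof -
  let ?E = "nsets {1..n} k"
  have finE: "finite ?E" by (simp add: finite_imp_finite_nsets)
  have restrict: "(\<Sum>e\<in>?E. if P e then h e else 0) = (\<Sum>e\<in>{e\<in>?E. P e}. h e)" for P and h :: "nat set \<Rightarrow> real"
    by (rule sum.inter_filter[OF finE, symmetric])
  have pointwise: "gap \<sigma> {u, v} e \<le> (if e \<inter> T = {u} then gap \<sigma> {u} e else 0) + (if e \<inter> T = {v} then gap \<sigma> {v} e else 0)
     + (if u \<in> e \<and> 2 \<le> card (e \<inter> T) then real k ^ 2 else 0) + (if v \<in> e \<and> 2 \<le> card (e \<inter> T) then real k ^ 2 else 0)"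
    if e: "e \<in> ?E" for e
  proof -
    have fe: "finite (e \<inter> T)" using X by simp
    have single: "gap \<sigma> {u, v} e = gap \<sigma> {w} e" if "e \<inter> T = {w}" "w \<in> {u, v}" for w
      using that T by (intro gap_cong) blast
    have two: "2 \<le> card (e \<inter> T)" if w: "w \<in> e" "w \<in> T" "e \<inter> T \<noteq> {w}" for w
    proof -
      obtain w' where "w' \<in> e \<inter> T" "w' \<noteq> w" using w by blast
      then have "card {w, w'} \<le> card (e \<inter> T)" using w fe by (intro card_mono) auto
      then show ?thesis using \<open>w' \<noteq> w\<close> by simp
    qed
    have le: "gap \<sigma> {u, v} e \<le> real k ^ 2" using abs_gap_le[OF \<sigma> e] abs_le_D1 by blast
    consider "u \<notin> e" "v \<notin> e" | "e \<inter> T = {u}" | "e \<inter> T = {v}"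
      | "u \<in> e" "2 \<le> card (e \<inter> T)" | "v \<in> e" "2 \<le> card (e \<inter> T)"
      using two T by blast
    then show ?thesis
    proof cases
      case 1
      then have "gap \<sigma> {u, v} e = 0" by (intro gap_disjoint) auto
      moreover have "e \<inter> T \<noteq> {u}" "e \<inter> T \<noteq> {v}" using 1 by auto
      ultimately show ?thesis using 1 by simp
    next
      case 2
      then show ?thesis using single[OF 2] T by auto
    next
      case 3
      then show ?thesis using single[OF 3] T by auto
    next
      case 4
      then have "e \<inter> T \<noteq> {u}" "e \<inter> T \<noteq> {v}" by auto
      then show ?thesis using 4 le by (simp add: add_increasing2)
    next
      case 5
      then have "e \<inter> T \<noteq> {u}" "e \<inter> T \<noteq> {v}" by auto
      then show ?thesis using 5 le by (simp add: add_increasing)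
    qed
  qed
  have "(\<Sum>e\<in>?E. gap \<sigma> {u, v} e * of_bool (X e))
    \<le> (\<Sum>e\<in>?E. (if e \<inter> T = {u} then gap \<sigma> {u} e * of_bool (X e) else 0) + (if e \<inter> T = {v} then gap \<sigma> {v} e * of_bool (X e) else 0)
     + (if u \<in> e \<and> 2 \<le> card (e \<inter> T) then real k ^ 2 * of_bool (X e) else 0) + (if v \<in> e \<and> 2 \<le> card (e \<inter> T) then real k ^ 2 * of_bool (X e) else 0))"
  proof (rule sum_mono)
    fix e assume "e \<in> ?E"
    note pw = pointwise[OF this]
    show "gap \<sigma> {u, v} e * of_bool (X e) \<le> (if e \<inter> T = {u} then gap \<sigma> {u} e * of_bool (X e) else 0) + (if e \<inter> T = {v} then gap \<sigma> {v} e * of_bool (X e) else 0)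
     + (if u \<in> e \<and> 2 \<le> card (e \<inter> T) then real k ^ 2 * of_bool (X e) else 0) + (if v \<in> e \<and> 2 \<le> card (e \<inter> T) then real k ^ 2 * of_bool (X e) else 0)"
    proof (cases "X e")
      case True
      then show ?thesis using pw by (simp only: of_bool_eq mult_1_right)
    qed (simp only: of_bool_eq mult_zero_right if_cancel add_0_right order.refl)
  qed
  also have "\<dots> = 4 * private_gap \<sigma> n k T u X + 4 * private_gap \<sigma> n k T v X
      + real k ^ 2 * ((\<Sum>e\<in>shared_edges n k T u. of_bool (X e)) + (\<Sum>e\<in>shared_edges n k T v. of_bool (X e)))"
    unfolding sum.distrib restrict private_gap_def private_edges_def shared_edges_def
    by (simp add: sum_distrib_left distrib_left)
  finally show ?thesis .
qed

text \<open>Private edge sets of different vertices are disjoint, so the probabilities multiply to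
  at most \<open>(1 - \<pi>) ^ card S\<close>. \<open>S\<close> is allowed to be smaller than
  \<open>T\<close> because each class of \<open>T\<close> is treated separately.\<close>

lemma all_private_gaps_large:
  assumes T: "T \<subseteq> {1..n}" "S \<subseteq> T" and \<pi>: "\<pi> \<le> 1"
    and low: "\<And>u. u \<in> S \<Longrightarrow> \<pi> \<le> measure_pmf.prob (bernoulli_field (nsets {1..n} k) p) {X. private_gap \<sigma> n k T u X \<le> - a}"
  shows "measure_pmf.prob (bernoulli_field (nsets {1..n} k) p) {X. \<forall>u\<in>S. private_gap \<sigma> n k T u X > - a}
     \<le> exp (- (\<pi> * real (card S)))"
proof -
  let ?E = "nsets {1..n} k"
  let ?M = "bernoulli_field ?E p"
  have finE: "finite ?E" by (simp add: finite_imp_finite_nsets)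
  have finS: "finite S" by (rule finite_subset[OF order.trans[OF T(2,1)]]) simp
  have "measure_pmf.prob ?M {X. \<forall>u\<in>S. private_gap \<sigma> n k T u X > - a}
     = measure_pmf.prob ?M {X. \<forall>u\<in>S. (\<Sum>e\<in>private_edges n k T u. gap \<sigma> {u} e / 4 * of_bool (X e)) \<in> {- a<..}}"
    by (simp add: private_gap_def)
  also have "\<dots> = (\<Prod>u\<in>S. measure_pmf.prob ?M {X. (\<Sum>e\<in>private_edges n k T u. gap \<sigma> {u} e / 4 * of_bool (X e)) \<in> {- a<..}})"
    by (intro prob_Ball_bernoulli_field finE finS) (auto simp: private_edges_def disjoint_family_on_def)
  also have "\<dots> \<le> (\<Prod>u\<in>S. exp (- \<pi>))"
  proof (intro prod_mono conjI)
    fix u assume u: "u \<in> S"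
    have "measure_pmf.prob ?M {X. (\<Sum>e\<in>private_edges n k T u. gap \<sigma> {u} e / 4 * of_bool (X e)) \<in> {- a<..}}
      = measure_pmf.prob ?M (UNIV - {X. private_gap \<sigma> n k T u X \<le> - a})"
      by (intro arg_cong[where f = "measure_pmf.prob ?M"]) (auto simp: private_gap_def)
    also have "\<dots> = 1 - measure_pmf.prob ?M {X. private_gap \<sigma> n k T u X \<le> - a}"
      using measure_pmf.prob_compl[of "{X. private_gap \<sigma> n k T u X \<le> - a}" ?M] by simp
    also have "\<dots> \<le> 1 + (- \<pi>)" using low[OF u] by simp
    also have "\<dots> \<le> exp (- \<pi>)" by (rule exp_ge_add_one_self)
    finally show "measure_pmf.prob ?M {X. (\<Sum>e\<in>private_edges n k T u. gap \<sigma> {u} e / 4 * of_bool (X e)) \<in> {- a<..}} \<le> exp (- \<pi>)" .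
  qed simp
  also have "\<dots> = exp (- (\<pi> * real (card S)))" by (simp add: mult.commute flip: exp_of_nat_mult)
  finally show ?thesis .
qed

text \<open>The event is that \<sigma> is optimal, ties included, so the exchange has to improve the
  objective strictly.\<close>

lemma failure_exponent:
  assumes k: "k \<ge> 2" and \<beta>: "0 < \<beta>" "\<beta> \<le> \<alpha>" and I: "I2 k \<alpha> \<beta> < 1" and \<delta>: "\<delta> > 0"
  shows "\<forall>\<^sub>F m in sequentially. \<forall>\<sigma>\<in>balanced_labels (2 * m).
    measure_pmf.prob (bernoulli_field (nsets {1..2 * m} k) (rate k \<alpha> \<beta> (2 * m) \<sigma>))
      {X. \<forall>y\<in>balanced_labels (2 * m). trunc_objective (2 * m) {e. X e} y \<le> trunc_objective (2 * m) {e. X e} \<sigma>} \<le> \<delta>"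
proof -
  obtain \<kappa> a \<epsilon>1 where \<kappa>: "0 \<le> \<kappa>" "\<kappa> < 1" and a: "a > 0" and \<epsilon>1: "\<epsilon>1 > 0" and private_low:
    "\<forall>\<^sub>F m in sequentially. \<forall>\<sigma>\<in>balanced_labels (2 * m). \<forall>T\<subseteq>{1..2 * m}. \<forall>r.
     card {v\<in>T. \<sigma> v = 1} = r \<longrightarrow> card {v\<in>T. \<sigma> v = - 1} = r \<longrightarrow> real r \<le> \<epsilon>1 * real m \<longrightarrow> (\<forall>u\<in>T.
       exp (- \<kappa> * ln (2 * real m)) / 2
       \<le> measure_pmf.prob (bernoulli_field (nsets {1..2 * m} k) (rate k \<alpha> \<beta> (2 * m) \<sigma>))
          {X. private_gap \<sigma> (2 * m) k T u X \<le> - (a * ln (2 * real m))})"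
    by (rule private_gap_lower[OF k \<beta> I])
  \<comment> \<open>Makes \<open>k\<^sup>2 * \<gamma> = 4 * a\<close>: the worst effect of the
    shared edges at a vertex just balances the gain on its private edges.\<close>
  define \<gamma> where "\<gamma> = 4 * a / real k ^ 2"
  have \<gamma>: "\<gamma> > 0" using a k by (simp add: \<gamma>_def)
  obtain \<epsilon>2 where \<epsilon>2: "\<epsilon>2 > 0" and shared_tail: "\<forall>\<^sub>F m in sequentially. \<forall>\<sigma> T. T \<subseteq> {1..2 * m} \<longrightarrow> real (card T) \<le> \<epsilon>2 * real m \<longrightarrow> (\<forall>u\<in>T.
     measure_pmf.prob (bernoulli_field (nsets {1..2 * m} k) (rate k \<alpha> \<beta> (2 * m) \<sigma>))
       {X. \<gamma> * ln (2 * real m) \<le> (\<Sum>e\<in>shared_edges (2 * m) k T u. of_bool (X e))}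
     \<le> exp (- (3 / 2) * ln (2 * real m)))"
    using shared_edges_tail[OF k \<beta> \<gamma>] by blast
  \<comment> \<open>With this choice \<open>1 - d - \<kappa> = d\<close>, so the expected number of
    good vertices per class grows like \<open>n\<close> to the power \<open>d\<close>.\<close>
  define d where "d = (1 - \<kappa>) / 2"
  \<comment> \<open>\<open>\<epsilon>2\<close> is halved because \<open>T\<close> has
    \<open>2 * \<tau>\<close> elements; the bound 1 ensures \<open>\<tau> \<le> m\<close>, so that
    each class can supply \<tau> vertices.\<close>
  define \<epsilon> where "\<epsilon> = min (min \<epsilon>1 (\<epsilon>2 / 2)) 1"
  have d: "d > 0" "1 - d > 0" using \<kappa> by (auto simp: d_def field_simps)
  have \<epsilon>: "\<epsilon> > 0" "\<epsilon> \<le> \<epsilon>1" "2 * \<epsilon> \<le> \<epsilon>2" "\<epsilon> \<le> 1" using \<epsilon>1 \<epsilon>2 by (auto simp: \<epsilon>_def)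
  have "(\<lambda>m. 2 * exp (- d * ln (2 * real m))) \<longlonglongrightarrow> 0" using d by real_asymp
  then have lim1: "\<forall>\<^sub>F m in sequentially. 2 * exp (- d * ln (2 * real m)) < \<epsilon>"
    using \<epsilon>(1) by (rule order_tendstoD)
  have "filterlim (\<lambda>m. exp ((1 - d) * ln (2 * real m))) at_top sequentially" using d(2) by real_asymp
  then have lim2: "\<forall>\<^sub>F m in sequentially. 2 \<le> exp ((1 - d) * ln (2 * real m))"
    by (simp add: filterlim_at_top)
  have "(\<lambda>m. 2 * exp (- (exp (d * ln (2 * real m)) / 4)) + exp (- (1 / 2) * ln (2 * real m))) \<longlonglongrightarrow> 0"
    using d(1) by real_asymp
  then have lim3: "\<forall>\<^sub>F m in sequentially. 2 * exp (- (exp (d * ln (2 * real m)) / 4)) + exp (- (1 / 2) * ln (2 * real m)) < \<delta>"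
    using \<delta> by (rule order_tendstoD)
  show ?thesis
    using private_low shared_tail lim1 lim2 lim3 eventually_ge_at_top[of 1]
  proof eventually_elim
    case (elim m)
    show ?case
    proof
      fix \<sigma> assume \<sigma>: "\<sigma> \<in> balanced_labels (2 * m)"
      let ?V = "{1..2 * m}" and ?p = "rate k \<alpha> \<beta> (2 * m) \<sigma>"
      let ?E = "nsets ?V k"
      let ?M = "bernoulli_field ?E ?p"
      define L where "L = ln (2 * real m)"
      have m: "m \<ge> 1" using elim by simp
      have L: "L \<ge> 0" using m by (simp add: L_def)
      have expL: "exp L = 2 * real m" using m by (simp add: L_def)
      have sv: "\<sigma> \<in> sign_vectors (2 * m)" using \<sigma> by (auto simp: balanced_labels_def)
      have finE: "finite ?E" by (simp add: finite_imp_finite_nsets)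
      \<comment> \<open>Rounding down loses at most half, as the power is eventually at least
        2.\<close>
      define \<tau> where "\<tau> = nat \<lfloor>exp ((1 - d) * L)\<rfloor>"
      have \<tau>_le: "real \<tau> \<le> exp ((1 - d) * L)" by (simp add: \<tau>_def)
      have \<tau>_ge: "exp ((1 - d) * L) / 2 \<le> real \<tau>"
      proof -
        have "exp ((1 - d) * L) - 1 \<le> real \<tau>" by (simp add: \<tau>_def)
        then show ?thesis using elim(4) unfolding L_def[symmetric] by linarith
      qed
      have \<tau>\<epsilon>: "real \<tau> \<le> \<epsilon> * real m"
      proof -
        have "exp ((1 - d) * L) = exp L * exp (- d * L)" by (simp add: algebra_simps flip: exp_add)
        also have "\<dots> = (2 * exp (- d * L)) * real m" by (simp add: expL)
        also have "\<dots> \<le> \<epsilon> * real m" using elim(3) by (intro mult_right_mono) (auto simp: L_def)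
        finally show ?thesis using \<tau>_le by linarith
      qed
      have "real \<tau> \<le> 1 * real m" using \<tau>\<epsilon> \<epsilon>(4) mult_right_mono[of \<epsilon> 1 "real m"] by linarith
      then have \<tau>m: "\<tau> \<le> m" by simp
      obtain T1 where T1: "T1 \<subseteq> {v\<in>?V. \<sigma> v = 1}" "card T1 = \<tau>" "finite T1"
        using obtain_subset_with_card_n[of \<tau> "{v\<in>?V. \<sigma> v = 1}"] balanced_card[OF \<sigma>, of 1] \<tau>m by auto
      obtain T2 where T2: "T2 \<subseteq> {v\<in>?V. \<sigma> v = - 1}" "card T2 = \<tau>" "finite T2"
        using obtain_subset_with_card_n[of \<tau> "{v\<in>?V. \<sigma> v = - 1}"] balanced_card[OF \<sigma>, of "- 1"] \<tau>m by auto
      define T where "T = T1 \<union> T2"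
      have T: "T \<subseteq> ?V" "finite T" "T1 \<subseteq> T" "T2 \<subseteq> T" using T1 T2 by (auto simp: T_def)
      have "{v\<in>T. \<sigma> v = 1} = T1" "{v\<in>T. \<sigma> v = - 1} = T2" using T1 T2 by (auto simp: T_def)
      then have r: "card {v\<in>T. \<sigma> v = 1} = \<tau>" "card {v\<in>T. \<sigma> v = - 1} = \<tau>" using T1 T2 by auto
      have cT: "card T = 2 * \<tau>" by (rule card_eq_double[OF sv T(1) r])
      have \<tau>1: "real \<tau> \<le> \<epsilon>1 * real m" using \<tau>\<epsilon> mult_right_mono[OF \<epsilon>(2), of "real m"] by linarith
      have \<tau>2: "real (card T) \<le> \<epsilon>2 * real m" using \<tau>\<epsilon> mult_right_mono[OF \<epsilon>(3), of "real m"] cT by simp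
      define \<pi> where "\<pi> = exp (- \<kappa> * L) / 2"
      have low: "\<pi> \<le> measure_pmf.prob ?M {X. private_gap \<sigma> (2 * m) k T u X \<le> - (a * L)}" if "u \<in> T" for u
        using elim(1)[rule_format, OF \<sigma> T(1) r \<tau>1 that] by (simp add: \<pi>_def L_def)
      have "- \<kappa> * L \<le> 0" using \<kappa> L by simp
      then have \<pi>1: "\<pi> \<le> 1" unfolding \<pi>_def using exp_le_one_iff[of "- \<kappa> * L"] by linarith
      let ?none = "\<lambda>S. {X. \<forall>u\<in>S. private_gap \<sigma> (2 * m) k T u X > - (a * L)}"
      let ?W = "\<lambda>u. {X. \<gamma> * L \<le> (\<Sum>e\<in>shared_edges (2 * m) k T u. of_bool (X e))}"
      let ?best = "{X. \<forall>y\<in>balanced_labels (2 * m). trunc_objective (2 * m) {e. X e} y \<le> trunc_objective (2 * m) {e. X e} \<sigma>}"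
      have "?best \<inter> set_pmf ?M \<subseteq> (?none T1 \<union> ?none T2) \<union> (\<Union>u\<in>T. ?W u)"
      proof
        fix X assume X: "X \<in> ?best \<inter> set_pmf ?M"
        show "X \<in> (?none T1 \<union> ?none T2) \<union> (\<Union>u\<in>T. ?W u)"
        proof (rule ccontr)
          assume not: "X \<notin> (?none T1 \<union> ?none T2) \<union> (\<Union>u\<in>T. ?W u)"
          then obtain u v where u: "u \<in> T1" "private_gap \<sigma> (2 * m) k T u X \<le> - (a * L)"
            and v: "v \<in> T2" "private_gap \<sigma> (2 * m) k T v X \<le> - (a * L)"
            by (auto simp: not_less)
          have uvT: "u \<in> T" "v \<in> T" using u v T by auto
          have \<sigma>uv: "\<sigma> u = 1" "\<sigma> v = - 1" using u v T1 T2 by auto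
          then have uv: "u \<noteq> v" by auto
          have W: "(\<Sum>e\<in>shared_edges (2 * m) k T w. of_bool (X e)) < \<gamma> * L" if "w \<in> T" for w
            using not that by force
          have D: "{u, v} \<subseteq> ?V" using uvT T by auto
          have XE: "{e. X e} \<subseteq> ?E" using set_bernoulli_field[OF finE] X by blast
          have "(\<Sum>e\<in>?E. gap \<sigma> {u, v} e * of_bool (X e))
             \<le> 4 * private_gap \<sigma> (2 * m) k T u X + 4 * private_gap \<sigma> (2 * m) k T v X
                + real k ^ 2 * ((\<Sum>e\<in>shared_edges (2 * m) k T u. of_bool (X e)) + (\<Sum>e\<in>shared_edges (2 * m) k T v. of_bool (X e)))"
            by (rule gap_pair_le[OF sv uvT uv T(2)])
          \<comment> \<open>Strictness comes from the shared edges, whose number lies strictly below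
            \<open>\<gamma> * L\<close> outside the exceptional events.\<close>
          also have "\<dots> < - 4 * (a * L) + - 4 * (a * L) + real k ^ 2 * (\<gamma> * L + \<gamma> * L)"
          proof -
            have "4 * private_gap \<sigma> (2 * m) k T u X \<le> - 4 * (a * L)" "4 * private_gap \<sigma> (2 * m) k T v X \<le> - 4 * (a * L)"
              using u(2) v(2) by linarith+
            moreover have "real k ^ 2 * ((\<Sum>e\<in>shared_edges (2 * m) k T u. of_bool (X e)) + (\<Sum>e\<in>shared_edges (2 * m) k T v. of_bool (X e)))
                < real k ^ 2 * (\<gamma> * L + \<gamma> * L)"
              using k by (intro mult_strict_left_mono add_strict_mono W uvT) auto
            ultimately show ?thesis by linarith
          qed
          also have "\<dots> = 0" using k by (simp add: \<gamma>_def field_simps)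
          finally have "2 * real_of_int (trunc_objective (2 * m) {e. X e} \<sigma> - trunc_objective (2 * m) {e. X e} (flip {u, v} \<sigma>)) < 0"
            unfolding trunc_objective_diff[OF sv D XE] .
          then have lt: "trunc_objective (2 * m) {e. X e} \<sigma> < trunc_objective (2 * m) {e. X e} (flip {u, v} \<sigma>)" by simp
          have "{w\<in>{u, v}. \<sigma> w = 1} = {u}" "{w\<in>{u, v}. \<sigma> w = - 1} = {v}" using \<sigma>uv by auto
          then have "(\<Sum>w\<in>?V. flip {u, v} \<sigma> w) = (\<Sum>w\<in>?V. \<sigma> w)" unfolding sum_flip[OF sv D] by simp
          then have "flip {u, v} \<sigma> \<in> balanced_labels (2 * m)"
            using \<sigma> flip_sign_vectors[OF sv D] by (simp add: balanced_labels_sum)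
          then show False using X lt by fastforce
        qed
      qed
      then have "measure_pmf.prob ?M (?best \<inter> set_pmf ?M) \<le> measure_pmf.prob ?M ((?none T1 \<union> ?none T2) \<union> (\<Union>u\<in>T. ?W u))"
        by (rule measure_pmf.finite_measure_mono) simp
      also have "\<dots> \<le> measure_pmf.prob ?M (?none T1 \<union> ?none T2) + measure_pmf.prob ?M (\<Union>u\<in>T. ?W u)"
        by (rule measure_Un_le) simp_all
      also have "measure_pmf.prob ?M (?none T1 \<union> ?none T2) \<le> measure_pmf.prob ?M (?none T1) + measure_pmf.prob ?M (?none T2)"
        by (rule measure_Un_le) simp_all
      also have "measure_pmf.prob ?M (?none T1) \<le> exp (- (\<pi> * real (card T1)))"
        using T low by (intro all_private_gaps_large \<pi>1) auto
      also have "measure_pmf.prob ?M (?none T2) \<le> exp (- (\<pi> * real (card T2)))"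
        using T low by (intro all_private_gaps_large \<pi>1) auto
      also have "measure_pmf.prob ?M (\<Union>u\<in>T. ?W u) \<le> (\<Sum>u\<in>T. measure_pmf.prob ?M (?W u))"
        by (rule measure_pmf.finite_measure_subadditive_finite[OF T(2)]) simp
      also have "\<dots> \<le> (\<Sum>u\<in>T. exp (- (3 / 2) * L))"
        unfolding L_def using elim(2) T(1) \<tau>2 by (intro sum_mono) blast
      also have "\<dots> = real (2 * \<tau>) * exp (- (3 / 2) * L)" by (simp add: cT)
      also have "\<dots> \<le> exp L * exp (- (3 / 2) * L)" using \<tau>m by (intro mult_right_mono) (auto simp: expL)
      also have "\<dots> = exp (- (1 / 2) * L)" by (simp flip: exp_add)
      finally have "measure_pmf.prob ?M (?best \<inter> set_pmf ?M) \<le> 2 * exp (- (\<pi> * real \<tau>)) + exp (- (1 / 2) * L)"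
        using T1 T2 by simp
      moreover have "exp (- (\<pi> * real \<tau>)) \<le> exp (- (exp (d * L) / 4))"
      proof -
        have "exp (d * L) / 4 = \<pi> * (exp ((1 - d) * L) / 2)"
          by (simp add: \<pi>_def d_def field_simps flip: exp_add)
        also have "\<dots> \<le> \<pi> * real \<tau>" using \<tau>_ge by (intro mult_left_mono) (auto simp: \<pi>_def)
        finally show ?thesis by simp
      qed
      ultimately show "measure_pmf.prob ?M ?best \<le> \<delta>"
        using elim(5) unfolding L_def[symmetric] measure_Int_set_pmf by linarith
    qed
  qed
qed

section \<open>Exact recovery\<close>

lemma HSBM_eq:
  "HSBM n (edge_prob k \<alpha> n) (edge_prob k \<beta> n) k
    = bind_pmf (pmf_of_set (balanced_labels n))
        (\<lambda>\<sigma>. map_pmf (\<lambda>X. (\<sigma>, {e. X e})) (bernoulli_field (nsets {1..n} k) (rate k \<alpha> \<beta> n \<sigma>)))"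
  unfolding HSBM_def bernoulli_field_def rate_def by (simp only: if_distrib[of "\<lambda>c. edge_prob k c n"])

text \<open>The bounds of both halves are uniform in \<sigma>, so they pass to the mixture over
  balanced labels.\<close>

lemma HSBM_prob_ge:
  assumes "even n" and "\<And>\<sigma>. \<sigma> \<in> balanced_labels n \<Longrightarrow>
      measure_pmf.prob (bernoulli_field (nsets {1..n} k) (rate k \<alpha> \<beta> n \<sigma>)) {X. (\<sigma>, {e. X e}) \<notin> A} \<le> \<delta>"
  shows "1 - \<delta> \<le> measure_pmf.prob (HSBM n (edge_prob k \<alpha> n) (edge_prob k \<beta> n) k) A"
proof -
  let ?\<mu> = "pmf_of_set (balanced_labels n)"
  define f where "f \<sigma> = map_pmf (\<lambda>X. (\<sigma>, {e. X e})) (bernoulli_field (nsets {1..n} k) (rate k \<alpha> \<beta> n \<sigma>))" for \<sigma>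
  have fin: "finite (balanced_labels n)" using finite_sign_vectors by (simp add: balanced_labels_def)
  have supp: "set_pmf ?\<mu> = balanced_labels n"
    using fin balanced_labels_nonempty[OF assms(1)] by (rule set_pmf_of_set[rotated])
  have ge: "1 - \<delta> \<le> measure_pmf.prob (f \<sigma>) A" if "\<sigma> \<in> balanced_labels n" for \<sigma>
  proof -
    let ?M = "bernoulli_field (nsets {1..n} k) (rate k \<alpha> \<beta> n \<sigma>)"
    have "measure_pmf.prob (f \<sigma>) A = measure_pmf.prob ?M ((\<lambda>X. (\<sigma>, {e. X e})) -` A)"
      by (simp add: f_def)
    also have "(\<lambda>X. (\<sigma>, {e. X e})) -` A = UNIV - {X. (\<sigma>, {e. X e}) \<notin> A}" by auto
    also have "measure_pmf.prob ?M \<dots> = 1 - measure_pmf.prob ?M {X. (\<sigma>, {e. X e}) \<notin> A}"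
      using measure_pmf.prob_compl[of "{X. (\<sigma>, {e. X e}) \<notin> A}" ?M] by simp
    finally show ?thesis using assms(2)[OF that] by simp
  qed
  have "ennreal (1 - \<delta>) \<le> (\<integral>\<^sup>+\<sigma>. emeasure (measure_pmf (f \<sigma>)) A \<partial>measure_pmf ?\<mu>)"
  proof (rule measure_pmf.nn_integral_ge_const)
    show "AE \<sigma> in measure_pmf ?\<mu>. ennreal (1 - \<delta>) \<le> emeasure (measure_pmf (f \<sigma>)) A"
      using ge by (intro AE_pmfI) (simp add: supp measure_pmf.emeasure_eq_measure ennreal_leI)
  qed
  also have "\<dots> = ennreal (measure_pmf.prob (bind_pmf ?\<mu> f) A)"
    by (simp flip: measure_pmf.emeasure_eq_measure)
  finally show ?thesis unfolding HSBM_eq f_def by (subst (asm) ennreal_le_iff) auto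
qed

lemma tendsto_1_prob:
  fixes M :: "nat \<Rightarrow> 'a pmf"
  assumes "\<And>\<delta>. \<delta> > 0 \<Longrightarrow> \<forall>\<^sub>F m in sequentially. 1 - \<delta> \<le> measure_pmf.prob (M m) (A m)"
  shows "(\<lambda>m. measure_pmf.prob (M m) (A m)) \<longlonglongrightarrow> 1"
proof (rule order_tendstoI)
  fix c :: real assume "c < 1"
  then show "\<forall>\<^sub>F m in sequentially. c < measure_pmf.prob (M m) (A m)"
    using assms[of "(1 - c) / 2"] by (auto elim!: eventually_mono simp: field_simps)
next
  fix c :: real assume "1 < c"
  then show "\<forall>\<^sub>F m in sequentially. measure_pmf.prob (M m) (A m) < c"
    by (intro always_eventually allI) (auto intro: le_less_trans[OF measure_pmf.prob_le_1])
qed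

lemma trunc_optimalD:
  assumes "trunc_optimal n H x"
  shows "x \<in> balanced_labels n" "y \<in> balanced_labels n \<Longrightarrow> trunc_objective n H y \<le> trunc_objective n H x"
  using assms by (auto simp: trunc_optimal_def is_arg_max_def balanced_labels_sum not_less)

text \<open>\<open>est\<close> stands for any rule that selects an optimum, so ties may be broken
  arbitrarily; even sizes are written as \<open>2*m\<close>.\<close>

theorem theorem3:
  fixes k :: nat and \<alpha> \<beta> :: real
    and est :: "nat \<Rightarrow> nat set set \<Rightarrow> nat \<Rightarrow> int"
  assumes "k \<ge> 2" and "\<alpha> > \<beta>" and "\<beta> > 0"
    and "\<And>n H. even n \<Longrightarrow> n > 0 \<Longrightarrow> H \<subseteq> nsets {1..n} k \<Longrightarrow> trunc_optimal n H (est n H)"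
  shows
    "(I2 k \<alpha> \<beta> < 1 \<longrightarrow>
        (\<lambda>m. measure_pmf.prob
          (HSBM (2*m) (edge_prob k \<alpha> (2*m)) (edge_prob k \<beta> (2*m)) k)
          {(\<sigma>, H). est (2*m) H \<notin> {\<sigma>, (\<lambda>v. - \<sigma> v)}}) \<longlonglongrightarrow> 1) \<and>
     (I2 k \<alpha> \<beta> > 1 \<longrightarrow>
        (\<lambda>m. measure_pmf.prob
          (HSBM (2*m) (edge_prob k \<alpha> (2*m)) (edge_prob k \<beta> (2*m)) k)
          {(\<sigma>, H). est (2*m) H \<in> {\<sigma>, (\<lambda>v. - \<sigma> v)}}) \<longlonglongrightarrow> 1)"
proof -
  let ?M = "\<lambda>m \<sigma>. bernoulli_field (nsets {1..2*m} k) (rate k \<alpha> \<beta> (2*m) \<sigma>)"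
  have optimal: "trunc_optimal (2*m) {e. X e} (est (2*m) {e. X e})"
    if "m \<ge> 1" "X \<in> set_pmf (?M m \<sigma>)" for m \<sigma> X
    using that set_bernoulli_field[OF _ that(2)] by (intro assms(4)) (auto simp: finite_imp_finite_nsets)
  have mono: "measure_pmf.prob (?M m \<sigma>) S \<le> measure_pmf.prob (?M m \<sigma>) S'"
    if "\<And>X. X \<in> set_pmf (?M m \<sigma>) \<Longrightarrow> X \<in> S \<Longrightarrow> X \<in> S'" for m \<sigma> S S'
    using that by (intro measure_pmf.finite_measure_mono_AE AE_pmfI) auto
  show ?thesis
  proof (intro conjI impI tendsto_1_prob)
    fix \<delta> :: real assume "I2 k \<alpha> \<beta> < 1" "\<delta> > 0"
    from failure_exponent[OF assms(1,3) less_imp_le[OF assms(2)] this] eventually_ge_at_top[of 1]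
    show "\<forall>\<^sub>F m in sequentially. 1 - \<delta> \<le> measure_pmf.prob
          (HSBM (2*m) (edge_prob k \<alpha> (2*m)) (edge_prob k \<beta> (2*m)) k)
          {(\<sigma>, H). est (2*m) H \<notin> {\<sigma>, (\<lambda>v. - \<sigma> v)}}"
    proof eventually_elim
      case (elim m)
      show ?case
      proof (rule HSBM_prob_ge)
        fix \<sigma> assume \<sigma>: "\<sigma> \<in> balanced_labels (2*m)"
        show "measure_pmf.prob (?M m \<sigma>)
           {X. (\<sigma>, {e. X e}) \<notin> {(\<sigma>, H). est (2*m) H \<notin> {\<sigma>, (\<lambda>v. - \<sigma> v)}}} \<le> \<delta>"
        proof (rule order.trans[OF mono bspec[OF elim(1) \<sigma>]], intro CollectI ballI)
          fix X y
          assume X: "X \<in> set_pmf (?M m \<sigma>)" "X \<in> {X. (\<sigma>, {e. X e}) \<notin> {(\<sigma>, H). est (2*m) H \<notin> {\<sigma>, (\<lambda>v. - \<sigma> v)}}}"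
            and y: "y \<in> balanced_labels (2*m)"
          \<comment> \<open>By the sign symmetry of the objective, success of the estimator makes
            \<sigma> itself optimal, which is the event of \<open>failure_exponent\<close>.\<close>
          from X(2) have "trunc_objective (2*m) {e. X e} (est (2*m) {e. X e}) = trunc_objective (2*m) {e. X e} \<sigma>"
            by (auto simp: trunc_objective_uminus)
          then show "trunc_objective (2*m) {e. X e} y \<le> trunc_objective (2*m) {e. X e} \<sigma>"
            using trunc_optimalD(2)[OF optimal[OF elim(2) X(1)] y] by simp
        qed
      qed simp
    qed
  next
    fix \<delta> :: real assume "I2 k \<alpha> \<beta> > 1" "\<delta> > 0"
    from recovery_exponent[OF assms(1,3,2) this] eventually_ge_at_top[of 1]
    show "\<forall>\<^sub>F m in sequentially. 1 - \<delta> \<le> measure_pmf.prob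
          (HSBM (2*m) (edge_prob k \<alpha> (2*m)) (edge_prob k \<beta> (2*m)) k)
          {(\<sigma>, H). est (2*m) H \<in> {\<sigma>, (\<lambda>v. - \<sigma> v)}}"
    proof eventually_elim
      case (elim m)
      show ?case
      proof (rule HSBM_prob_ge)
        fix \<sigma> assume \<sigma>: "\<sigma> \<in> balanced_labels (2*m)"
        show "measure_pmf.prob (?M m \<sigma>)
           {X. (\<sigma>, {e. X e}) \<notin> {(\<sigma>, H). est (2*m) H \<in> {\<sigma>, (\<lambda>v. - \<sigma> v)}}} \<le> \<delta>"
        \<comment> \<open>When recovery fails, the estimate itself is the rival labeling in the
          event of \<open>recovery_exponent\<close>.\<close>
        proof (rule order.trans[OF mono bspec[OF elim(1) \<sigma>]], intro CollectI bexI conjI)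
          fix X
          assume X: "X \<in> set_pmf (?M m \<sigma>)" "X \<in> {X. (\<sigma>, {e. X e}) \<notin> {(\<sigma>, H). est (2*m) H \<in> {\<sigma>, (\<lambda>v. - \<sigma> v)}}}"
          note opt = trunc_optimalD[OF optimal[OF elim(2) X(1)]]
          show "est (2*m) {e. X e} \<in> balanced_labels (2*m)" by (rule opt)
          show "trunc_objective (2*m) {e. X e} \<sigma> \<le> trunc_objective (2*m) {e. X e} (est (2*m) {e. X e})"
            by (rule opt(2)[OF \<sigma>])
          show "est (2*m) {e. X e} \<noteq> \<sigma>" "est (2*m) {e. X e} \<noteq> (\<lambda>v. - \<sigma> v)" using X(2) by auto
        qed
      qed simp
    qed
  qed
qed

end
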